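(* Let $X$ be a $\frac{d}{dm}\frac{d}{ds}$-diffusion on $[0,b)$ $(0<b\le\infty)$ such that the boundary $b$ is natural, $\lambda_0>0$ and $s(b)=\infty$. Assume that the first hitting uniqueness holds on $\mathcal{P}_{\mathrm{exp}}$. Let $\lambda>0$ and let $\nu_\lambda$ be a probability distribution on $(0,b)$ such that $$\mathbb{P}_{\nu_\lambda}[T_0\in dt]=\lambda e^{-\lambda t}\,dt .$$ Let $\mu$ be a probability distribution on $[0,b)$ with $\mu\neq\delta_0$, and set $$\mu_t(dx)=\mathbb{P}_\mu[X_t\in dx\mid T_0>t]\qquad(t>0).$$ Then the following are equivalent: (i) $\displaystyle\lim_{t\to\infty}\frac{\mathbb{P}_\mu[T_0>t+s]}{\mathbb{P}_\mu[T_0>t]}=e^{-\lambda s}$ for every $s>0$. (ii) $\mathbb{P}_{\mu_t}[T_0\in ds]\to\lambda e^{-\lambda s}\,ds$ as $t\to\infty$ (weak convergence of probability distributions). (iii) $\mu_t\to\nu_\lambda$ as $t\to\infty$ (weak convergence of probability distributions).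
   Context: Diffusions. Let $0<b\le\infty$ and $I=[0,b)$. $X=(X_t)_{t\ge0}$ with laws $(\mathbb{P}_x)_{x\in I}$ is a one-dimensional diffusion on $I$: a time-homogeneous strong Markov process with continuous paths, killed nowhere. $T_y$ denotes the first hitting time of $y$. It is assumed that $\mathbb{P}_x[T_y<\infty]>0$ for all $x\in I\setminus\{0\}$ and $y\in[0,b)$, and that $0$ is a trap: $X_t=0$ for $t\ge T_0$. For a probability distribution $\mu$ on $I$, $\mathbb{P}_\mu$ is the law of $X$ with initial distribution $\mu$. There are a Radon measure $m$ on $(0,b)$ with full support (speed measure) and a strictly increasing continuous function $s$ on $(0,b)$ (scale function) such that the local generator of $X$ on $(0,b)$ is $\frac{d}{dm}\frac{d}{ds}$; then $X$ is called a $\frac{d}{dm}\frac{d}{ds}$-diffusion. Write $s(b)=\lim_{x\to b}s(x)$. Boundaries. For $c\in\{0,b\}$ and $d\in(0,b)$ let $I(c)=\int_c^d ds(x)\int_c^x dm(y)$ and $J(c)=\int_c^d dm(x)\int_c^x ds(y)$ (for $c=b$: $I(b)=\int_d^b ds(x)\int_x^b dm(y)$, $J(b)=\int_d^b dm(x)\int_x^b ds(y)$). The boundary $c$ is regular if $I(c)<\infty,J(c)<\infty$; exit if $I(c)=\infty,J(c)<\infty$; entrance if $I(c)<\infty,J(c)=\infty$; natural if $I(c)=J(c)=\infty$. Since $\mathbb{P}_x[T_0<\infty]>0$ for every $x\in I\setminus\{0\}$, the boundary $0$ is regular or exit. Spectral bottom. $\lambda_0\ge0$ is the infimum of the spectrum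 of the non-negative definite self-adjoint operator $-\frac{d}{dm}\frac{d}{ds}$ on $L^2((0,b),dm)$ with Dirichlet boundary condition at $0$. First hitting uniqueness. For a class $\mathcal{P}$ of initial distributions, the first hitting uniqueness holds on $\mathcal{P}$ if the map $\mathcal{P}\ni\mu\mapsto\mathbb{P}_\mu[T_0\in dt]$ is injective. $\mathcal{P}_{\mathrm{exp}}$ is the set of probability distributions $\mu$ on $[0,b)$ such that $\mathbb{P}_\mu[T_0\in dt]=\lambda e^{-\lambda t}dt$ for some $\lambda>0$. *)

theory Defs
  imports "HOL-Probability.Probability"
begin

section \<open>State space and processes\<close>

text \<open>The right end point \<open>b\<close> is an extended real, so that \<open>b = \<infinity>\<close> is allowed.\<close>

definition half_open :: "ereal \<Rightarrow> real set" where
  "half_open b = {x. 0 \<le> x \<and> ereal x < b}"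

definition open_part :: "ereal \<Rightarrow> real set" where
  "open_part b = {x. 0 < x \<and> ereal x < b}"

abbreviation state_space :: "ereal \<Rightarrow> real measure" where
  "state_space b \<equiv> restrict_space borel (half_open b)"

abbreviation distributions :: "ereal \<Rightarrow> real measure set" where
  "distributions b \<equiv> space (prob_algebra (state_space b))"

text \<open>Times live in \<^typ>\<open>ennreal\<close>: this accommodates infinite stopping times, and the
  filtration at time \<open>\<infinity>\<close> is the \<open>\<sigma>\<close>-algebra of the whole path.\<close>

definition natural_filtration :: "'w set \<Rightarrow> (real \<Rightarrow> 'w \<Rightarrow> real) \<Rightarrow> ennreal \<Rightarrow> 'w measure" where
  "natural_filtration \<Omega> X t =
     sigma \<Omega> {X u -` A \<inter> \<Omega> | u A. 0 \<le> u \<and> ennreal u \<le> t \<and> A \<in> sets borel}"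

definition right_filtration :: "'w set \<Rightarrow> (real \<Rightarrow> 'w \<Rightarrow> real) \<Rightarrow> ennreal \<Rightarrow> 'w measure" where
  "right_filtration \<Omega> X t =
     sigma \<Omega> (\<Inter>u\<in>insert \<infinity> {t<..}. sets (natural_filtration \<Omega> X u))"

abbreviation path_algebra :: "'w set \<Rightarrow> (real \<Rightarrow> 'w \<Rightarrow> real) \<Rightarrow> 'w measure" where
  "path_algebra \<Omega> X \<equiv> natural_filtration \<Omega> X \<infinity>"

definition hitting_time :: "(real \<Rightarrow> 'w \<Rightarrow> real) \<Rightarrow> real \<Rightarrow> 'w \<Rightarrow> ennreal" where
  "hitting_time X y \<omega> = Inf {ennreal t | t. 0 \<le> t \<and> X t \<omega> = y}"

definition exit_time :: "(real \<Rightarrow> 'w \<Rightarrow> real) \<Rightarrow> real set \<Rightarrow> 'w \<Rightarrow> ennreal" where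
  "exit_time X U \<omega> = Inf {ennreal t | t. 0 \<le> t \<and> X t \<omega> \<notin> U}"

lemma space_natural_filtration [simp]: "space (natural_filtration \<Omega> X t) = \<Omega>"
  unfolding natural_filtration_def by (rule space_measure_of) auto

lemma sets_natural_filtration_mono:
  assumes "t \<le> u"
  shows "sets (natural_filtration \<Omega> X t) \<subseteq> sets (natural_filtration \<Omega> X u)"
proof -
  have "{X v -` A \<inter> \<Omega> | v A. 0 \<le> v \<and> ennreal v \<le> t \<and> A \<in> sets borel}
      \<subseteq> {X v -` A \<inter> \<Omega> | v A. 0 \<le> v \<and> ennreal v \<le> u \<and> A \<in> sets borel}"
    using assms by (blast intro: order_trans)
  then show ?thesis
    unfolding natural_filtration_def
    by (subst (1 2) sets_measure_of) (auto intro!: sigma_sets_mono')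
qed

lemma filtration_right_filtration: "filtration \<Omega> (right_filtration \<Omega> X)"
proof
  have sub: "(\<Inter>u\<in>insert \<infinity> {t<..}. sets (natural_filtration \<Omega> X u)) \<subseteq> Pow \<Omega>" for t
    using sets.space_closed[of "natural_filtration \<Omega> X \<infinity>"] by auto
  show "space (right_filtration \<Omega> X t) = \<Omega>" for t
    unfolding right_filtration_def by (rule space_measure_of[OF sub])
  fix t u :: ennreal assume "t \<le> u"
  then have "insert \<infinity> {u<..} \<subseteq> insert \<infinity> {t<..}" by auto
  then show "sets (right_filtration \<Omega> X t) \<subseteq> sets (right_filtration \<Omega> X u)"
    unfolding right_filtration_def sets_measure_of[OF sub]
    by (intro sigma_sets_mono' INF_superset_mono) auto
qed

text \<open>The strong Markov property is stated for stopping times of the right-continuous filtration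
  \<open>(F\<^sub>t\<^sub>+)\<close> and for one later time \<open>t\<close>; as \<open>T + t\<close> is again a stopping time, it extends by iteration
  to events depending on the whole path after \<open>T\<close>.\<close>

definition strong_Markov ::
    "'w set \<Rightarrow> ereal \<Rightarrow> (real \<Rightarrow> 'w \<Rightarrow> real) \<Rightarrow> (real \<Rightarrow> 'w measure) \<Rightarrow> bool" where
  "strong_Markov \<Omega> b X P \<longleftrightarrow>
     (\<forall>T. stopping_time (right_filtration \<Omega> X) T \<longrightarrow>
       (\<forall>x\<in>half_open b. \<forall>A\<in>sets (filtration.pre_sigma \<Omega> (right_filtration \<Omega> X) T).
        \<forall>t\<ge>0. \<forall>B\<in>sets (state_space b).
          emeasure (P x) {\<omega>\<in>A. T \<omega> < \<infinity> \<and> X (enn2real (T \<omega>) + t) \<omega> \<in> B} =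
          (\<integral>\<^sup>+\<omega>. indicator {\<omega>\<in>A. T \<omega> < \<infinity>} \<omega> *
             emeasure (P (X (enn2real (T \<omega>)) \<omega>)) {\<omega>'\<in>\<Omega>. X t \<omega>' \<in> B} \<partial>P x)))"

section \<open>The operator d/dm d/ds and the local generator\<close>

text \<open>\<open>h\<close> is the right derivative \<open>df/ds\<close>; it is right continuous with \<open>dh = g dm\<close>.
  The definition is polymorphic so that it serves both the (real) generator of the process and
  the operator on the complex Hilbert space \<open>L\<^sup>2(m)\<close>.\<close>

definition has_dm_ds ::
    "real measure \<Rightarrow> (real \<Rightarrow> real) \<Rightarrow> real set \<Rightarrow>
     (real \<Rightarrow> 'a::{banach, second_countable_topology}) \<Rightarrow> (real \<Rightarrow> 'a) \<Rightarrow> bool" where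
  "has_dm_ds m s U f g \<longleftrightarrow> continuous_on U f \<and>
     (\<exists>h. (\<forall>x\<in>U. ((\<lambda>y. (f y - f x) /\<^sub>R (s y - s x)) \<longlongrightarrow> h x) (at_right x)) \<and>
          (\<forall>x\<in>U. \<forall>y\<in>U. x < y \<longrightarrow>
             set_integrable m {x<..y} g \<and> h y - h x = (LINT z:{x<..y}|m. g z)))"

text \<open>Dynkin's form of the local generator:
  \<open>lim (E\<^sub>x[f(X\<^sub>\<tau>)] - f(x)) / E\<^sub>x[\<tau>]\<close>, with \<open>\<tau>\<close> the exit time of \<open>(a, c)\<close>, as \<open>a \<up> x\<close> and \<open>c \<down> x\<close>.
  Under \<open>P\<^sub>x\<close> the point \<open>X\<^sub>\<tau>\<close> is almost surely in \<open>[a, c]\<close>; the restriction to this event keeps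
  the values of \<open>f\<close> far away from \<open>x\<close> (where \<open>f\<close> may fail to be measurable) out of the
  expectation.\<close>

definition local_generator ::
    "(real \<Rightarrow> 'w \<Rightarrow> real) \<Rightarrow> (real \<Rightarrow> 'w measure) \<Rightarrow> (real \<Rightarrow> real) \<Rightarrow> real \<Rightarrow> real \<Rightarrow> bool" where
  "local_generator X P f x v \<longleftrightarrow>
     ((\<lambda>(a, c). let \<tau> = (\<lambda>\<omega>. enn2real (exit_time X {a<..<c} \<omega>)) in
          ((LINT \<omega>:{\<omega>. X (\<tau> \<omega>) \<omega> \<in> {a..c}}|P x. f (X (\<tau> \<omega>) \<omega>)) - f x)
            / enn2real (\<integral>\<^sup>+\<omega>. exit_time X {a<..<c} \<omega> \<partial>P x))
      \<longlongrightarrow> v) (at_left x \<times>\<^sub>F at_right x)"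

definition speed_measure :: "ereal \<Rightarrow> real measure \<Rightarrow> bool" where
  "speed_measure b m \<longleftrightarrow> sets m = sets (restrict_space borel (open_part b)) \<and>
     (\<forall>K. compact K \<and> K \<subseteq> open_part b \<longrightarrow> emeasure m K < \<infinity>) \<and>
     (\<forall>U. open U \<and> U \<noteq> {} \<and> U \<subseteq> open_part b \<longrightarrow> 0 < emeasure m U)"

definition scale_function :: "ereal \<Rightarrow> (real \<Rightarrow> real) \<Rightarrow> bool" where
  "scale_function b s \<longleftrightarrow> strict_mono_on (open_part b) s \<and> continuous_on (open_part b) s"

section \<open>Diffusions\<close>

locale diffusion =
  fixes \<Omega> :: "'w set" and b :: ereal
    and X :: "real \<Rightarrow> 'w \<Rightarrow> real" and P :: "real \<Rightarrow> 'w measure"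
  assumes b_pos: "0 < b"
    and X_in_state: "\<And>t \<omega>. 0 \<le> t \<Longrightarrow> \<omega> \<in> \<Omega> \<Longrightarrow> X t \<omega> \<in> half_open b"
    and continuous_paths: "\<And>\<omega>. \<omega> \<in> \<Omega> \<Longrightarrow> continuous_on {0..} (\<lambda>t. X t \<omega>)"
    and kernel: "P \<in> state_space b \<rightarrow>\<^sub>M prob_algebra (path_algebra \<Omega> X)"
    and start: "\<And>x. x \<in> half_open b \<Longrightarrow> AE \<omega> in P x. X 0 \<omega> = x"
    and strong_Markov: "strong_Markov \<Omega> b X P"
    and hits: "\<And>x y. x \<in> half_open b - {0} \<Longrightarrow> y \<in> half_open b \<Longrightarrow>
                 0 < measure (P x) {\<omega>\<in>\<Omega>. hitting_time X y \<omega> < \<infinity>}"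
    and trap: "\<And>x. x \<in> half_open b \<Longrightarrow>
                 AE \<omega> in P x. \<forall>t\<ge>0. hitting_time X 0 \<omega> \<le> ennreal t \<longrightarrow> X t \<omega> = 0"

text \<open>The generator condition is an equality of operators (domain and value) on every open
  subinterval of \<open>(0, b)\<close>.\<close>

locale dm_ds_diffusion = diffusion \<Omega> b X P
  for \<Omega> :: "'w set" and b :: ereal
    and X :: "real \<Rightarrow> 'w \<Rightarrow> real" and P :: "real \<Rightarrow> 'w measure" +
  fixes m :: "real measure" and s :: "real \<Rightarrow> real"
  assumes speed: "speed_measure b m"
    and scale: "scale_function b s"
    and generator: "\<And>p q f g. 0 \<le> p \<Longrightarrow> p < q \<Longrightarrow> ereal q \<le> b \<Longrightarrow>
          continuous_on {p<..<q} f \<Longrightarrow> continuous_on {p<..<q} g \<Longrightarrow>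
          has_dm_ds m s {p<..<q} f g \<longleftrightarrow> (\<forall>x\<in>{p<..<q}. local_generator X P f x (g x))"

section \<open>The boundary b\<close>

text \<open>The Stieltjes measure \<open>ds\<close> on \<open>(0, b)\<close> is the image of Lebesgue measure under the inverse
  of \<open>s\<close>.  (\<open>interval_measure\<close> is not applicable: \<open>s\<close> need not extend to a monotone function
  on the whole line.)\<close>

definition stieltjes :: "ereal \<Rightarrow> (real \<Rightarrow> real) \<Rightarrow> real measure" where
  "stieltjes b s = distr (restrict_space lborel (s ` open_part b))
     (restrict_space borel (open_part b)) (the_inv_into (open_part b) s)"

lemma open_part_between:
  "x \<in> open_part b \<Longrightarrow> y \<in> open_part b \<Longrightarrow> x \<le> z \<Longrightarrow> z \<le> y \<Longrightarrow> z \<in> open_part b"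
  unfolding open_part_def
  by (metis (mono_tags, lifting) ereal_less_eq(3) mem_Collect_eq order_le_less_trans
      order_less_le_trans)

lemma emeasure_stieltjes_Ioc:
  assumes s: "scale_function b s" and xy: "x \<in> open_part b" "y \<in> open_part b" "x \<le> y"
  shows "emeasure (stieltjes b s) {x<..y} = ennreal (s y - s x)"
proof -
  let ?U = "open_part b" and ?V = "s ` open_part b"
  let ?i = "the_inv_into ?U s"
  have mono: "strict_mono_on ?U s" and cont: "continuous_on ?U s"
    using s by (auto simp: scale_function_def)
  have inj: "inj_on s ?U" by (rule strict_mono_on_imp_inj_on[OF mono])
  have less: "s u < s v \<longleftrightarrow> u < v" if "u \<in> ?U" "v \<in> ?U" for u v
    using strict_mono_on_less[OF mono] that by auto
  have le: "s u \<le> s v \<longleftrightarrow> u \<le> v" if "u \<in> ?U" "v \<in> ?U" for u v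
    using strict_mono_on_less_eq[OF mono] that by auto
  have conn: "is_interval ?V"
    unfolding is_interval_connected_1
    by (rule connected_continuous_image[OF cont])
      (meson connected_iff_interval open_part_between)
  have V: "?V \<in> sets borel" by (rule real_interval_borel_measurable[OF conn])
  have i_mono: "mono_on ?V ?i"
    using le by (auto simp: mono_on_def the_inv_into_f_f[OF inj])
  have i_meas: "?i \<in> restrict_space lborel ?V \<rightarrow>\<^sub>M restrict_space borel ?U"
  proof (rule measurable_restrict_space2)
    show "?i \<in> space (restrict_space lborel ?V) \<rightarrow> ?U"
      by (auto simp: space_restrict_space the_inv_into_f_f[OF inj])
    have "sets (restrict_space lborel ?V) = sets (restrict_space borel ?V)"
      by (simp add: sets_restrict_space)
    then show "?i \<in> restrict_space lborel ?V \<rightarrow>\<^sub>M borel"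
      using borel_measurable_mono_on_fnc[OF i_mono] measurable_cong_sets by blast
  qed
  have sub: "{x<..y} \<subseteq> ?U"
    using open_part_between[OF xy(1,2)] by auto
  have eq: "?i -` {x<..y} \<inter> ?V = {s x<..s y}"
  proof (intro set_eqI iffI)
    fix z assume z: "z \<in> {s x<..s y}"
    then have "z \<in> ?V"
      using conn xy unfolding is_interval_1 by (metis greaterThanAtMost_iff imageI less_imp_le)
    then show "z \<in> ?i -` {x<..y} \<inter> ?V"
      using z less le xy by (auto simp: the_inv_into_f_f[OF inj])
  next
    fix z assume "z \<in> ?i -` {x<..y} \<inter> ?V"
    then show "z \<in> {s x<..s y}"
      using less le xy by (auto simp: the_inv_into_f_f[OF inj])
  qed
  have subV: "{s x<..s y} \<subseteq> ?V" using eq by blast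
  have "emeasure (stieltjes b s) {x<..y} = emeasure (restrict_space lborel ?V) {s x<..s y}"
    unfolding stieltjes_def using sub
    by (subst emeasure_distr[OF i_meas])
      (auto simp: sets_restrict_space space_restrict_space eq intro!: image_eqI[of _ _ "{x<..y}"])
  also have "\<dots> = emeasure lborel {s x<..s y}"
    using V subV by (intro emeasure_restrict_space) auto
  also have "\<dots> = ennreal (s y - s x)"
    using le xy by auto
  finally show ?thesis .
qed

definition boundary_I :: "ereal \<Rightarrow> real measure \<Rightarrow> (real \<Rightarrow> real) \<Rightarrow> real \<Rightarrow> ennreal" where
  "boundary_I b m s d =
     (\<integral>\<^sup>+x. indicator {d<..} x * emeasure m {y\<in>open_part b. x < y} \<partial>stieltjes b s)"

definition boundary_J :: "ereal \<Rightarrow> real measure \<Rightarrow> (real \<Rightarrow> real) \<Rightarrow> real \<Rightarrow> ennreal" where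
  "boundary_J b m s d =
     (\<integral>\<^sup>+x. indicator {d<..} x * emeasure (stieltjes b s) {y\<in>open_part b. x < y} \<partial>m)"

text \<open>Whether the integrals are finite does not depend on \<open>d\<close>.\<close>

definition natural_boundary :: "ereal \<Rightarrow> real measure \<Rightarrow> (real \<Rightarrow> real) \<Rightarrow> bool" where
  "natural_boundary b m s \<longleftrightarrow>
     (\<forall>d\<in>open_part b. boundary_I b m s d = \<infinity> \<and> boundary_J b m s d = \<infinity>)"

definition scale_at_b :: "ereal \<Rightarrow> (real \<Rightarrow> real) \<Rightarrow> ereal" where
  "scale_at_b b s = Lim (at_left b) (\<lambda>x. ereal (s (real_of_ereal x)))"

section \<open>Spectral bottom\<close>

text \<open>Elements of \<open>L\<^sup>2(m)\<close> are represented by functions, to be identified when equal almost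
  everywhere.\<close>

definition L2 :: "real measure \<Rightarrow> (real \<Rightarrow> complex) set" where
  "L2 m = {f \<in> borel_measurable m. integrable m (\<lambda>x. (cmod (f x))\<^sup>2)}"

definition L2_norm :: "real measure \<Rightarrow> (real \<Rightarrow> complex) \<Rightarrow> real" where
  "L2_norm m f = sqrt (LINT x|m. (cmod (f x))\<^sup>2)"

text \<open>The graph of \<open>- d/dm d/ds\<close> with Dirichlet condition at \<open>0\<close>; \<open>f\<close> is the continuous
  representative of its class, which is unique since \<open>m\<close> has full support.  No condition is
  imposed at \<open>b\<close>: a natural boundary is of limit point type, so the operator is self-adjoint
  as it stands.\<close>

definition dirichlet_graph ::
    "ereal \<Rightarrow> real measure \<Rightarrow> (real \<Rightarrow> real) \<Rightarrow> ((real \<Rightarrow> complex) \<times> (real \<Rightarrow> complex)) set" where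
  "dirichlet_graph b m s = {(f, g). f \<in> L2 m \<and> g \<in> L2 m \<and>
     has_dm_ds m s (open_part b) f (\<lambda>x. - g x) \<and> (f \<longlongrightarrow> 0) (at_right 0)}"

definition resolvent_set :: "ereal \<Rightarrow> real measure \<Rightarrow> (real \<Rightarrow> real) \<Rightarrow> complex set" where
  "resolvent_set b m s = {z.
     (\<forall>\<phi>\<in>L2 m. \<exists>(f, g)\<in>dirichlet_graph b m s. AE x in m. g x - z * f x = \<phi> x) \<and>
     (\<exists>C. \<forall>(f, g)\<in>dirichlet_graph b m s. L2_norm m f \<le> C * L2_norm m (\<lambda>x. g x - z * f x))}"

definition spectral_bottom :: "ereal \<Rightarrow> real measure \<Rightarrow> (real \<Rightarrow> real) \<Rightarrow> real" where
  "spectral_bottom b m s = Inf (Re ` (- resolvent_set b m s))"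

section \<open>Laws, hitting uniqueness and weak convergence\<close>

definition initial_law :: "(real \<Rightarrow> 'w measure) \<Rightarrow> real measure \<Rightarrow> 'w measure" where
  "initial_law P \<mu> = \<mu> \<bind> P"

definition hitting_law ::
    "(real \<Rightarrow> 'w \<Rightarrow> real) \<Rightarrow> (real \<Rightarrow> 'w measure) \<Rightarrow> real measure \<Rightarrow> ennreal measure" where
  "hitting_law X P \<mu> = distr (initial_law P \<mu>) borel (hitting_time X 0)"

definition survival ::
    "'w set \<Rightarrow> (real \<Rightarrow> 'w \<Rightarrow> real) \<Rightarrow> real \<Rightarrow> 'w set" where
  "survival \<Omega> X t = {\<omega>\<in>\<Omega>. ennreal t < hitting_time X 0 \<omega>}"

definition conditional_law ::
    "'w set \<Rightarrow> ereal \<Rightarrow> (real \<Rightarrow> 'w \<Rightarrow> real) \<Rightarrow> (real \<Rightarrow> 'w measure) \<Rightarrow> real measure \<Rightarrow> real \<Rightarrow>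
     real measure" where
  "conditional_law \<Omega> b X P \<mu> t =
     distr (uniform_measure (initial_law P \<mu>) (survival \<Omega> X t)) (state_space b) (X t)"

text \<open>The exponential distribution as a distribution of \<open>[0, \<infinity>]\<close>-valued times.\<close>

definition exponential_law :: "real \<Rightarrow> ennreal measure" where
  "exponential_law l = distr (density lborel (exponential_density l)) borel ennreal"

definition first_hitting_uniqueness ::
    "(real \<Rightarrow> 'w \<Rightarrow> real) \<Rightarrow> (real \<Rightarrow> 'w measure) \<Rightarrow> real measure set \<Rightarrow> bool" where
  "first_hitting_uniqueness X P \<P> \<longleftrightarrow> inj_on (hitting_law X P) \<P>"

definition P_exp ::
    "ereal \<Rightarrow> (real \<Rightarrow> 'w \<Rightarrow> real) \<Rightarrow> (real \<Rightarrow> 'w measure) \<Rightarrow> real measure set" where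
  "P_exp b X P = {\<mu> \<in> distributions b. \<exists>l>0. hitting_law X P \<mu> = exponential_law l}"

text \<open>\<open>weak_conv_m\<close> covers sequences of measures on the line only; here the index is a
  continuous time and the measures live on \<open>[0, b)\<close> or \<open>[0, \<infinity>]\<close>.\<close>

definition weakly_converges ::
    "('i \<Rightarrow> 'a::topological_space measure) \<Rightarrow> 'a measure \<Rightarrow> 'i filter \<Rightarrow> bool" where
  "weakly_converges N M F \<longleftrightarrow>
     (\<forall>f :: 'a \<Rightarrow> real. continuous_on (space M) f \<and> bounded (f ` space M) \<longrightarrow>
        ((\<lambda>i. LINT x|N i. f x) \<longlongrightarrow> (LINT x|M. f x)) F)"

end

theory Submission
  imports Defs
begin

text \<open>By the Markov property the law of the hitting time \<open>T\<^sub>0\<close> under \<open>P\<^sub>\<mu>\<^sub>t\<close> has the tail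
  \<open>u \<mapsto> P\<^sub>\<mu>[T\<^sub>0 > t + u] / P\<^sub>\<mu>[T\<^sub>0 > t]\<close>, so (i) and (ii) are the same statement.

  Since \<open>\<nu>\<close> charges some \<open>x > 0\<close> from which \<open>0\<close> is hit almost surely, \<open>0\<close> is hit almost surely
  from every point.  Then \<open>x \<mapsto> E\<^sub>x[g(T\<^sub>0)]\<close> is continuous for continuous bounded \<open>g\<close>: all these
  laws are realised under a single \<open>P\<^sub>z\<close>, as laws of \<open>T\<^sub>0 - T\<close> for first passage times \<open>T\<close> below a
  level, and these times depend continuously on the level.  This gives (iii) \<open>\<Longrightarrow>\<close> (ii).

  For (ii) \<open>\<Longrightarrow>\<close> (iii), naturality of \<open>b\<close> forces \<open>P\<^sub>x[T\<^sub>0 \<le> u] \<rightarrow> 0\<close> as \<open>x \<rightarrow> b\<close>, so the \<open>\<mu>\<^sub>t\<close> are tight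
  in \<open>[0, b)\<close>; every limit point has hitting law \<open>\<lambda> e\<^sup>-\<^sup>\<lambda>\<^sup>t dt\<close> and equals \<open>\<nu>\<close> by uniqueness.\<close>

section \<open>Weak convergence of laws of times\<close>

text \<open>The strong Markov assumption speaks of one later time only, and no shift acts on the
  path space. Since \<open>0\<close> is a trap, however, \<open>T + t < T0\<close> means almost
  surely that \<open>X\<close> differs from \<open>0\<close> at time \<open>T + t\<close>. One later
  time therefore suffices for tails of \<open>T0\<close>, and tails determine a law on
  \<open>[0, \<infinity>]\<close>. This is why the work is done with survival events, and why
  shifting paths is replaced by an identity of laws: restarting at the position reached at time
  \<open>T\<close> gives the law of \<open>T0 - T\<close>.

  Two obstacles shape the rest. The generator assumption characterises d/dm d/ds on continuous
  functions only, so the continuity of the mean hitting time must come from path arguments; for this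
  reason the continuity result admits unbounded integrands with a dominating function. And tightness
  on the line does not stop mass from accumulating at a finite \<open>b\<close>; the tail estimates
  therefore use levels \<open>c\<close> strictly below \<open>b\<close>, and limits are first formed
  on the line and then shown to live on \<open>[0, b)\<close>.\<close>

lemma exponential_law_greaterThan:
  assumes "0 < l" "0 \<le> u"
  shows "measure (exponential_law l) {ennreal u<..} = exp (- (l * u))"
proof -
  let ?D = "density lborel (exponential_density l)"
  interpret prob_space ?D
    using assms by (intro prob_space_exponential_density)
  have "distributed ?D lborel (\<lambda>x. x) (exponential_density l)"
    by (auto simp: distributed_def distr_id2 sets_eq_imp_space_eq)
  from exponential_distributedD_gt[OF this assms(2,1)]
  have *: "measure ?D {x. u < x} = exp (- u * l)" by simp
  have "measure (exponential_law l) {ennreal u<..} = measure ?D (ennreal -` {ennreal u<..} \<inter> space ?D)"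
    unfolding exponential_law_def by (rule measure_distr) auto
  also have "ennreal -` {ennreal u<..} \<inter> space ?D = {x. u < x}"
    using assms by (auto simp: ennreal_less_iff)
  finally show ?thesis using * by (simp add: mult.commute)
qed

lemma prob_space_exponential_law: "0 < l \<Longrightarrow> prob_space (exponential_law l)"
  unfolding exponential_law_def
  by (intro prob_space.prob_space_distr prob_space_exponential_density) auto

lemma sets_exponential_law [simp]: "sets (exponential_law l) = sets borel"
  by (simp add: exponential_law_def)

lemma space_exponential_law [simp]: "space (exponential_law l) = UNIV"
  by (simp add: exponential_law_def)

text \<open>Rays \<open>{a<..}\<close> generate the Borel sets and are stable under intersection,
  but none of them contains \<open>0\<close>. \<open>UNIV\<close> is added to the generator so that
  it can serve as the exhausting sequence of the uniqueness theorem.\<close>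

lemma measure_ennreal_eqI:
  fixes M N :: "ennreal measure"
  assumes "sets M = sets borel" "sets N = sets borel" "prob_space M" "prob_space N"
    and eq: "\<And>r. 0 \<le> r \<Longrightarrow> emeasure M {ennreal r<..} = emeasure N {ennreal r<..}"
  shows "M = N"
proof (rule measure_eqI_generator_eq[where \<Omega> = UNIV and E = "insert UNIV (range greaterThan)" and A = "\<lambda>_. UNIV"])
  interpret M: prob_space M by fact
  interpret N: prob_space N by fact
  have sp: "space M = UNIV" "space N = UNIV"
    using assms(1,2)[THEN sets_eq_imp_space_eq] by auto
  have gen: "sets borel = sigma_sets UNIV (insert UNIV (range (greaterThan :: ennreal \<Rightarrow> _)))"
  proof -
    have "sets borel = sigma_sets UNIV (range (greaterThan :: ennreal \<Rightarrow> _))"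
      by (simp add: borel_Ioi)
    also have "\<dots> = sigma_sets UNIV (insert UNIV (range (greaterThan :: ennreal \<Rightarrow> _)))"
      by (intro sigma_sets_eqI) (auto intro: sigma_sets_top)
    finally show ?thesis .
  qed
  show "sets M = sigma_sets UNIV (insert UNIV (range greaterThan))"
    "sets N = sigma_sets UNIV (insert UNIV (range greaterThan))"
    using gen assms(1,2) by auto
  show "Int_stable (insert UNIV (range (greaterThan :: ennreal \<Rightarrow> _)))"
  proof -
    have "{a<..} \<inter> {b<..} = {max a b<..}" for a b :: ennreal by auto
    then show ?thesis by (auto simp: Int_stable_def)
  qed
  show "emeasure M UNIV \<noteq> \<infinity>" for i :: nat
    using M.emeasure_space_1 sp by simp
  fix Y :: "ennreal set" assume "Y \<in> insert UNIV (range greaterThan)"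
  then show "emeasure M Y = emeasure N Y"
  proof
    assume "Y = UNIV" then show ?thesis
      using M.emeasure_space_1 N.emeasure_space_1 sp by simp
  next
    assume "Y \<in> range greaterThan"
    then obtain a where Y: "Y = {a<..}" by auto
    show ?thesis
    proof (cases a)
      case top
      then have "Y = {}" using Y by (auto simp: top.extremum_strict)
      then show ?thesis by simp
    qed (auto simp: Y eq)
  qed
qed auto

text \<open>\<open>squash\<close> is a homeomorphism of \<open>[0, \<infinity>]\<close> onto \<open>[0, 1]\<close>; it transports weak
  convergence of laws of times to the theory of weak convergence on the line.\<close>

definition squash :: "ennreal \<Rightarrow> real" where
  "squash t = 1 - enn2real (inverse (1 + t))"

text \<open>The function \<open>y / (1 - y)\<close>, written so that truncation in
  \<open>ennreal\<close> extends it to the whole line: the value is \<open>0\<close> for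
  \<open>y \<le> 0\<close> and \<open>\<infinity>\<close> for \<open>y \<ge> 1\<close>. Composition
  with it turns a test function on \<open>[0, \<infinity>]\<close> into one on the line.\<close>

definition unsquash :: "real \<Rightarrow> ennreal" where
  "unsquash y = ennreal y * inverse (ennreal (1 - y))"

lemma squash_ennreal:
  assumes r: "0 \<le> r"
  shows "squash (ennreal r) = r / (1 + r)"
proof -
  have "inverse (1 + ennreal r) = inverse (ennreal (1 + r))"
    using r by (simp add: ennreal_plus)
  also have "\<dots> = ennreal (inverse (1 + r))" using r by (intro inverse_ennreal) simp
  finally have "squash (ennreal r) = 1 - inverse (1 + r)" using r by (simp add: squash_def)
  also have "\<dots> = r / (1 + r)" using r by (simp add: field_simps)
  finally show ?thesis .
qed

lemma squash_top: "squash \<infinity> = 1"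
  by (simp add: squash_def)

lemma unsquash_squash: "unsquash (squash t) = t"
proof (cases t)
  case (real r)
  have "unsquash (r / (1 + r)) = ennreal (r / (1 + r)) * ennreal (1 + r)"
    using real unfolding unsquash_def by (subst inverse_ennreal) (auto simp: field_simps)
  also have "\<dots> = ennreal (r / (1 + r) * (1 + r))" using real by (intro ennreal_mult[symmetric]) auto
  also have "\<dots> = ennreal r" using real by simp
  finally show ?thesis using real by (simp add: squash_ennreal)
qed (simp add: unsquash_def squash_top[unfolded infinity_ennreal_def])

lemma continuous_on_squash: "continuous_on UNIV squash"
proof -
  have *: "continuous_on UNIV (\<lambda>t::ennreal. inverse (1 + t))"
    by (intro continuous_on_inverse_ennreal continuous_on_add_ennreal continuous_on_const continuous_on_id)
  \<comment> \<open>\<open>enn2real\<close> is continuous only at finite values;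
    \<open>inverse (1 + t)\<close> never leaves them.\<close>
  have fin: "ennreal (enn2real (inverse (1 + t))) = inverse (1 + t)" for t :: ennreal
    by (intro ennreal_enn2real) (simp add: top.not_eq_extremum[symmetric] ennreal_inverse_eq_top_iff)
  have "continuous_on UNIV (\<lambda>t::ennreal. enn2real (inverse (1 + t)))"
    using * unfolding continuous_on_def by (auto intro!: tendsto_enn2real simp: fin)
  then show ?thesis unfolding squash_def[abs_def] by (intro continuous_intros)
qed

text \<open>Multiplication in \<open>ennreal\<close> is discontinuous only where \<open>0\<close>
  meets \<open>\<infinity>\<close>. The first factor vanishes for \<open>y \<le> 0\<close>, the
  second is infinite for \<open>y \<ge> 1\<close>, so this never happens.\<close>

lemma isCont_unsquash: "isCont unsquash y"
proof -
  have "isCont (\<lambda>y. inverse (ennreal (1 - y))) y"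
    by (intro continuous_on_interior[where S = UNIV] continuous_on_inverse_ennreal
        continuous_on_ennreal continuous_intros) auto
  then show ?thesis
    unfolding unsquash_def[abs_def] isCont_def
    by (intro tendsto_mult_ennreal tendsto_ennrealI tendsto_ident_at)
      (auto simp: ennreal_eq_0_iff ennreal_inverse_eq_top_iff)
qed

lemma squash_le_iff: "0 \<le> y \<Longrightarrow> y < 1 \<Longrightarrow> squash t \<le> y \<longleftrightarrow> t \<le> ennreal (y / (1 - y))"
  by (cases t) (auto simp: squash_ennreal squash_top[unfolded infinity_ennreal_def] field_simps
      top_unique)

lemma squash_nonneg: "0 \<le> squash t" and squash_le_1: "squash t \<le> 1"
  by (cases t; simp add: squash_ennreal squash_top[unfolded infinity_ennreal_def])+

lemma measurable_squash [measurable]: "squash \<in> borel_measurable borel"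
  by (intro borel_measurable_continuous_onI continuous_on_squash)

lemma real_distribution_squash:
  assumes "prob_space N" "sets N = sets borel"
  shows "real_distribution (distr N borel squash)"
proof -
  have "squash \<in> borel_measurable N"
    using assms(2) measurable_squash by (simp cong: measurable_cong_sets)
  then show ?thesis
    by (intro prob_space.real_distribution_distr) (use assms in auto)
qed

lemma cdf_squash:
  assumes N: "prob_space N" "sets N = sets borel" and y: "0 \<le> y" "y < 1"
  shows "cdf (distr N borel squash) y = 1 - measure N {ennreal (y / (1 - y))<..}"
proof -
  interpret prob_space N by fact
  have sp: "space N = UNIV" using sets_eq_imp_space_eq[OF N(2)] by simp
  have m: "squash \<in> borel_measurable N"
    using N(2) measurable_squash by (simp cong: measurable_cong_sets)
  have "cdf (distr N borel squash) y = measure N {t. squash t \<le> y}"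
    unfolding cdf_def using m by (subst measure_distr) (auto simp: sp intro!: arg_cong[where f="measure N"])
  also have "{t. squash t \<le> y} = space N - {ennreal (y / (1 - y))<..}"
    using y by (auto simp: squash_le_iff sp)
  also have "measure N \<dots> = 1 - measure N {ennreal (y / (1 - y))<..}"
    by (rule prob_compl) (simp add: N(2))
  finally show ?thesis .
qed

text \<open>Under \<open>squash\<close> a tail at \<open>u\<close> becomes one minus the
  distribution function at \<open>u / (1 + u)\<close>, and mass at \<open>\<infinity>\<close>
  becomes mass at \<open>1\<close>, so none is lost. Both halves are then the equivalence of
  convergence of distribution functions and of integrals on the line; the absence of an atom at
  \<open>u\<close> provides the continuity point.\<close>

lemma weak_conv_ennreal_seq:
  fixes N :: "nat \<Rightarrow> ennreal measure"
  assumes N: "\<And>n. prob_space (N n)" "\<And>n. sets (N n) = sets borel"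
    and M: "prob_space M" "sets M = sets borel"
  shows "(\<And>u. 0 \<le> u \<Longrightarrow> (\<lambda>n. measure (N n) {ennreal u<..}) \<longlonglongrightarrow> measure M {ennreal u<..})
      \<Longrightarrow> weakly_converges N M sequentially"
    and "weakly_converges N M sequentially \<Longrightarrow> 0 \<le> u \<Longrightarrow> measure M {ennreal u} = 0
      \<Longrightarrow> (\<lambda>n. measure (N n) {ennreal u<..}) \<longlonglongrightarrow> measure M {ennreal u<..}"
proof -
  let ?N = "\<lambda>n. distr (N n) borel squash" and ?M = "distr M borel squash"
  interpret N: real_distribution "?N n" for n using N by (rule real_distribution_squash)
  interpret M: real_distribution ?M using M by (rule real_distribution_squash)
  have mN: "squash \<in> borel_measurable (N n)" for n
    using N(2) measurable_squash by (simp cong: measurable_cong_sets)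
  have mM: "squash \<in> borel_measurable M"
    using M(2) measurable_squash by (simp cong: measurable_cong_sets)
  have spM: "space M = UNIV" using sets_eq_imp_space_eq[OF M(2)] by simp
  {
    assume *: "\<And>u. 0 \<le> u \<Longrightarrow> (\<lambda>n. measure (N n) {ennreal u<..}) \<longlonglongrightarrow> measure M {ennreal u<..}"
    have w: "weak_conv_m ?N ?M"
      unfolding weak_conv_m_def weak_conv_def
    proof (intro allI impI)
      fix y :: real
      \<comment> \<open>\<open>squash\<close> has values in \<open>[0, 1]\<close>, so outside
        \<open>[0, 1)\<close> every distribution function involved is constant, \<open>0\<close> on
        the left and \<open>1\<close> on the right.\<close>
      consider "y < 0" | "0 \<le> y" "y < 1" | "1 \<le> y" by linarith
      then show "(\<lambda>n. cdf (?N n) y) \<longlonglongrightarrow> cdf ?M y"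
      proof cases
        case 1
        have "cdf (distr K borel squash) y = 0" if "squash \<in> borel_measurable K" for K
        proof -
          have "squash -` {..y} \<inter> space K = {}" using 1 squash_nonneg by (auto simp: not_le) (meson not_le order_trans)
          then show ?thesis unfolding cdf_def using that by (subst measure_distr) auto
        qed
        then show ?thesis using mN mM by simp
      next
        case 2
        then show ?thesis
          using N M by (auto simp: cdf_squash intro!: tendsto_intros *)
      next
        case 3
        have "cdf (distr K borel squash) y = 1" if "squash \<in> borel_measurable K" "prob_space K" for K
        proof -
          have "squash -` {..y} \<inter> space K = space K" using 3 squash_le_1 by (auto intro: order_trans)
          then show ?thesis unfolding cdf_def using that by (subst measure_distr) (auto simp: prob_space.prob_space)
        qed
        then show ?thesis using mN mM N M by simp
      qed
    qed
    show "weakly_converges N M sequentially"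
      unfolding weakly_converges_def
    proof (intro allI impI)
      fix f :: "ennreal \<Rightarrow> real" assume "continuous_on (space M) f \<and> bounded (f ` space M)"
      then have f: "continuous_on UNIV f" and "bounded (range f)" by (auto simp: spM)
      then obtain B where B: "\<And>x. norm (f x) \<le> B" by (auto simp: bounded_iff)
      have fm: "f \<in> borel_measurable borel" using f by (rule borel_measurable_continuous_onI)
      have c: "isCont (\<lambda>y. f (unsquash y)) y" for y
        by (rule isCont_o2[OF isCont_unsquash]) (use f in \<open>simp add: continuous_on_eq_continuous_at\<close>)
      then have cm: "(\<lambda>y. f (unsquash y)) \<in> borel_measurable borel"
        by (intro borel_measurable_continuous_onI) (simp add: continuous_on_eq_continuous_at)
      have *: "(\<lambda>n. integral\<^sup>L (?N n) (\<lambda>y. f (unsquash y))) \<longlonglongrightarrow> integral\<^sup>L ?M (\<lambda>y. f (unsquash y))"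
        by (rule weak_conv_imp_integral_bdd_continuous_conv[OF _ _ w c B]) unfold_locales
      then show "(\<lambda>n. LINT x|N n. f x) \<longlonglongrightarrow> (LINT x|M. f x)"
        using integral_distr[OF mM cm] integral_distr[OF mN cm] by (simp add: unsquash_squash)
    qed
  }
  {
    assume *: "weakly_converges N M sequentially" and u: "0 \<le> u" "measure M {ennreal u} = 0"
    have w: "weak_conv_m ?N ?M"
    proof (rule integral_bdd_continuous_conv_imp_weak_conv)
      show "real_distribution (?N n)" "real_distribution ?M" for n by unfold_locales
      fix f :: "real \<Rightarrow> real" assume f: "\<And>x. isCont f x" "\<And>x. \<bar>f x\<bar> \<le> 1"
      then have fc: "continuous_on UNIV f" by (simp add: continuous_on_eq_continuous_at)
      have fm: "f \<in> borel_measurable borel" using fc by (rule borel_measurable_continuous_onI)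
      have "continuous_on UNIV (f \<circ> squash)"
        by (intro continuous_on_compose continuous_on_squash continuous_on_subset[OF fc]) auto
      moreover have "bounded (range (f \<circ> squash))" using f(2) by (auto simp: bounded_iff intro!: exI[of _ 1])
      ultimately have "(\<lambda>n. LINT x|N n. (f \<circ> squash) x) \<longlonglongrightarrow> (LINT x|M. (f \<circ> squash) x)"
        using * unfolding weakly_converges_def spM by blast
      then show "(\<lambda>n. integral\<^sup>L (?N n) f) \<longlonglongrightarrow> integral\<^sup>L ?M f"
        using integral_distr[OF mM fm] integral_distr[OF mN fm] by simp
    qed
    define y where "y = squash (ennreal u)"
    have y: "0 \<le> y" "y < 1" "y / (1 - y) = u"
      using u(1) by (auto simp: y_def squash_ennreal field_simps)
    have "squash -` {y} \<inter> space M = {ennreal u}"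
      unfolding spM y_def by (auto dest: arg_cong[where f = unsquash] simp: unsquash_squash)
    then have "measure ?M {y} = 0" using u(2) mM by (subst measure_distr) auto
    then have "isCont (cdf ?M) y" by (simp add: M.isCont_cdf)
    then have "(\<lambda>n. cdf (?N n) y) \<longlonglongrightarrow> cdf ?M y" using w unfolding weak_conv_m_def weak_conv_def by blast
    then have "(\<lambda>n. 1 - cdf (?N n) y) \<longlonglongrightarrow> 1 - cdf ?M y" by (intro tendsto_intros)
    then show "(\<lambda>n. measure (N n) {ennreal u<..}) \<longlonglongrightarrow> measure M {ennreal u<..}"
      using N M y by (simp add: cdf_squash)
  }
qed

lemma exponential_law_singleton:
  assumes u: "0 \<le> u"
  shows "measure (exponential_law l) {ennreal u} = 0"
proof -
  have "measure (exponential_law l) {ennreal u} =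
      measure (density lborel (exponential_density l)) (ennreal -` {ennreal u})"
    unfolding exponential_law_def by (subst measure_distr) auto
  also have "\<dots> = 0"
  proof -
    \<comment> \<open>The point \<open>0\<close> is removed as well because \<open>ennreal\<close>
      sends every negative number to \<open>0\<close>: for \<open>u = 0\<close> the preimage is a
      half line, on whose negative part the density vanishes.\<close>
    have "AE x in lborel. ennreal (exponential_density l x) * indicator (ennreal -` {ennreal u}) x = 0"
      using AE_lborel_singleton[of u] AE_lborel_singleton[of 0]
    proof eventually_elim
      fix x :: real assume "x \<noteq> u" "x \<noteq> 0"
      then show "ennreal (exponential_density l x) * indicator (ennreal -` {ennreal u}) x = 0"
        using u by (cases "x < 0") (auto simp: exponential_density_def)
    qed
    then have "emeasure (density lborel (exponential_density l)) (ennreal -` {ennreal u}) = 0"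
      using measurable_sets_borel[OF measurable_ennreal, of "{ennreal u}"]
      by (subst emeasure_density) (auto simp: nn_integral_0_iff_AE)
    then show ?thesis by (simp add: measure_def)
  qed
  finally show ?thesis .
qed

text \<open>Limits at infinity are tested along sequences \<open>T\<close>. Since \<open>N t\<close>
  is controlled for \<open>t \<ge> 0\<close> only, \<open>T n\<close> is replaced by
  \<open>max 0 (T n)\<close>, which changes finitely many terms. All \<open>u\<close> can appear
  because the exponential law has no atoms.\<close>

lemma weakly_converges_at_top_iff:
  fixes N :: "real \<Rightarrow> ennreal measure"
  assumes N: "\<And>t. 0 \<le> t \<Longrightarrow> prob_space (N t)" "\<And>t. 0 \<le> t \<Longrightarrow> sets (N t) = sets borel"
    and l: "0 < l"
  shows "weakly_converges N (exponential_law l) at_top \<longleftrightarrow>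
    (\<forall>u\<ge>0. ((\<lambda>t. measure (N t) {ennreal u<..}) \<longlongrightarrow> exp (- (l * u))) at_top)" (is "?L \<longleftrightarrow> ?R")
proof
  assume L: ?L
  show ?R
  proof (intro allI impI tendsto_at_topI_sequentially)
    fix u :: real and T :: "nat \<Rightarrow> real" assume u: "0 \<le> u" and T: "filterlim T at_top sequentially"
    have ev: "\<forall>\<^sub>F n in sequentially. 0 \<le> T n" using T by (simp add: filterlim_at_top)
    have "weakly_converges (\<lambda>n. N (max 0 (T n))) (exponential_law l) sequentially"
      unfolding weakly_converges_def
    proof (intro allI impI)
      fix f :: "ennreal \<Rightarrow> real"
      assume "continuous_on (space (exponential_law l)) f \<and> bounded (f ` space (exponential_law l))"
      with L have "((\<lambda>t. LINT x|N t. f x) \<longlongrightarrow> (LINT x|exponential_law l. f x)) at_top"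
        unfolding weakly_converges_def by blast
      then have "(\<lambda>n. LINT x|N (T n). f x) \<longlonglongrightarrow> (LINT x|exponential_law l. f x)"
        by (rule filterlim_compose[OF _ T])
      then show "(\<lambda>n. LINT x|N (max 0 (T n)). f x) \<longlonglongrightarrow> (LINT x|exponential_law l. f x)"
        by (rule Lim_transform_eventually) (use ev in eventually_elim, simp)
    qed
    moreover have "measure (exponential_law l) {ennreal u} = 0"
      by (rule exponential_law_singleton[OF u])
    ultimately have "(\<lambda>n. measure (N (max 0 (T n))) {ennreal u<..}) \<longlonglongrightarrow>
        measure (exponential_law l) {ennreal u<..}"
      by (intro weak_conv_ennreal_seq(2)) (use N l u in \<open>auto simp: prob_space_exponential_law\<close>)
    then have "(\<lambda>n. measure (N (max 0 (T n))) {ennreal u<..}) \<longlonglongrightarrow> exp (- (l * u))"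
      using l u by (simp add: exponential_law_greaterThan)
    then show "(\<lambda>n. measure (N (T n)) {ennreal u<..}) \<longlonglongrightarrow> exp (- (l * u))"
      by (rule Lim_transform_eventually) (use ev in eventually_elim, simp)
  qed
next
  assume R: ?R
  show ?L
    unfolding weakly_converges_def
  proof (intro allI impI tendsto_at_topI_sequentially)
    fix f :: "ennreal \<Rightarrow> real" and T :: "nat \<Rightarrow> real"
    assume f: "continuous_on (space (exponential_law l)) f \<and> bounded (f ` space (exponential_law l))"
      and T: "filterlim T at_top sequentially"
    have ev: "\<forall>\<^sub>F n in sequentially. 0 \<le> T n" using T by (simp add: filterlim_at_top)
    have "weakly_converges (\<lambda>n. N (max 0 (T n))) (exponential_law l) sequentially"
    proof (rule weak_conv_ennreal_seq(1))
      fix u :: real assume u: "0 \<le> u"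
      have "(\<lambda>n. measure (N (T n)) {ennreal u<..}) \<longlonglongrightarrow> exp (- (l * u))"
        using R u by (auto intro: filterlim_compose[OF _ T])
      then have "(\<lambda>n. measure (N (max 0 (T n))) {ennreal u<..}) \<longlonglongrightarrow> exp (- (l * u))"
        by (rule Lim_transform_eventually) (use ev in eventually_elim, simp)
      then show "(\<lambda>n. measure (N (max 0 (T n))) {ennreal u<..}) \<longlonglongrightarrow>
          measure (exponential_law l) {ennreal u<..}"
        using l u by (simp add: exponential_law_greaterThan)
    qed (use N l in \<open>auto simp: prob_space_exponential_law\<close>)
    with f have "(\<lambda>n. LINT x|N (max 0 (T n)). f x) \<longlonglongrightarrow> (LINT x|exponential_law l. f x)"
      unfolding weakly_converges_def by blast
    then show "(\<lambda>n. LINT x|N (T n). f x) \<longlonglongrightarrow> (LINT x|exponential_law l. f x)"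
      by (rule Lim_transform_eventually) (use ev in eventually_elim, simp)
  qed
qed

section \<open>Exit times of continuous paths\<close>

lemma exit_time_le: "0 \<le> t \<Longrightarrow> X t \<omega> \<notin> U \<Longrightarrow> exit_time X U \<omega> \<le> ennreal t"
  unfolding exit_time_def by (auto intro: Inf_lower)

lemma exit_time_less_iff:
  "exit_time X U \<omega> < c \<longleftrightarrow> (\<exists>t\<ge>0. ennreal t < c \<and> X t \<omega> \<notin> U)"
  unfolding exit_time_def by (auto simp: Inf_less_iff)

lemma exit_time_antimono: "V \<subseteq> U \<Longrightarrow> exit_time X V \<omega> \<le> exit_time X U \<omega>"
  unfolding exit_time_def by (rule Inf_superset_mono) auto

lemma hitting_time_eq_exit_time: "hitting_time X y = exit_time X (- {y})"
  by (simp add: fun_eq_iff hitting_time_def exit_time_def)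

lemma hitting_time_le: "0 \<le> t \<Longrightarrow> X t \<omega> = y \<Longrightarrow> hitting_time X y \<omega> \<le> ennreal t"
  by (simp add: hitting_time_eq_exit_time exit_time_le)

lemma exit_time_inside:
  assumes "0 \<le> t" "ennreal t < exit_time X U \<omega>"
  shows "X t \<omega> \<in> U"
  using exit_time_le[of t X \<omega> U] assms by (auto simp: not_le[symmetric])

context
  fixes X :: "real \<Rightarrow> 'w \<Rightarrow> real" and \<omega> :: 'w
  assumes cont: "continuous_on {0..} (\<lambda>t. X t \<omega>)"
begin

lemma path_tendsto:
  assumes "T \<longlonglongrightarrow> t" "\<And>n::nat. 0 \<le> T n"
  shows "(\<lambda>n. X (T n) \<omega>) \<longlonglongrightarrow> X t \<omega>"
  by (rule continuous_on_tendsto_compose[OF cont assms(1)])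
    (use assms LIMSEQ_le_const[OF assms(1)] in auto)

text \<open>The infimum is attained because the complement is closed: a path inside \<open>U\<close>
  at that instant would remain in \<open>U\<close> a little longer, and the infimum would be
  larger.\<close>

lemma X_exit_time_notin:
  assumes U: "open U" and fin: "exit_time X U \<omega> < \<infinity>"
  shows "X (enn2real (exit_time X U \<omega>)) \<omega> \<notin> U"
proof
  let ?r = "enn2real (exit_time X U \<omega>)"
  assume "X ?r \<omega> \<in> U"
  have "((\<lambda>t. X t \<omega>) \<longlongrightarrow> X ?r \<omega>) (at ?r within {0..})"
    using cont by (auto simp: continuous_on_def)
  then have "\<forall>\<^sub>F t in at ?r within {0..}. X t \<omega> \<in> U"
    using U \<open>X ?r \<omega> \<in> U\<close> by (rule topological_tendstoD)
  then obtain e where e: "0 < e" "\<And>t. 0 \<le> t \<Longrightarrow> t \<noteq> ?r \<Longrightarrow> dist t ?r < e \<Longrightarrow> X t \<omega> \<in> U"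
    unfolding eventually_at by auto
  have "exit_time X U \<omega> < ennreal (?r + e)"
    using fin e(1) by (metis add.commute enn2real_nonneg ennreal_enn2real ennreal_less_iff infinity_ennreal_def less_add_same_cancel2)
  then obtain t where t: "0 \<le> t" "ennreal t < ennreal (?r + e)" "X t \<omega> \<notin> U"
    unfolding exit_time_less_iff by auto
  have "?r \<le> t"
    using exit_time_le[of t X \<omega> U] t by (simp add: enn2real_leI)
  moreover have "t < ?r + e" using t by (simp add: ennreal_less_iff)
  ultimately show False
    using e(2)[of t] t \<open>X ?r \<omega> \<in> U\<close> by (cases "t = ?r") (auto simp: dist_real_def)
qed

text \<open>Strictly before the exit the path is in \<open>U\<close>, so its limit from the left
  lies in \<open>C\<close>. When the exit time is \<open>0\<close> nothing precedes it, and the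
  starting point decides.\<close>

lemma X_exit_time_closure:
  assumes start: "X 0 \<omega> \<in> U" and C: "closed C" "U \<subseteq> C" and fin: "exit_time X U \<omega> < \<infinity>"
  shows "X (enn2real (exit_time X U \<omega>)) \<omega> \<in> C"
proof (cases "enn2real (exit_time X U \<omega>) = 0")
  case True
  then show ?thesis using start C by auto
next
  case False
  define r where "r = enn2real (exit_time X U \<omega>)"
  have r: "0 < r" using False by (simp add: r_def order_less_le)
  have eq: "exit_time X U \<omega> = ennreal r" using fin by (simp add: r_def)
  define T where "T n = r * (1 - 1 / real (Suc n))" for n :: nat
  have "(\<lambda>n. r * (1 - 1 / real (Suc n))) \<longlonglongrightarrow> r * (1 - 0)"
    using LIMSEQ_inverse_real_of_nat by (intro tendsto_intros) (simp add: inverse_eq_divide)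
  then have T: "T \<longlonglongrightarrow> r" by (simp add: T_def[abs_def])
  have nn: "0 \<le> T n" for n unfolding T_def using r by (intro mult_nonneg_nonneg) auto
  have "T n < r" for n using r by (simp add: T_def field_simps)
  then have "X (T n) \<omega> \<in> C" for n
    using exit_time_inside[of "T n" X U \<omega>] nn[of n] C(2) eq by (auto simp: ennreal_less_iff)
  then show ?thesis
    unfolding r_def[symmetric] by (intro closed_sequentially[OF C(1) _ path_tendsto[OF T nn]]) auto
qed

lemma exit_time_pos:
  assumes U: "open U" and start: "X 0 \<omega> \<in> U"
  shows "0 < exit_time X U \<omega>"
proof (rule ccontr)
  assume "\<not> 0 < exit_time X U \<omega>"
  then have "exit_time X U \<omega> = 0" by (simp add: not_less)
  then show False using X_exit_time_notin[OF U] start by simp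
qed

lemma exists_rational_before:
  assumes t: "0 \<le> t" "t < c" and V: "open V" "X t \<omega> \<in> V"
  shows "\<exists>p\<in>\<rat>. 0 \<le> p \<and> p < c \<and> X p \<omega> \<in> V"
proof -
  have "((\<lambda>t. X t \<omega>) \<longlongrightarrow> X t \<omega>) (at t within {0..})"
    using cont t by (auto simp: continuous_on_def)
  then have "\<forall>\<^sub>F u in at t within {0..}. X u \<omega> \<in> V"
    using V by (rule topological_tendstoD)
  then obtain e where e: "0 < e" "\<And>u. 0 \<le> u \<Longrightarrow> u \<noteq> t \<Longrightarrow> dist u t < e \<Longrightarrow> X u \<omega> \<in> V"
    unfolding eventually_at by auto
  obtain p where p: "p \<in> \<rat>" "t < p" "p < min c (t + e)"
    using Rats_dense_in_real[of t "min c (t + e)"] t e by auto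
  then have "X p \<omega> \<in> V" using e(2)[of p] t by (auto simp: dist_real_def)
  then show ?thesis using p t by (intro bexI[of _ p]) auto
qed

text \<open>A countable description of the event. The distance to the closed complement attains its
  minimum over \<open>[0, q]\<close>, and if it falls below every \<open>1 / (n + 1)\<close> at
  rational times, that minimum is \<open>0\<close>. The margin \<open>q < r\<close> matters: over
  \<open>[0, r)\<close> the distance could tend to \<open>0\<close> towards \<open>r\<close> without
  being attained, and the exit time would equal \<open>r\<close>.\<close>

lemma exit_time_open_less_iff:
  assumes U: "open U" "U \<noteq> UNIV" and r: "0 < r"
  shows "exit_time X U \<omega> < ennreal r \<longleftrightarrow>
    (\<exists>q\<in>\<rat>. 0 < q \<and> q < r \<and> (\<forall>n. \<exists>p\<in>\<rat>. 0 \<le> p \<and> p < q \<and> infdist (X p \<omega>) (- U) < 1 / real (Suc n)))"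
proof
  assume "exit_time X U \<omega> < ennreal r"
  then obtain t where t: "0 \<le> t" "t < r" "X t \<omega> \<notin> U"
    unfolding exit_time_less_iff by (auto simp: ennreal_less_iff)
  obtain q where q: "q \<in> \<rat>" "t < q" "q < r" using Rats_dense_in_real t by blast
  have "\<exists>p\<in>\<rat>. 0 \<le> p \<and> p < q \<and> infdist (X p \<omega>) (- U) < 1 / real (Suc n)" for n
  proof -
    have "open {x. infdist x (- U) < 1 / real (Suc n)}"
      by (intro open_Collect_less continuous_on_infdist continuous_intros)
    from exists_rational_before[OF t(1) q(2) this]
    show ?thesis using t by (simp del: of_nat_Suc)
  qed
  then show "\<exists>q\<in>\<rat>. 0 < q \<and> q < r \<and> (\<forall>n. \<exists>p\<in>\<rat>. 0 \<le> p \<and> p < q \<and> infdist (X p \<omega>) (- U) < 1 / real (Suc n))"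
    using q t by (intro bexI[of _ q]) auto
next
  have cl: "closed (- U)" "- U \<noteq> {}" using U by auto
  have cc: "continuous_on {0..} (\<lambda>t. infdist (X t \<omega>) (- U))"
    by (intro continuous_on_infdist cont)
  assume "\<exists>q\<in>\<rat>. 0 < q \<and> q < r \<and> (\<forall>n. \<exists>p\<in>\<rat>. 0 \<le> p \<and> p < q \<and> infdist (X p \<omega>) (- U) < 1 / real (Suc n))"
  then obtain q where q: "0 < q" "q < r"
    and p: "\<And>n. \<exists>p\<in>\<rat>. 0 \<le> p \<and> p < q \<and> infdist (X p \<omega>) (- U) < 1 / real (Suc n)" by blast
  have "continuous_on {0..q} (\<lambda>t. infdist (X t \<omega>) (- U))"
    using cc by (rule continuous_on_subset) auto
  then obtain t where t: "0 \<le> t" "t \<le> q"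
      and min: "\<And>u. 0 \<le> u \<Longrightarrow> u \<le> q \<Longrightarrow> infdist (X t \<omega>) (- U) \<le> infdist (X u \<omega>) (- U)"
    using continuous_attains_inf[of "{0..q}" "\<lambda>t. infdist (X t \<omega>) (- U)"] q by auto
  have "infdist (X t \<omega>) (- U) < 1 / real (Suc n)" for n
    using p[of n] min by (metis less_imp_le order_le_less_trans)
  then have "infdist (X t \<omega>) (- U) = 0"
    by (metis infdist_nonneg nat_approx_posE order_less_le order_less_asym)
  then have "X t \<omega> \<in> - U" using in_closed_iff_infdist_zero[OF cl] by blast
  then show "exit_time X U \<omega> < ennreal r"
    using t q unfolding exit_time_less_iff
    by (intro exI[of _ t]) (auto simp: ennreal_less_iff)
qed

lemma exit_time_closed_less_iff:
  assumes U: "closed U"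
  shows "exit_time X U \<omega> < ennreal r \<longleftrightarrow> (\<exists>p\<in>\<rat>. 0 \<le> p \<and> p < r \<and> X p \<omega> \<notin> U)"
proof
  assume "exit_time X U \<omega> < ennreal r"
  then obtain t where t: "0 \<le> t" "t < r" "X t \<omega> \<in> - U"
    unfolding exit_time_less_iff by (auto simp: ennreal_less_iff)
  have "open (- U)" using U by auto
  from exists_rational_before[OF t(1,2) this t(3)]
  show "\<exists>p\<in>\<rat>. 0 \<le> p \<and> p < r \<and> X p \<omega> \<notin> U" by auto
next
  assume "\<exists>p\<in>\<rat>. 0 \<le> p \<and> p < r \<and> X p \<omega> \<notin> U"
  then show "exit_time X U \<omega> < ennreal r"
    unfolding exit_time_less_iff by (auto simp: ennreal_less_iff)
qed

end

text \<open>The strict inequality is deliberate. For the exit time of a closed set such as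
  \<open>{y..}\<close>, the event \<open>T \<le> r\<close> may depend on the path immediately after
  \<open>r\<close>, whereas \<open>T < r\<close> is decided by the path up to
  \<open>r\<close>.\<close>

definition optional_time :: "'w set \<Rightarrow> (real \<Rightarrow> 'w \<Rightarrow> real) \<Rightarrow> ('w \<Rightarrow> ennreal) \<Rightarrow> bool" where
  "optional_time \<Omega> X T \<longleftrightarrow>
     (\<forall>r>0. {\<omega>\<in>\<Omega>. T \<omega> < ennreal r} \<in> sets (natural_filtration \<Omega> X (ennreal r)))"

section \<open>Measurability of optional times\<close>

lemma measurable_natural_filtration:
  assumes "0 \<le> u" "ennreal u \<le> t"
  shows "X u \<in> borel_measurable (natural_filtration \<Omega> X t)"
proof (rule measurableI)
  fix A :: "real set" assume "A \<in> sets borel"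
  then show "X u -` A \<inter> space (natural_filtration \<Omega> X t) \<in> sets (natural_filtration \<Omega> X t)"
    using assms unfolding space_natural_filtration unfolding natural_filtration_def
    by (subst sets_measure_of) (auto intro!: sigma_sets.Basic)
qed auto

text \<open>For any \<open>u\<close> above a finite \<open>t\<close>, the event
  \<open>T \<le> t\<close> is the intersection of the events \<open>T < S n\<close> for a sequence
  \<open>S n\<close> strictly above \<open>t\<close>, tending to \<open>t\<close> and staying below
  \<open>u\<close>. Hence it belongs to the past of every such \<open>u\<close>, which is membership
  in the right-continuous filtration.\<close>

lemma stopping_time_optional:
  assumes T: "optional_time \<Omega> X T"
  shows "stopping_time (right_filtration \<Omega> X) T"
proof (rule stopping_timeI)
  fix t :: ennreal
  have "{\<omega>\<in>\<Omega>. T \<omega> \<le> t} \<in> sets (natural_filtration \<Omega> X u)" if u: "u = \<infinity> \<or> t < u" for u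
  proof (cases t)
    case top
    have "{\<omega>\<in>\<Omega>. T \<omega> \<le> t} = space (natural_filtration \<Omega> X u)" using top by auto
    then show ?thesis by (metis sets.top)
  next
    case (real r)
    have "t < u" using u real by auto
    then obtain v where v: "t < v" "v < u" using dense by blast
    then obtain v' where v': "v = ennreal v'" "r < v'"
      using real by (cases v) (auto simp: ennreal_less_iff)
    define S where "S n = r + (v' - r) / real (Suc n)" for n
    have S: "r < S n" "S n \<le> v'" for n
      using v' real divide_left_mono[of 1 "real (Suc n)" "v' - r"] by (auto simp: S_def)
    have "S \<longlonglongrightarrow> r + (v' - r) * 0"
      unfolding S_def divide_inverse by (intro tendsto_intros LIMSEQ_inverse_real_of_nat)
    then have lim: "(\<lambda>n. ennreal (S n)) \<longlonglongrightarrow> ennreal r" by (intro tendsto_ennrealI) simp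
    have "{\<omega>\<in>\<Omega>. T \<omega> \<le> t} = (\<Inter>n. {\<omega>\<in>\<Omega>. T \<omega> < ennreal (S n)})"
    proof (intro set_eqI iffI)
      fix \<omega> assume "\<omega> \<in> (\<Inter>n. {\<omega>\<in>\<Omega>. T \<omega> < ennreal (S n)})"
      then have "\<omega> \<in> \<Omega>" "\<And>n. T \<omega> \<le> ennreal (S n)" by (auto intro: less_imp_le)
      then show "\<omega> \<in> {\<omega>\<in>\<Omega>. T \<omega> \<le> t}"
        using LIMSEQ_le_const[OF lim] real by blast
    next
      fix \<omega> assume "\<omega> \<in> {\<omega>\<in>\<Omega>. T \<omega> \<le> t}"
      then show "\<omega> \<in> (\<Inter>n. {\<omega>\<in>\<Omega>. T \<omega> < ennreal (S n)})"
        using S(1) real by (auto intro: le_less_trans simp: ennreal_less_iff)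
    qed
    moreover have "{\<omega>\<in>\<Omega>. T \<omega> < ennreal (S n)} \<in> sets (natural_filtration \<Omega> X u)" for n
    proof -
      have "ennreal (S n) \<le> u" using S(2)[of n] v v' by (metis ennreal_leI less_imp_le order_trans)
      moreover have "0 < S n" using S(1)[of n] real by linarith
      ultimately show ?thesis
        using T sets_natural_filtration_mono unfolding optional_time_def by blast
    qed
    ultimately show ?thesis by auto
  qed
  then have *: "{\<omega>\<in>\<Omega>. T \<omega> \<le> t} \<in> (\<Inter>u\<in>insert \<infinity> {t<..}. sets (natural_filtration \<Omega> X u))" by auto
  have sub: "(\<Inter>u\<in>insert \<infinity> {t<..}. sets (natural_filtration \<Omega> X u)) \<subseteq> Pow \<Omega>"
    using sets.space_closed[of "natural_filtration \<Omega> X \<infinity>"] by auto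
  have "space (right_filtration \<Omega> X t) = \<Omega>"
    unfolding right_filtration_def by (rule space_measure_of[OF sub])
  then show "Measurable.pred (right_filtration \<Omega> X t) (\<lambda>\<omega>. T \<omega> \<le> t)"
    using * unfolding pred_def unfolding right_filtration_def sets_measure_of[OF sub]
    by (auto intro!: sigma_sets.Basic)
qed

lemma measurable_optional:
  assumes T: "optional_time \<Omega> X T"
  shows "T \<in> borel_measurable (path_algebra \<Omega> X)"
proof (rule borel_measurableI_less)
  have *: "{\<omega>\<in>\<Omega>. T \<omega> < ennreal r} \<in> sets (path_algebra \<Omega> X)" if "0 < r" for r
    using T sets_natural_filtration_mono[of "ennreal r" \<infinity> \<Omega> X] that unfolding optional_time_def by auto
  fix t :: ennreal
  show "{\<omega> \<in> space (path_algebra \<Omega> X). T \<omega> < t} \<in> sets (path_algebra \<Omega> X)"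
  proof (cases t)
    case (real r)
    then show ?thesis using * by (cases "r = 0") auto
  next
    case top
    have "{\<omega>\<in>\<Omega>. T \<omega> < t} = (\<Union>n::nat. {\<omega>\<in>\<Omega>. T \<omega> < ennreal (real (Suc n))})"
    proof (intro set_eqI iffI)
      fix \<omega> assume "\<omega> \<in> {\<omega>\<in>\<Omega>. T \<omega> < t}"
      then obtain r where "\<omega> \<in> \<Omega>" "T \<omega> = ennreal r" "0 \<le> r" using top by (cases "T \<omega>") auto
      moreover obtain n where "r < real n" using reals_Archimedean2 by blast
      ultimately show "\<omega> \<in> (\<Union>n::nat. {\<omega>\<in>\<Omega>. T \<omega> < ennreal (real (Suc n))})"
        by (auto simp: ennreal_less_iff simp del: of_nat_Suc intro!: exI[of _ n])
    next
      fix \<omega> assume "\<omega> \<in> (\<Union>n::nat. {\<omega>\<in>\<Omega>. T \<omega> < ennreal (real (Suc n))})"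
      then show "\<omega> \<in> {\<omega>\<in>\<Omega>. T \<omega> < t}" using top by (auto elim: less_trans)
    qed
    also have "\<dots> \<in> sets (path_algebra \<Omega> X)"
      by (intro sets.countable_UN) (use * in \<open>auto simp del: of_nat_Suc\<close>)
    finally show ?thesis by simp
  qed
qed

lemma optional_time_const: "optional_time \<Omega> X (\<lambda>_. c)"
proof -
  have "{\<omega>\<in>\<Omega>. c < ennreal r} \<in> sets (natural_filtration \<Omega> X (ennreal r))" for r
  proof (cases "c < ennreal r")
    case True
    then have "{\<omega>\<in>\<Omega>. c < ennreal r} = space (natural_filtration \<Omega> X (ennreal r))" by simp
    then show ?thesis by (metis sets.top)
  next
    case False
    then have "{\<omega>\<in>\<Omega>. c < ennreal r} = {}" by simp
    then show ?thesis by (metis sets.empty_sets)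
  qed
  then show ?thesis unfolding optional_time_def by blast
qed

lemma optional_exit_time:
  assumes cont: "\<And>\<omega>. \<omega> \<in> \<Omega> \<Longrightarrow> continuous_on {0..} (\<lambda>t. X t \<omega>)"
    and U: "open U \<or> closed U"
  shows "optional_time \<Omega> X (exit_time X U)"
  unfolding optional_time_def
proof (intro allI impI)
  fix r :: real assume r: "0 < r"
  let ?F = "natural_filtration \<Omega> X (ennreal r)"
  have X: "X p \<in> borel_measurable ?F" if "0 \<le> p" "p < r" for p
    using that by (intro measurable_natural_filtration) (auto intro: ennreal_leI)
  consider "closed U" | "open U" "U \<noteq> UNIV" using U by auto
  then show "{\<omega>\<in>\<Omega>. exit_time X U \<omega> < ennreal r} \<in> sets ?F"
  proof cases
    case 1
    have "{\<omega>\<in>\<Omega>. exit_time X U \<omega> < ennreal r} =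
        (\<Union>p\<in>\<rat> \<inter> {0..<r}. X p -` (- U) \<inter> space ?F)"
      using exit_time_closed_less_iff[of X _ U, OF cont 1] by (auto simp: Bex_def)
    also have "\<dots> \<in> sets ?F"
    proof (rule sets.countable_UN'')
      fix p assume "p \<in> \<rat> \<inter> {0..<r}"
      then have "X p \<in> borel_measurable ?F" by (intro X) auto
      moreover have "- U \<in> sets borel" using 1 by auto
      ultimately show "X p -` (- U) \<inter> space ?F \<in> sets ?F" by (rule measurable_sets)
    qed (intro countable_Int1 countable_rat)
    finally show ?thesis .
  next
    case 2
    have m: "(\<lambda>x. infdist x (- U)) \<in> borel_measurable borel"
      by (intro borel_measurable_continuous_onI continuous_on_infdist continuous_intros)
    have b1: "(\<exists>q\<in>\<rat>. 0 < q \<and> q < c \<and> Q q) \<longleftrightarrow> (\<exists>q\<in>\<rat> \<inter> {0<..<c}. Q q)" for Q and c :: real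
      by auto
    have b2: "(\<exists>q\<in>\<rat>. 0 \<le> q \<and> q < c \<and> Q q) \<longleftrightarrow> (\<exists>q\<in>\<rat> \<inter> {0..<c}. Q q)" for Q and c :: real
      by auto
    have "{\<omega>\<in>\<Omega>. exit_time X U \<omega> < ennreal r} =
        (\<Union>q\<in>\<rat> \<inter> {0<..<r}. \<Inter>n. \<Union>p\<in>\<rat> \<inter> {0..<q}.
          {\<omega>\<in>space ?F. infdist (X p \<omega>) (- U) < 1 / real (Suc n)})"
      using exit_time_open_less_iff[of X _ U r, OF cont 2 r]
      by (simp add: set_eq_iff b1 b2 del: of_nat_Suc cong: conj_cong)
    also have "\<dots> \<in> sets ?F"
    proof (intro sets.countable_UN'' sets.countable_INT subsetI countable_Int1 countable_rat, elim rangeE,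
        clarify, intro sets.countable_UN'' countable_Int1 countable_rat)
      fix q p :: real and n :: nat assume "q \<in> \<rat>" "q \<in> {0<..<r}" "p \<in> \<rat> \<inter> {0..<q}"
      then have "X p \<in> borel_measurable ?F" by (intro X) auto
      from measurable_compose[OF this m]
      show "{\<omega>\<in>space ?F. infdist (X p \<omega>) (- U) < 1 / real (Suc n)} \<in> sets ?F"
        by (intro borel_measurable_less borel_measurable_const)
    qed simp
    finally show ?thesis .
  qed
qed

section \<open>The strong Markov property at optional times\<close>

context diffusion
begin

abbreviation T0 :: "'w \<Rightarrow> ennreal" where "T0 \<equiv> hitting_time X 0"

abbreviation X_at :: "('w \<Rightarrow> ennreal) \<Rightarrow> 'w \<Rightarrow> real" where
  "X_at T \<omega> \<equiv> X (enn2real (T \<omega>)) \<omega>"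

lemma half_open_0: "0 \<in> half_open b"
  using b_pos by (simp add: half_open_def zero_ereal_def)

lemma half_open_nonneg: "x \<in> half_open b \<Longrightarrow> 0 \<le> x"
  by (simp add: half_open_def)

lemma half_open_between: "y \<in> half_open b \<Longrightarrow> 0 \<le> x \<Longrightarrow> x \<le> y \<Longrightarrow> x \<in> half_open b"
  unfolding half_open_def
  by (metis (mono_tags, lifting) ereal_less_eq(3) mem_Collect_eq order_le_less_trans)

lemma half_open_borel [measurable]: "half_open b \<in> sets borel"
proof -
  have "is_interval (half_open b)"
    unfolding is_interval_1 using half_open_between half_open_nonneg
    by (meson order_trans)
  then show ?thesis by (rule real_interval_borel_measurable)
qed

lemma space_state_space: "space (state_space b) = half_open b"
  by (simp add: space_restrict_space)

lemma
  assumes "x \<in> half_open b"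
  shows prob_space_P: "prob_space (P x)"
    and sets_P: "sets (P x) = sets (path_algebra \<Omega> X)"
    and space_P: "space (P x) = \<Omega>"
proof -
  have "P x \<in> space (prob_algebra (path_algebra \<Omega> X))"
    using measurable_space[OF kernel] assms by (simp add: space_state_space)
  then show "prob_space (P x)" and *: "sets (P x) = sets (path_algebra \<Omega> X)"
    by (auto simp: space_prob_algebra)
  show "space (P x) = \<Omega>" using sets_eq_imp_space_eq[OF *] by simp
qed

lemma measurable_P:
  "x \<in> half_open b \<Longrightarrow> f \<in> path_algebra \<Omega> X \<rightarrow>\<^sub>M N \<Longrightarrow> f \<in> P x \<rightarrow>\<^sub>M N"
  using measurable_cong_sets[OF sets_P refl] by blast

lemma kernel': "P \<in> state_space b \<rightarrow>\<^sub>M subprob_algebra (path_algebra \<Omega> X)"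
  using kernel by (rule measurable_prob_algebraD)

lemma measurable_kernel_emeasure:
  "A \<in> sets (path_algebra \<Omega> X) \<Longrightarrow> (\<lambda>x. emeasure (P x) A) \<in> borel_measurable (state_space b)"
  by (rule measurable_emeasure_kernel[OF kernel'])

lemma measurable_X: "0 \<le> t \<Longrightarrow> X t \<in> path_algebra \<Omega> X \<rightarrow>\<^sub>M state_space b"
  by (intro measurable_restrict_space2 measurable_natural_filtration) (auto simp: X_in_state)

lemma X_at_in_state: "\<omega> \<in> \<Omega> \<Longrightarrow> X_at T \<omega> \<in> half_open b"
  by (simp add: X_in_state)

text \<open>The time is rounded down to the grid of mesh \<open>1 / (n + 1)\<close>. The rounded
  time has countably many values, so the position there is measurable, and continuity of paths gives
  the limit. Infinite times are read as \<open>0\<close> by \<open>enn2real\<close>, so the map is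
  total.\<close>

lemma measurable_X_at:
  assumes T: "T \<in> borel_measurable (path_algebra \<Omega> X)"
  shows "X_at T \<in> path_algebra \<Omega> X \<rightarrow>\<^sub>M state_space b"
proof (rule measurable_restrict_space2)
  let ?r = "\<lambda>n \<omega>. real (nat \<lfloor>real (Suc n) * enn2real (T \<omega>)\<rfloor>) / real (Suc n)"
  show "X_at T \<in> borel_measurable (path_algebra \<Omega> X)"
  proof (rule borel_measurable_LIMSEQ_metric)
    fix n
    have "(\<lambda>\<omega>. nat \<lfloor>real (Suc n) * enn2real (T \<omega>)\<rfloor>) \<in> path_algebra \<Omega> X \<rightarrow>\<^sub>M count_space UNIV"
      using T by measurable
    moreover have "X (real k / real (Suc n)) \<in> borel_measurable (path_algebra \<Omega> X)" for k
      by (intro measurable_natural_filtration) auto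
    ultimately show "(\<lambda>\<omega>. X (?r n \<omega>) \<omega>) \<in> borel_measurable (path_algebra \<Omega> X)"
      by (rule measurable_compose_countable[where f = "\<lambda>k. X (real k / real (Suc n))", rotated])
  next
    fix \<omega> assume "\<omega> \<in> space (path_algebra \<Omega> X)"
    then have cont: "continuous_on {0..} (\<lambda>t. X t \<omega>)" using continuous_paths by simp
    define a where "a = enn2real (T \<omega>)"
    have a: "0 \<le> a" by (simp add: a_def)
    have "(\<lambda>n. real (nat \<lfloor>real (Suc n) * a\<rfloor>) / real (Suc n)) \<longlonglongrightarrow> a"
    proof (rule tendsto_sandwich)
      show "\<forall>\<^sub>F n in sequentially. a - 1 / real (Suc n) \<le> real (nat \<lfloor>real (Suc n) * a\<rfloor>) / real (Suc n)"
      proof (rule always_eventually, rule allI)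
        fix n
        have "real (Suc n) * a - 1 \<le> real (nat \<lfloor>real (Suc n) * a\<rfloor>)"
          by linarith
        then have "(real (Suc n) * a - 1) / real (Suc n) \<le> real (nat \<lfloor>real (Suc n) * a\<rfloor>) / real (Suc n)"
          by (rule divide_right_mono) simp
        then show "a - 1 / real (Suc n) \<le> real (nat \<lfloor>real (Suc n) * a\<rfloor>) / real (Suc n)"
          by (simp add: diff_divide_distrib del: of_nat_Suc)
      qed
      show "\<forall>\<^sub>F n in sequentially. real (nat \<lfloor>real (Suc n) * a\<rfloor>) / real (Suc n) \<le> a"
      proof (rule always_eventually, rule allI)
        fix n
        have "0 \<le> real (Suc n) * a" using a by simp
        then have "real (nat \<lfloor>real (Suc n) * a\<rfloor>) \<le> real (Suc n) * a"
          by linarith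
        then show "real (nat \<lfloor>real (Suc n) * a\<rfloor>) / real (Suc n) \<le> a"
          by (simp add: field_simps del: of_nat_Suc)
      qed
      have "(\<lambda>n. a - inverse (real (Suc n))) \<longlonglongrightarrow> a - 0"
        by (intro tendsto_intros LIMSEQ_inverse_real_of_nat)
      then show "(\<lambda>n. a - 1 / real (Suc n)) \<longlonglongrightarrow> a" by (simp add: inverse_eq_divide)
    qed simp
    then show "(\<lambda>n. X (?r n \<omega>) \<omega>) \<longlonglongrightarrow> X_at T \<omega>"
      unfolding a_def by (intro path_tendsto[of X \<omega>] cont) auto
  qed
  show "X_at T \<in> space (path_algebra \<Omega> X) \<rightarrow> half_open b"
    by (auto simp: X_in_state)
qed

lemma optional_T0: "optional_time \<Omega> X T0"
  unfolding hitting_time_eq_exit_time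
  by (rule optional_exit_time) (auto intro: continuous_paths)

lemma measurable_T0: "T0 \<in> borel_measurable (path_algebra \<Omega> X)"
  by (rule measurable_optional[OF optional_T0])

lemma measurable_T0_P: "x \<in> half_open b \<Longrightarrow> T0 \<in> borel_measurable (P x)"
  by (intro measurable_P measurable_T0)

lemma survival_sets: "survival \<Omega> X t \<in> sets (path_algebra \<Omega> X)"
proof -
  have "{\<omega>\<in>space (path_algebra \<Omega> X). ennreal t < T0 \<omega>} \<in> sets (path_algebra \<Omega> X)"
    using measurable_T0 by (intro borel_measurable_less) auto
  then show ?thesis by (simp add: survival_def)
qed

section \<open>Survival events and the strong Markov property\<close>

lemma AE_X_eq_0_iff:
  assumes "x \<in> half_open b"
  shows "AE \<omega> in P x. \<forall>t\<ge>0. X t \<omega> = 0 \<longleftrightarrow> T0 \<omega> \<le> ennreal t"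
  using trap[OF assms] by eventually_elim (auto intro: hitting_time_le)

text \<open>Because \<open>0\<close> is a trap, survival up to \<open>t\<close> can be read off the
  single position \<open>X t\<close>, which brings it within reach of a Markov property for one
  later time.\<close>

lemma emeasure_survival_eq:
  assumes x: "x \<in> half_open b" and t: "0 \<le> t"
  shows "emeasure (P x) {\<omega>\<in>\<Omega>. X t \<omega> \<in> half_open b - {0}} = emeasure (P x) (survival \<Omega> X t)"
proof (rule emeasure_eq_AE)
  show "AE \<omega> in P x. \<omega> \<in> {\<omega>\<in>\<Omega>. X t \<omega> \<in> half_open b - {0}} \<longleftrightarrow> \<omega> \<in> survival \<Omega> X t"
    using AE_X_eq_0_iff[OF x]
    by eventually_elim (use t X_in_state in \<open>auto simp: survival_def not_le[symmetric]\<close>)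
  have "X t -` (half_open b - {0}) \<inter> space (path_algebra \<Omega> X) \<in> sets (path_algebra \<Omega> X)"
    by (rule measurable_sets[OF measurable_X[OF t]]) (auto simp: sets_restrict_space_iff)
  also have "X t -` (half_open b - {0}) \<inter> space (path_algebra \<Omega> X) = {\<omega>\<in>\<Omega>. X t \<omega> \<in> half_open b - {0}}"
    by auto
  finally show "{\<omega>\<in>\<Omega>. X t \<omega> \<in> half_open b - {0}} \<in> sets (P x)" by (simp add: sets_P[OF x])
  show "survival \<Omega> X t \<in> sets (P x)" 
    unfolding sets_P[OF x] by (rule survival_sets)
qed

text \<open>The only appeal to the strong Markov assumption, with target set
  \<open>half_open b - {0}\<close> and with the whole path space as the event prior to
  \<open>T\<close>. Absorption translates non-vanishing of \<open>X\<close> at time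
  \<open>T + t\<close> into \<open>T + t < T0\<close>.\<close>

lemma survival_strong_Markov:
  assumes x: "x \<in> half_open b" and T: "optional_time \<Omega> X T" and t: "0 \<le> t"
  shows "emeasure (P x) {\<omega>\<in>\<Omega>. T \<omega> < \<infinity> \<and> T \<omega> + ennreal t < T0 \<omega>} =
    (\<integral>\<^sup>+\<omega>. indicator {\<omega>\<in>\<Omega>. T \<omega> < \<infinity>} \<omega> * emeasure (P (X_at T \<omega>)) (survival \<Omega> X t) \<partial>P x)"
proof -
  let ?B = "half_open b - {0}"
  note [measurable] = measurable_optional[OF T] measurable_T0
  interpret F: filtration \<Omega> "right_filtration \<Omega> X" by (rule filtration_right_filtration)
  have T': "stopping_time (right_filtration \<Omega> X) T" by (rule stopping_time_optional[OF T])
  have "\<Omega> \<in> sets (F.pre_sigma T)" using sets.top[of "F.pre_sigma T"] by (simp add: F.space_pre_sigma)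
  moreover have "?B \<in> sets (state_space b)" by (auto simp: sets_restrict_space_iff)
  ultimately have *: "emeasure (P x) {\<omega>\<in>\<Omega>. T \<omega> < \<infinity> \<and> X (enn2real (T \<omega>) + t) \<omega> \<in> ?B} =
      (\<integral>\<^sup>+\<omega>. indicator {\<omega>\<in>\<Omega>. T \<omega> < \<infinity>} \<omega> *
         emeasure (P (X_at T \<omega>)) {\<omega>'\<in>\<Omega>. X t \<omega>' \<in> ?B} \<partial>P x)"
    using strong_Markov[unfolded strong_Markov_def, rule_format, OF T' x _ t] by blast
  \<comment> \<open>\<open>T + t\<close> is treated as a random time in its own right, so that the
    position there is measurable by the same approximation.\<close>
  have shift: "(\<lambda>\<omega>. X_at (\<lambda>\<omega>. T \<omega> + ennreal t) \<omega>) \<in> path_algebra \<Omega> X \<rightarrow>\<^sub>M state_space b"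
    by (rule measurable_X_at) measurable
  have fin: "enn2real (T \<omega> + ennreal t) = enn2real (T \<omega>) + t" if "T \<omega> < \<infinity>" for \<omega>
    using that t by (cases "T \<omega>") (auto simp: ennreal_plus[symmetric] simp del: ennreal_plus)
  have "emeasure (P x) {\<omega>\<in>\<Omega>. T \<omega> < \<infinity> \<and> T \<omega> + ennreal t < T0 \<omega>} =
      emeasure (P x) {\<omega>\<in>\<Omega>. T \<omega> < \<infinity> \<and> X (enn2real (T \<omega>) + t) \<omega> \<in> ?B}"
  proof (rule emeasure_eq_AE)
    show "AE \<omega> in P x. \<omega> \<in> {\<omega>\<in>\<Omega>. T \<omega> < \<infinity> \<and> T \<omega> + ennreal t < T0 \<omega>} \<longleftrightarrow>
        \<omega> \<in> {\<omega>\<in>\<Omega>. T \<omega> < \<infinity> \<and> X (enn2real (T \<omega>) + t) \<omega> \<in> ?B}"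
      using AE_X_eq_0_iff[OF x]
    proof eventually_elim
      fix \<omega> assume \<omega>: "\<forall>t\<ge>0. X t \<omega> = 0 \<longleftrightarrow> T0 \<omega> \<le> ennreal t"
      have "T \<omega> + ennreal t < T0 \<omega> \<longleftrightarrow> X (enn2real (T \<omega>) + t) \<omega> \<noteq> 0" if "T \<omega> < \<infinity>"
      proof -
        have "T \<omega> + ennreal t = ennreal (enn2real (T \<omega>) + t)"
          using that t by (cases "T \<omega>") (auto simp: ennreal_plus)
        then show ?thesis using \<omega> t by (simp add: not_le[symmetric])
      qed
      then show "\<omega> \<in> {\<omega>\<in>\<Omega>. T \<omega> < \<infinity> \<and> T \<omega> + ennreal t < T0 \<omega>} \<longleftrightarrow>
          \<omega> \<in> {\<omega>\<in>\<Omega>. T \<omega> < \<infinity> \<and> X (enn2real (T \<omega>) + t) \<omega> \<in> ?B}"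
        using X_in_state t by auto
    qed
    have "{\<omega>\<in>space (path_algebra \<Omega> X). T \<omega> < \<infinity> \<and> T \<omega> + ennreal t < T0 \<omega>} \<in> sets (path_algebra \<Omega> X)"
      by measurable
    then show "{\<omega>\<in>\<Omega>. T \<omega> < \<infinity> \<and> T \<omega> + ennreal t < T0 \<omega>} \<in> sets (P x)"
      by (simp add: sets_P[OF x])
    have "{\<omega>\<in>space (path_algebra \<Omega> X). T \<omega> < \<infinity>} \<inter>
        (X_at (\<lambda>\<omega>. T \<omega> + ennreal t) -` ?B \<inter> space (path_algebra \<Omega> X)) \<in> sets (path_algebra \<Omega> X)"
    proof (rule sets.Int)
      show "{\<omega>\<in>space (path_algebra \<Omega> X). T \<omega> < \<infinity>} \<in> sets (path_algebra \<Omega> X)" by measurable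
      show "X_at (\<lambda>\<omega>. T \<omega> + ennreal t) -` ?B \<inter> space (path_algebra \<Omega> X) \<in> sets (path_algebra \<Omega> X)"
        by (rule measurable_sets[OF shift]) (auto simp: sets_restrict_space_iff)
    qed
    also have "{\<omega>\<in>space (path_algebra \<Omega> X). T \<omega> < \<infinity>} \<inter>
        (X_at (\<lambda>\<omega>. T \<omega> + ennreal t) -` ?B \<inter> space (path_algebra \<Omega> X)) =
        {\<omega>\<in>\<Omega>. T \<omega> < \<infinity> \<and> X (enn2real (T \<omega>) + t) \<omega> \<in> ?B}"
      using fin by auto
    finally show "{\<omega>\<in>\<Omega>. T \<omega> < \<infinity> \<and> X (enn2real (T \<omega>) + t) \<omega> \<in> ?B} \<in> sets (P x)"
      by (simp add: sets_P[OF x])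
  qed
  also note *
  also have "(\<integral>\<^sup>+\<omega>. indicator {\<omega>\<in>\<Omega>. T \<omega> < \<infinity>} \<omega> *
         emeasure (P (X_at T \<omega>)) {\<omega>'\<in>\<Omega>. X t \<omega>' \<in> ?B} \<partial>P x) =
      (\<integral>\<^sup>+\<omega>. indicator {\<omega>\<in>\<Omega>. T \<omega> < \<infinity>} \<omega> * emeasure (P (X_at T \<omega>)) (survival \<Omega> X t) \<partial>P x)"
    by (intro nn_integral_cong arg_cong2[where f = times] refl emeasure_survival_eq t)
      (auto simp: space_P[OF x] X_in_state)
  finally show ?thesis .
qed

lemma distribution_P:
  assumes x: "x \<in> half_open b" and T: "T \<in> borel_measurable (path_algebra \<Omega> X)"
  shows "distr (P x) (state_space b) (X_at T) \<in> distributions b"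
  using prob_space.prob_space_distr[OF prob_space_P[OF x] measurable_P[OF x measurable_X_at[OF T]]]
  by (simp add: space_prob_algebra)

section \<open>Laws with a random initial position\<close>

lemma
  assumes \<mu>: "\<mu> \<in> distributions b"
  shows sets_initial_law: "sets (initial_law P \<mu>) = sets (path_algebra \<Omega> X)"
    and space_initial_law: "space (initial_law P \<mu>) = \<Omega>"
    and prob_space_initial_law: "prob_space (initial_law P \<mu>)"
    and nn_integral_initial_law: "f \<in> borel_measurable (path_algebra \<Omega> X) \<Longrightarrow>
      (\<integral>\<^sup>+\<omega>. f \<omega> \<partial>initial_law P \<mu>) = (\<integral>\<^sup>+x. (\<integral>\<^sup>+\<omega>. f \<omega> \<partial>P x) \<partial>\<mu>)"
proof -
  have s: "sets \<mu> = sets (state_space b)" and p: "prob_space \<mu>"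
    using \<mu> by (auto simp: space_prob_algebra)
  have k: "P \<in> \<mu> \<rightarrow>\<^sub>M prob_algebra (path_algebra \<Omega> X)"
    using kernel measurable_cong_sets[OF s refl] by blast
  have sp: "space \<mu> = half_open b" using sets_eq_imp_space_eq[OF s] by (simp add: space_state_space)
  have "initial_law P \<mu> \<in> space (prob_algebra (path_algebra \<Omega> X))"
  proof -
    have "sets (initial_law P \<mu>) = sets (path_algebra \<Omega> X)"
      unfolding initial_law_def
      by (rule sets_bind[OF sets_P]) (use half_open_0 sp in auto)
    moreover have "prob_space (initial_law P \<mu>)"
      unfolding initial_law_def
      by (rule prob_space_bind'[OF \<mu> kernel])
    ultimately show ?thesis by (simp add: space_prob_algebra)
  qed
  then show *: "sets (initial_law P \<mu>) = sets (path_algebra \<Omega> X)" "prob_space (initial_law P \<mu>)"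
    by (auto simp: space_prob_algebra)
  show "space (initial_law P \<mu>) = \<Omega>" using sets_eq_imp_space_eq[OF *(1)] by simp
  assume f: "f \<in> borel_measurable (path_algebra \<Omega> X)"
  show "(\<integral>\<^sup>+\<omega>. f \<omega> \<partial>initial_law P \<mu>) = (\<integral>\<^sup>+x. (\<integral>\<^sup>+\<omega>. f \<omega> \<partial>P x) \<partial>\<mu>)"
    unfolding initial_law_def by (rule nn_integral_bind[OF f measurable_prob_algebraD[OF k]])
qed

lemma
  assumes \<mu>: "\<mu> \<in> distributions b"
  shows sets_hitting_law: "sets (hitting_law X P \<mu>) = sets borel"
    and prob_space_hitting_law: "prob_space (hitting_law X P \<mu>)"
    and emeasure_initial_law_survival: "emeasure (initial_law P \<mu>) (survival \<Omega> X u) =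
      (\<integral>\<^sup>+x. emeasure (P x) (survival \<Omega> X u) \<partial>\<mu>)"
    and emeasure_hitting_law_greaterThan: "emeasure (hitting_law X P \<mu>) {ennreal u<..} =
      emeasure (initial_law P \<mu>) (survival \<Omega> X u)"
    and nn_integral_hitting_law: "g \<in> borel_measurable borel \<Longrightarrow>
      (\<integral>\<^sup>+t. g t \<partial>hitting_law X P \<mu>) = (\<integral>\<^sup>+x. (\<integral>\<^sup>+\<omega>. g (T0 \<omega>) \<partial>P x) \<partial>\<mu>)"
proof -
  note sI = sets_initial_law[OF \<mu>]
  have T0: "T0 \<in> borel_measurable (initial_law P \<mu>)"
    using measurable_T0 measurable_cong_sets[OF sI refl] by blast
  show "sets (hitting_law X P \<mu>) = sets borel" by (simp add: hitting_law_def)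
  show "prob_space (hitting_law X P \<mu>)"
    unfolding hitting_law_def by (intro prob_space.prob_space_distr prob_space_initial_law \<mu> T0)
  have "(\<integral>\<^sup>+\<omega>. indicator (survival \<Omega> X u) \<omega> \<partial>initial_law P \<mu>) =
      (\<integral>\<^sup>+x. (\<integral>\<^sup>+\<omega>. indicator (survival \<Omega> X u) \<omega> \<partial>P x) \<partial>\<mu>)"
    by (intro nn_integral_initial_law \<mu> borel_measurable_indicator survival_sets)
  also have "\<dots> = (\<integral>\<^sup>+x. emeasure (P x) (survival \<Omega> X u) \<partial>\<mu>)"
  proof (intro nn_integral_cong nn_integral_indicator)
    fix x assume "x \<in> space \<mu>"
    then have "x \<in> half_open b" using \<mu> sets_eq_imp_space_eq[of \<mu> "state_space b"]
      by (auto simp: space_prob_algebra space_state_space)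
    then show "survival \<Omega> X u \<in> sets (P x)" using sets_P survival_sets by metis
  qed
  finally show "emeasure (initial_law P \<mu>) (survival \<Omega> X u) =
      (\<integral>\<^sup>+x. emeasure (P x) (survival \<Omega> X u) \<partial>\<mu>)"
    by (subst (asm) nn_integral_indicator) (use survival_sets sI in auto)
  show "emeasure (hitting_law X P \<mu>) {ennreal u<..} = emeasure (initial_law P \<mu>) (survival \<Omega> X u)"
    unfolding hitting_law_def using T0
    by (subst emeasure_distr) (auto simp: survival_def space_initial_law[OF \<mu>] intro!: arg_cong[where f = "emeasure _"])
  assume g: "g \<in> borel_measurable borel"
  have "(\<integral>\<^sup>+t. g t \<partial>hitting_law X P \<mu>) = (\<integral>\<^sup>+\<omega>. g (T0 \<omega>) \<partial>initial_law P \<mu>)"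
    unfolding hitting_law_def using T0 g by (intro nn_integral_distr) simp_all
  also have "\<dots> = (\<integral>\<^sup>+x. (\<integral>\<^sup>+\<omega>. g (T0 \<omega>) \<partial>P x) \<partial>\<mu>)"
    by (intro nn_integral_initial_law \<mu> measurable_compose[OF measurable_T0 g])
  finally show "(\<integral>\<^sup>+t. g t \<partial>hitting_law X P \<mu>) = (\<integral>\<^sup>+x. (\<integral>\<^sup>+\<omega>. g (T0 \<omega>) \<partial>P x) \<partial>\<mu>)" .
qed

lemma hitting_law_return:
  assumes "x \<in> half_open b"
  shows "hitting_law X P (return (state_space b) x) = distr (P x) borel T0"
  unfolding hitting_law_def initial_law_def
  by (subst bind_return[OF kernel']) (use assms in \<open>auto simp: space_state_space\<close>)

end

section \<open>Continuity in the starting point\<close>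

text \<open>Almost sure absorption makes every difference \<open>T0 - T\<close> below a difference
  of finite times. In the theorem it is derived from the exponential hitting law of
  \<open>\<nu>\<close>.\<close>

locale absorbed_diffusion = diffusion +
  assumes absorbed: "\<And>x. x \<in> half_open b \<Longrightarrow> AE \<omega> in P x. T0 \<omega> < \<infinity>"
begin

text \<open>Replaces a shift of paths. For finite \<open>T\<close>, the condition
  \<open>T + r < T0\<close> is the same as \<open>r < T0 - T\<close>, so the strong Markov property
  identifies all tails of the two laws.\<close>

lemma hitting_law_stopped:
  assumes x: "x \<in> half_open b" and T: "optional_time \<Omega> X T"
    and le: "AE \<omega> in P x. T \<omega> \<le> T0 \<omega>"
  shows "hitting_law X P (distr (P x) (state_space b) (X_at T)) = distr (P x) borel (\<lambda>\<omega>. T0 \<omega> - T \<omega>)"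
proof (rule measure_ennreal_eqI)
  let ?\<eta> = "distr (P x) (state_space b) (X_at T)"
  note mT = measurable_optional[OF T]
  have mX: "X_at T \<in> P x \<rightarrow>\<^sub>M state_space b" by (intro measurable_P x measurable_X_at mT)
  have \<eta>: "?\<eta> \<in> distributions b" by (rule distribution_P[OF x mT])
  have [measurable]: "T \<in> borel_measurable (P x)" "T0 \<in> borel_measurable (P x)"
    using measurable_P[OF x mT] measurable_T0_P[OF x] by auto
  show "sets (hitting_law X P ?\<eta>) = sets borel" "prob_space (hitting_law X P ?\<eta>)"
    by (rule sets_hitting_law[OF \<eta>], rule prob_space_hitting_law[OF \<eta>])
  show "prob_space (distr (P x) borel (\<lambda>\<omega>. T0 \<omega> - T \<omega>))"
    by (intro prob_space.prob_space_distr prob_space_P x) measurable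
  fix r :: real assume r: "0 \<le> r"
  have fin: "AE \<omega> in P x. \<omega> \<in> \<Omega> \<and> T \<omega> < \<infinity>"
    using le absorbed[OF x] AE_space by eventually_elim (use space_P[OF x] in \<open>auto intro: le_less_trans\<close>)
  have "emeasure (hitting_law X P ?\<eta>) {ennreal r<..} = (\<integral>\<^sup>+y. emeasure (P y) (survival \<Omega> X r) \<partial>?\<eta>)"
    by (simp only: emeasure_hitting_law_greaterThan[OF \<eta>] emeasure_initial_law_survival[OF \<eta>])
  also have "\<dots> = (\<integral>\<^sup>+\<omega>. emeasure (P (X_at T \<omega>)) (survival \<Omega> X r) \<partial>P x)"
    by (intro nn_integral_distr mX) (use measurable_kernel_emeasure[OF survival_sets] in simp)
  also have "\<dots> = (\<integral>\<^sup>+\<omega>. indicator {\<omega>\<in>\<Omega>. T \<omega> < \<infinity>} \<omega> * emeasure (P (X_at T \<omega>)) (survival \<Omega> X r) \<partial>P x)"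
    by (rule nn_integral_cong_AE) (use fin in eventually_elim, simp)
  also have "\<dots> = emeasure (P x) {\<omega>\<in>\<Omega>. T \<omega> < \<infinity> \<and> T \<omega> + ennreal r < T0 \<omega>}"
    by (rule survival_strong_Markov[OF x T r, symmetric])
  also have "\<dots> = emeasure (P x) {\<omega>\<in>space (P x). ennreal r < T0 \<omega> - T \<omega>}"
  proof (rule emeasure_eq_AE)
    show "AE \<omega> in P x. \<omega> \<in> {\<omega>\<in>\<Omega>. T \<omega> < \<infinity> \<and> T \<omega> + ennreal r < T0 \<omega>} \<longleftrightarrow>
        \<omega> \<in> {\<omega>\<in>space (P x). ennreal r < T0 \<omega> - T \<omega>}"
      using fin by eventually_elim (auto simp: space_P[OF x] less_diff_eq_ennreal add.commute)
    have "{\<omega>\<in>space (P x). T \<omega> < \<infinity> \<and> T \<omega> + ennreal r < T0 \<omega>} \<in> sets (P x)" by measurable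
    then show "{\<omega>\<in>\<Omega>. T \<omega> < \<infinity> \<and> T \<omega> + ennreal r < T0 \<omega>} \<in> sets (P x)" by (simp add: space_P[OF x])
    show "{\<omega>\<in>space (P x). ennreal r < T0 \<omega> - T \<omega>} \<in> sets (P x)" by measurable
  qed
  also have "\<dots> = emeasure (distr (P x) borel (\<lambda>\<omega>. T0 \<omega> - T \<omega>)) {ennreal r<..}"
    by (subst emeasure_distr) (auto intro!: arg_cong[where f = "emeasure _"])
  finally show "emeasure (hitting_law X P ?\<eta>) {ennreal r<..} =
      emeasure (distr (P x) borel (\<lambda>\<omega>. T0 \<omega> - T \<omega>)) {ennreal r<..}" .
qed simp

text \<open>If the position at \<open>T\<close> is deterministic, the restarted law is that of a
  fixed starting point; thus \<open>T0\<close> under \<open>P y\<close> is realised as a difference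
  of times under \<open>P x\<close>.\<close>

lemma residual_law:
  assumes x: "x \<in> half_open b" and T: "optional_time \<Omega> X T"
    and le: "AE \<omega> in P x. T \<omega> \<le> T0 \<omega>"
    and y: "y \<in> half_open b" and at: "AE \<omega> in P x. X_at T \<omega> = y"
  shows "distr (P y) borel T0 = distr (P x) borel (\<lambda>\<omega>. T0 \<omega> - T \<omega>)"
proof -
  interpret prob_space "P x" by (rule prob_space_P[OF x])
  have mX: "X_at T \<in> P x \<rightarrow>\<^sub>M state_space b"
    by (intro measurable_P x measurable_X_at measurable_optional T)
  have "distr (P x) (state_space b) (X_at T) = distr (P x) (state_space b) (\<lambda>_. y)"
    using at mX y by (intro distr_cong_AE) (auto simp: space_state_space)
  also have "\<dots> = return (state_space b) y"
    using y by (intro distr_const) (simp add: space_state_space)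
  finally show ?thesis
    using hitting_law_stopped[OF x T le] hitting_law_return[OF y] by simp
qed

section \<open>First passage below a level\<close>

lemma exit_above_at:
  assumes x: "x \<in> half_open b" and xz: "x < z" "z \<in> half_open b"
  shows "AE \<omega> in P z. exit_time X {x<..} \<omega> \<le> T0 \<omega> \<and> X_at (exit_time X {x<..}) \<omega> = x"
  using start[OF xz(2)] absorbed[OF xz(2)] AE_space
proof eventually_elim
  fix \<omega> assume *: "X 0 \<omega> = z" "T0 \<omega> < \<infinity>" "\<omega> \<in> space (P z)"
  then have cont: "continuous_on {0..} (\<lambda>t. X t \<omega>)" using continuous_paths space_P[OF xz(2)] by simp
  let ?T = "exit_time X {x<..}"
  have le: "?T \<omega> \<le> T0 \<omega>" using half_open_nonneg[OF x]
    unfolding hitting_time_eq_exit_time by (intro exit_time_antimono) auto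
  then have fin: "?T \<omega> < \<infinity>" using *(2) by (rule le_less_trans)
  have "X_at ?T \<omega> \<notin> {x<..}" by (rule X_exit_time_notin[OF cont _ fin]) simp
  moreover have "X_at ?T \<omega> \<in> {x..}"
    by (rule X_exit_time_closure[OF cont _ _ _ fin]) (use * xz in auto)
  ultimately show "?T \<omega> \<le> T0 \<omega> \<and> X_at ?T \<omega> = x" using le by auto
qed

lemma optional_exit: "open U \<or> closed U \<Longrightarrow> optional_time \<Omega> X (exit_time X U)"
  by (rule optional_exit_time) (auto intro: continuous_paths)

lemma exit_above_law:
  assumes x: "x \<in> half_open b" and xz: "x < z" "z \<in> half_open b"
  shows "distr (P x) borel T0 = distr (P z) borel (\<lambda>\<omega>. T0 \<omega> - exit_time X {x<..} \<omega>)"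
  using exit_above_at[OF assms] by (intro residual_law assms optional_exit) auto

text \<open>A continuous path from \<open>z\<close> to \<open>0\<close> must pass through
  \<open>x\<close>, and the time that remains from there is at most the whole lifetime.\<close>

lemma survival_mono:
  assumes x: "x \<in> half_open b" and xz: "x \<le> z" "z \<in> half_open b"
  shows "emeasure (P x) (survival \<Omega> X u) \<le> emeasure (P z) (survival \<Omega> X u)"
proof (cases "x = z")
  case False
  then have xz': "x < z" using xz by simp
  let ?T = "exit_time X {x<..}"
  have m: "?T \<in> borel_measurable (P z)" "T0 \<in> borel_measurable (P z)" "T0 \<in> borel_measurable (P x)"
    using measurable_T0_P x xz measurable_P[OF xz(2) measurable_optional[OF optional_exit]] by auto
  have "emeasure (P x) (survival \<Omega> X u) = emeasure (distr (P x) borel T0) {ennreal u<..}"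
    using m by (subst emeasure_distr) (auto simp: survival_def space_P[OF x] intro!: arg_cong[where f = "emeasure _"])
  also have "\<dots> = emeasure (distr (P z) borel (\<lambda>\<omega>. T0 \<omega> - ?T \<omega>)) {ennreal u<..}"
    by (simp only: exit_above_law[OF x xz' xz(2)])
  also have "\<dots> = emeasure (P z) ((\<lambda>\<omega>. T0 \<omega> - ?T \<omega>) -` {ennreal u<..} \<inter> space (P z))"
    using m by (intro emeasure_distr) auto
  also have "\<dots> \<le> emeasure (P z) (survival \<Omega> X u)"
    using survival_sets sets_P[OF xz(2)]
    by (intro emeasure_mono)
      (auto simp: survival_def space_P[OF xz(2)] intro: less_le_trans[OF _ diff_le_self_ennreal])
  finally show ?thesis .
qed simp

text \<open>First passage times are right continuous in the level. Up to a time \<open>r\<close>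
  before the passage of \<open>x\<close> the path has, by compactness, a minimum
  \<open>x + d\<close> with \<open>d > 0\<close>; once \<open>S n < x + d / 2\<close>, the level
  \<open>S n\<close> has not been passed by time \<open>r\<close> either.\<close>

lemma exit_above_tendsto:
  assumes cont: "continuous_on {0..} (\<lambda>t. X t \<omega>)"
    and S: "S \<longlonglongrightarrow> x" "\<And>n. x \<le> S n" and fin: "exit_time X {x<..} \<omega> < \<infinity>"
  shows "(\<lambda>n::nat. exit_time X {S n<..} \<omega>) \<longlonglongrightarrow> exit_time X {x<..} \<omega>"
proof (rule order_tendstoI)
  let ?T = "\<lambda>y. exit_time X {y<..} \<omega>"
  fix a assume a: "a < ?T x"
  then obtain r where r: "a = ennreal r" "0 \<le> r" by (cases a) auto
  have "\<exists>d>0. \<forall>t\<in>{0..r}. x + d \<le> X t \<omega>"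
  proof -
    have "continuous_on {0..r} (\<lambda>t. X t \<omega>)" using cont by (rule continuous_on_subset) auto
    then obtain t where t: "t \<in> {0..r}" "\<And>u. u \<in> {0..r} \<Longrightarrow> X t \<omega> \<le> X u \<omega>"
      using continuous_attains_inf[of "{0..r}" "\<lambda>t. X t \<omega>"] r by auto
    have "ennreal t \<le> ennreal r" using t(1) by (intro ennreal_leI) auto
    also have "\<dots> < ?T x" using a r by simp
    finally have "ennreal t < ?T x" .
    then have "x < X t \<omega>" using exit_time_inside[of t X "{x<..}"] t(1) by auto
    then show ?thesis using t by (intro exI[of _ "X t \<omega> - x"]) auto
  qed
  then obtain d where d: "0 < d" "\<And>t. t \<in> {0..r} \<Longrightarrow> x + d \<le> X t \<omega>" by blast
  have "\<forall>\<^sub>F n in sequentially. S n < x + d / 2" using S(1) by (rule order_tendstoD) (use d in simp)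
  then show "\<forall>\<^sub>F n in sequentially. a < ?T (S n)"
  proof eventually_elim
    fix n assume n: "S n < x + d / 2"
    show "a < ?T (S n)"
    proof (rule ccontr)
      assume "\<not> a < ?T (S n)"
      then have ler: "?T (S n) \<le> ennreal r" by (simp add: r)
      then have fin: "?T (S n) < \<infinity>" by (rule le_less_trans) simp
      have "enn2real (?T (S n)) \<in> {0..r}" using ler r by (auto intro: enn2real_leI)
      moreover have "X_at (exit_time X {S n<..}) \<omega> \<notin> {S n<..}"
        by (rule X_exit_time_notin[OF cont _ fin]) simp
      ultimately show False using d(1) d(2)[of "enn2real (?T (S n))"] n by simp
    qed
  qed
next
  fix a assume "exit_time X {x<..} \<omega> < a"
  moreover have "exit_time X {S n<..} \<omega> \<le> exit_time X {x<..} \<omega>" for n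
    using S(2)[of n] by (intro exit_time_antimono) auto
  ultimately show "\<forall>\<^sub>F n in sequentially. exit_time X {S n<..} \<omega> < a"
    by (intro always_eventually allI) (rule le_less_trans)
qed

text \<open>From the left the limit is a different time, the first entrance strictly below
  \<open>y\<close>: passage times may jump where the path touches a level and turns back.\<close>

lemma exit_below_tendsto:
  assumes S: "S \<longlonglongrightarrow> y" "\<And>n. S n < y"
  shows "(\<lambda>n::nat. exit_time X {S n<..} \<omega>) \<longlonglongrightarrow> exit_time X {y..} \<omega>"
proof (rule order_tendstoI)
  have le: "exit_time X {y..} \<omega> \<le> exit_time X {S n<..} \<omega>" for n
    using S(2)[of n] by (intro exit_time_antimono) auto
  fix a assume "a < exit_time X {y..} \<omega>"
  then show "\<forall>\<^sub>F n in sequentially. a < exit_time X {S n<..} \<omega>"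
    using le by (intro always_eventually allI) (rule less_le_trans)
next
  fix a assume "exit_time X {y..} \<omega> < a"
  then obtain t where t: "0 \<le> t" "ennreal t < a" "X t \<omega> < y" unfolding exit_time_less_iff by auto
  have "\<forall>\<^sub>F n in sequentially. X t \<omega> < S n" using S(1) t(3) by (rule order_tendstoD)
  then show "\<forall>\<^sub>F n in sequentially. exit_time X {S n<..} \<omega> < a"
    by eventually_elim (use t in \<open>auto simp: exit_time_less_iff intro!: exI[of _ t]\<close>)
qed

text \<open>The entrance time into \<open>[0, y)\<close> need not be known to vanish under \<open>P y\<close> for the following:
  it is the limit of the times of first passage below \<open>y\<close>, and the process restarts from \<open>y\<close> there.\<close>

lemma exit_below_at:
  assumes y: "y \<in> half_open b" "0 < y"
  shows "AE \<omega> in P y. exit_time X {y..} \<omega> \<le> T0 \<omega> \<and> X_at (exit_time X {y..}) \<omega> = y"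
  using start[OF y(1)] absorbed[OF y(1)] AE_space
proof eventually_elim
  fix \<omega> assume *: "X 0 \<omega> = y" "T0 \<omega> < \<infinity>" "\<omega> \<in> space (P y)"
  then have cont: "continuous_on {0..} (\<lambda>t. X t \<omega>)" using continuous_paths space_P[OF y(1)] by simp
  let ?T = "exit_time X {y..}"
  have le: "?T \<omega> \<le> T0 \<omega>" using y(2)
    unfolding hitting_time_eq_exit_time by (intro exit_time_antimono) auto
  then have fin: "?T \<omega> < \<infinity>" using *(2) by (rule le_less_trans)
  have ge: "X_at ?T \<omega> \<in> {y..}"
    by (rule X_exit_time_closure[OF cont _ _ _ fin]) (use * in auto)
  \<comment> \<open>The path is at most \<open>S n < y\<close> when it passes \<open>S n\<close>,
    and this survives the limit as \<open>y\<close> rises to meet it as an upper bound. The levels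
    are nonnegative (\<open>S 0 = 0\<close>), so that each is passed no later than
    \<open>T0\<close>.\<close>
  define S where "S n = y - y / real (Suc n)" for n
  have "(\<lambda>n. y - y * inverse (real (Suc n))) \<longlonglongrightarrow> y - y * 0"
    by (intro tendsto_intros LIMSEQ_inverse_real_of_nat)
  then have S: "S \<longlonglongrightarrow> y" by (simp add: S_def[abs_def] divide_inverse)
  have Sy: "S n < y" "0 \<le> S n" for n using y(2) by (auto simp: S_def field_simps)
  let ?R = "\<lambda>n. exit_time X {S n<..}"
  have Rfin: "?R n \<omega> < \<infinity>" for n
  proof -
    have "?R n \<omega> \<le> T0 \<omega>" using Sy(2)[of n]
      unfolding hitting_time_eq_exit_time by (intro exit_time_antimono) auto
    then show ?thesis using *(2) by (rule le_less_trans)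
  qed
  have "(\<lambda>n. enn2real (?R n \<omega>)) \<longlonglongrightarrow> enn2real (?T \<omega>)"
    using exit_below_tendsto[OF S Sy(1), of \<omega>] fin by (intro tendsto_enn2real) auto
  then have "(\<lambda>n. X_at (?R n) \<omega>) \<longlonglongrightarrow> X_at ?T \<omega>" by (rule path_tendsto[of X \<omega>, OF cont]) simp
  moreover have "X_at (?R n) \<omega> \<le> y" for n
    using X_exit_time_notin[OF cont _ Rfin[of n]] Sy(1)[of n] by auto
  ultimately have "X_at ?T \<omega> \<le> y" by (intro LIMSEQ_le_const2) auto
  then show "?T \<omega> \<le> T0 \<omega> \<and> X_at ?T \<omega> = y" using ge le by auto
qed

lemma integral_T0_eq:
  fixes g :: "ennreal \<Rightarrow> real"
  assumes "x \<in> half_open b" "z \<in> half_open b" and T: "optional_time \<Omega> X T" and g: "g \<in> borel_measurable borel"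
    and law: "distr (P x) borel T0 = distr (P z) borel (\<lambda>\<omega>. T0 \<omega> - T \<omega>)"
  shows "(LINT \<omega>|P x. g (T0 \<omega>)) = (LINT \<omega>|P z. g (T0 \<omega> - T \<omega>))"
proof -
  have [measurable]: "T \<in> borel_measurable (P z)" "T0 \<in> borel_measurable (P z)"
    using measurable_P[OF assms(2) measurable_optional[OF T]] measurable_T0_P[OF assms(2)] by auto
  have "(LINT \<omega>|P x. g (T0 \<omega>)) = integral\<^sup>L (distr (P x) borel T0) g"
    by (rule integral_distr[OF measurable_T0_P[OF assms(1)] g, symmetric])
  also have "\<dots> = (LINT \<omega>|P z. g (T0 \<omega> - T \<omega>))"
    unfolding law using g by (intro integral_distr) auto
  finally show ?thesis .
qed

text \<open>Dominated convergence under the single measure \<open>P z\<close>: the arguments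
  \<open>T0 - T n\<close> never exceed \<open>T0\<close>, so one function \<open>w\<close> of
  \<open>T0\<close> bounds all integrands. A constant \<open>w\<close> serves bounded
  \<open>g\<close>; \<open>w = enn2real\<close> serves the mean of \<open>T0\<close>. Continuity of
  \<open>g\<close> is asked at finite times only, since \<open>enn2real\<close> lacks it at
  \<open>\<infinity>\<close>.\<close>

lemma expectation_T0_tendsto:
  fixes g :: "ennreal \<Rightarrow> real" and w :: "ennreal \<Rightarrow> real"
  assumes z: "z \<in> half_open b" "\<And>n::nat. S n \<in> half_open b" "x \<in> half_open b"
    and g: "g \<in> borel_measurable borel" "\<And>t. t < \<infinity> \<Longrightarrow> isCont g t"
    and w: "integrable (P z) (\<lambda>\<omega>. w (T0 \<omega>))" "\<And>s t. s \<le> t \<Longrightarrow> t < \<infinity> \<Longrightarrow> \<bar>g s\<bar> \<le> w t"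
    and T: "\<And>n. optional_time \<Omega> X (T n)" "optional_time \<Omega> X R"
    and law: "\<And>n. distr (P (S n)) borel T0 = distr (P z) borel (\<lambda>\<omega>. T0 \<omega> - T n \<omega>)"
      "distr (P x) borel T0 = distr (P z) borel (\<lambda>\<omega>. T0 \<omega> - R \<omega>)"
    and lim: "AE \<omega> in P z. (\<lambda>n. T n \<omega>) \<longlonglongrightarrow> R \<omega> \<and> R \<omega> < \<infinity>"
  shows "(\<lambda>n. LINT \<omega>|P (S n). g (T0 \<omega>)) \<longlonglongrightarrow> (LINT \<omega>|P x. g (T0 \<omega>))"
  unfolding integral_T0_eq[OF z(2,1) T(1) g(1) law(1)] integral_T0_eq[OF z(3,1) T(2) g(1) law(2)]
proof (rule integral_dominated_convergence)
  note [measurable] = g(1) measurable_T0_P[OF z(1)] measurable_P[OF z(1) measurable_optional[OF T(1)]]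
    measurable_P[OF z(1) measurable_optional[OF T(2)]]
  show "(\<lambda>\<omega>. g (T0 \<omega> - R \<omega>)) \<in> borel_measurable (P z)" by measurable
  show "(\<lambda>\<omega>. g (T0 \<omega> - T n \<omega>)) \<in> borel_measurable (P z)" for n by measurable
  show "integrable (P z) (\<lambda>\<omega>. w (T0 \<omega>))" by fact
  show "AE \<omega> in P z. norm (g (T0 \<omega> - T n \<omega>)) \<le> w (T0 \<omega>)" for n
    using absorbed[OF z(1)] by eventually_elim (use w(2) diff_le_self_ennreal in auto)
  show "AE \<omega> in P z. (\<lambda>n. g (T0 \<omega> - T n \<omega>)) \<longlonglongrightarrow> g (T0 \<omega> - R \<omega>)"
    using absorbed[OF z(1)] lim
  proof eventually_elim
    fix \<omega> assume *: "T0 \<omega> < \<infinity>" "(\<lambda>n. T n \<omega>) \<longlonglongrightarrow> R \<omega> \<and> R \<omega> < \<infinity>"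
    then have "(\<lambda>n. T0 \<omega> - T n \<omega>) \<longlonglongrightarrow> T0 \<omega> - R \<omega>"
      by (intro tendsto_diff_ennreal tendsto_const) auto
    moreover have "T0 \<omega> - R \<omega> < \<infinity>" using *(1) diff_le_self_ennreal by (rule le_less_trans[rotated])
    ultimately show "(\<lambda>n. g (T0 \<omega> - T n \<omega>)) \<longlonglongrightarrow> g (T0 \<omega> - R \<omega>)"
      using g(2) isCont_tendsto_compose by blast
  qed
qed

text \<open>For limits from the right all starting points are reached from one \<open>z\<close>
  above them. For limits from the left the process starts at \<open>y\<close> itself and the passage
  times tend to the exit from \<open>{y..}\<close>. At the left end point \<open>0\<close> only the
  first kind of limit occurs.\<close>

lemma continuous_expectation_T0:
  fixes g :: "ennreal \<Rightarrow> real" and w :: "ennreal \<Rightarrow> real"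
  assumes g: "g \<in> borel_measurable borel" "\<And>t. t < \<infinity> \<Longrightarrow> isCont g t"
    and w: "\<And>x. x \<in> half_open b \<Longrightarrow> integrable (P x) (\<lambda>\<omega>. w (T0 \<omega>))"
      "\<And>s t. s \<le> t \<Longrightarrow> t < \<infinity> \<Longrightarrow> \<bar>g s\<bar> \<le> w t"
  shows "continuous_on (half_open b) (\<lambda>x. LINT \<omega>|P x. g (T0 \<omega>))"
proof -
  let ?E = "\<lambda>x. LINT \<omega>|P x. g (T0 \<omega>)"
  have right: "(?E \<longlongrightarrow> ?E x) (at_right x)" if x: "x \<in> half_open b" for x
  proof -
    obtain z where z: "x < z" "z \<in> half_open b"
    proof -
      have "ereal x < b" using x by (simp add: half_open_def)
      then obtain q where "x < q" "ereal q < b" using ereal_dense2 ereal_less_ereal_Ex ereal_less(2)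
        by (metis less_ereal.simps(1) ereal_dense2)
      then show thesis using that[of q] x by (auto simp: half_open_def)
    qed
    show ?thesis
    proof (rule tendsto_at_right_sequentially[OF z(1)])
      fix S :: "nat \<Rightarrow> real" assume S: "\<And>n. x < S n" "\<And>n. S n < z" "S \<longlonglongrightarrow> x"
      have Sin: "S n \<in> half_open b" for n
        using half_open_between[OF z(2), of "S n"] half_open_nonneg[OF x] S(1,2)[of n] by auto
      have "AE \<omega> in P z. (\<lambda>n. exit_time X {S n<..} \<omega>) \<longlonglongrightarrow> exit_time X {x<..} \<omega> \<and> exit_time X {x<..} \<omega> < \<infinity>"
        using exit_above_at[OF x z] absorbed[OF z(2)] AE_space
      proof eventually_elim
        fix \<omega> assume *: "exit_time X {x<..} \<omega> \<le> T0 \<omega> \<and> X_at (exit_time X {x<..}) \<omega> = x"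
          "T0 \<omega> < \<infinity>" "\<omega> \<in> space (P z)"
        then have fin: "exit_time X {x<..} \<omega> < \<infinity>" by (auto intro: le_less_trans)
        have cont: "continuous_on {0..} (\<lambda>t. X t \<omega>)" using continuous_paths space_P[OF z(2)] *(3) by simp
        show "(\<lambda>n. exit_time X {S n<..} \<omega>) \<longlonglongrightarrow> exit_time X {x<..} \<omega> \<and> exit_time X {x<..} \<omega> < \<infinity>"
          using exit_above_tendsto[OF cont S(3) _ fin] less_imp_le[OF S(1)] fin by blast
      qed
      then show "(\<lambda>n. ?E (S n)) \<longlonglongrightarrow> ?E x"
        using S(2) z(1) exit_above_law[OF x z]
        by (intro expectation_T0_tendsto[where z = z and w = w and T = "\<lambda>n. exit_time X {S n<..}"
              and R = "exit_time X {x<..}"] z(2) Sin x g w exit_above_law optional_exit) auto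
    qed
  qed
  have left: "(?E \<longlongrightarrow> ?E y) (at_left y)" if y: "y \<in> half_open b" "0 < y" for y
  proof (rule tendsto_at_left_sequentially[OF y(2)])
    fix S :: "nat \<Rightarrow> real" assume S: "\<And>n. S n < y" "\<And>n. 0 < S n" "S \<longlonglongrightarrow> y"
    have Sin: "S n \<in> half_open b" for n
      using half_open_between[OF y(1), of "S n"] S(1,2)[of n] by auto
    have "AE \<omega> in P y. (\<lambda>n. exit_time X {S n<..} \<omega>) \<longlonglongrightarrow> exit_time X {y..} \<omega> \<and> exit_time X {y..} \<omega> < \<infinity>"
      using exit_below_at[OF y] absorbed[OF y(1)]
      by eventually_elim (use exit_below_tendsto[OF S(3,1)] in \<open>auto intro: le_less_trans\<close>)
    \<comment> \<open>At the exit from \<open>{y..}\<close> the process is again at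
      \<open>y\<close>, so the limiting law of \<open>T0\<close> minus this time is the law of
      \<open>T0\<close> under \<open>P y\<close>, even without knowing that this exit is
      immediate.\<close>
    moreover have "distr (P y) borel T0 = distr (P y) borel (\<lambda>\<omega>. T0 \<omega> - exit_time X {y..} \<omega>)"
      using exit_below_at[OF y] by (intro residual_law y optional_exit) auto
    ultimately show "(\<lambda>n. ?E (S n)) \<longlonglongrightarrow> ?E y"
      using S(1)
      by (intro expectation_T0_tendsto[where z = y and w = w and T = "\<lambda>n. exit_time X {S n<..}"
            and R = "exit_time X {y..}"] y(1) Sin g w exit_above_law optional_exit) auto
  qed
  show ?thesis
    unfolding continuous_on_def
  proof
    fix x assume x: "x \<in> half_open b"
    show "(?E \<longlongrightarrow> ?E x) (at x within half_open b)"
    proof (cases "x = 0")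
      case True
      have "at x within half_open b \<le> at_right x"
        unfolding at_within_def using half_open_nonneg True
        by (intro inf_mono order_refl) (auto simp: order_less_le)
      then show ?thesis using right[OF x] tendsto_mono by blast
    next
      case False
      then have "0 < x" using half_open_nonneg[OF x] by simp
      then have "(?E \<longlongrightarrow> ?E x) (at x)"
        using left[OF x] right[OF x] by (simp add: filterlim_split_at)
      then show ?thesis by (rule tendsto_within_subset) auto
    qed
  qed
qed

end

section \<open>The natural boundary\<close>

text \<open>A mean value inequality for right difference quotients with respect to \<open>s\<close>.
  With slack \<open>\<epsilon>\<close>, the set of points up to which the inequality holds is closed
  and contains its supremum; below \<open>c\<close> the local hypothesis would carry it beyond. Then
  \<open>\<epsilon>\<close> tends to \<open>0\<close>.\<close>

lemma scale_mean_value: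
  fixes w s :: "real \<Rightarrow> real"
  assumes ac: "a < c" and w: "continuous_on {a..c} w" and s: "continuous_on {a..c} s"
    and step: "\<And>z \<epsilon>. a \<le> z \<Longrightarrow> z < c \<Longrightarrow> 0 < \<epsilon> \<Longrightarrow>
      \<forall>\<^sub>F y in at_right z. - \<epsilon> * (s y - s z) \<le> w y - w z"
  shows "w a \<le> w c"
proof -
  have *: "- \<epsilon> * (s c - s a) \<le> w c - w a" if \<epsilon>: "0 < \<epsilon>" for \<epsilon>
  proof -
    define A where "A = {y \<in> {a..c}. - \<epsilon> * (s y - s a) \<le> w y - w a}"
    have cl: "closed A"
      unfolding A_def by (intro continuous_closed_preimage_constant continuous_on_closed_Collect_le
          continuous_intros w s closed_atLeastAtMost)
    have ne: "a \<in> A" using ac by (simp add: A_def)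
    have bdd: "bdd_above A" unfolding A_def by (rule bdd_aboveI[of _ c]) auto
    define y where "y = Sup A"
    have y: "y \<in> A" unfolding y_def using ne bdd cl by (intro closed_contains_Sup) auto
    have "y = c"
    proof (rule ccontr)
      assume "y \<noteq> c"
      then have yc: "a \<le> y" "y < c" using y by (auto simp: A_def)
      have "\<forall>\<^sub>F z in at_right y. z < c" using yc(2) by (simp add: eventually_at_right_less eventually_at_right[OF yc(2)]) blast
      then have "\<forall>\<^sub>F z in at_right y. z \<in> A \<and> y < z"
        using step[OF yc \<epsilon>] eventually_at_right_less
      proof eventually_elim
        fix z assume "z < c" "- \<epsilon> * (s z - s y) \<le> w z - w y" "y < z"
        moreover have "- \<epsilon> * (s y - s a) \<le> w y - w a" using y by (simp add: A_def)
        ultimately show "z \<in> A \<and> y < z" using yc by (auto simp: A_def algebra_simps)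
      qed
      then obtain z where "z \<in> A" "y < z"
        using eventually_happens'[of "at_right y"] by (auto simp: trivial_limit_at_right_real)
      then show False using cSup_upper[OF _ bdd, of z] by (simp add: y_def)
    qed
    then show ?thesis using y by (simp add: A_def)
  qed
  show ?thesis
  proof (rule field_le_epsilon)
    fix e :: real assume e: "0 < e"
    \<comment> \<open>The added \<open>1\<close> makes the slack \<open>e / K\<close> well defined
      and keeps the accumulated error at most \<open>e\<close>.\<close>
    have K: "0 < \<bar>s c - s a\<bar> + 1" by linarith
    have "e / (\<bar>s c - s a\<bar> + 1) * (s c - s a) \<le> e / (\<bar>s c - s a\<bar> + 1) * (\<bar>s c - s a\<bar> + 1)"
      using e K by (intro mult_left_mono) auto
    also have "\<dots> = e" using K by simp
    finally show "w a \<le> w c + e" using *[of "e / (\<bar>s c - s a\<bar> + 1)"] e K by simp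
  qed
qed

section \<open>Slope of a solution against the mass of the speed measure\<close>

lemma open_part_Ioc: "0 < x \<Longrightarrow> ereal q < b \<Longrightarrow> {x<..q} \<subseteq> open_part b" "0 < x \<Longrightarrow> ereal q < b \<Longrightarrow> {x..q} \<subseteq> open_part b"
  by (auto simp: open_part_def) (metis ereal_less_eq(3) order_le_less_trans)+

lemma open_part_borel [measurable]: "open_part b \<in> sets borel"
proof -
  have "is_interval (open_part b)"
    unfolding is_interval_1 using open_part_between by blast
  then show ?thesis by (rule real_interval_borel_measurable)
qed

lemma borel_measurable_antimono_ennreal:
  fixes F :: "real \<Rightarrow> ennreal"
  assumes F: "\<And>x y. x \<le> y \<Longrightarrow> F y \<le> F x"
  shows "F \<in> borel_measurable borel"
proof (rule borel_measurableI_less)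
  fix a
  have "is_interval {x. F x < a}"
    unfolding is_interval_1 using F by (auto intro: le_less_trans)
  then show "{x \<in> space borel. F x < a} \<in> sets borel"
    using real_interval_borel_measurable by simp
qed

lemma sets_stieltjes: "sets (stieltjes b s) = sets (restrict_space borel (open_part b))"
  by (simp add: stieltjes_def)

text \<open>The right derivative \<open>h = dv/ds\<close> loses exactly the mass of
  \<open>m\<close>, so \<open>h x = h q + m {x<..q}\<close>, and \<open>h q \<ge> 0\<close> because
  \<open>v\<close> increases. Hence \<open>h\<close> dominates the truncated tail of
  \<open>m\<close>, and integration against \<open>ds\<close> bounds the integral by the increment
  of \<open>v\<close>. The room between \<open>q\<close> and \<open>r\<close> is there for the right
  derivative at \<open>q\<close>.\<close>

lemma nn_integral_speed_tail_le:
  fixes v s :: "real \<Rightarrow> real"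
  assumes m: "speed_measure b m" and s: "scale_function b s"
    and d: "0 < d" "d < q" "q < r" "ereal r \<le> b"
    and gen: "has_dm_ds m s {0<..<r} v (\<lambda>_. - 1)"
    and mono: "\<And>x y. 0 < x \<Longrightarrow> x \<le> y \<Longrightarrow> y < r \<Longrightarrow> v x \<le> v y"
  shows "(\<integral>\<^sup>+x. indicator {d<..} x * emeasure m {y\<in>open_part b. x < y \<and> y \<le> q} \<partial>stieltjes b s)
    \<le> ennreal (v q - v d)"
proof -
  define F where "F x = emeasure m {y\<in>open_part b. x < y \<and> y \<le> q}" for x
  let ?\<sigma> = "stieltjes b s"
  have sm: "sets m = sets (restrict_space borel (open_part b))" using m by (simp add: speed_measure_def)
  have qb: "ereal y < b" if "y < r" for y using that d(4) by (metis ereal_less_eq(3) less_ereal.simps(1) less_le_trans)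
  have inU: "y \<in> open_part b" if "0 < y" "y < r" for y using that qb by (auto simp: open_part_def)
  have sIoc: "{x<..y} \<in> sets m" "{x<..y} \<in> sets ?\<sigma>" if "0 < x" "y < r" for x y
    using open_part_Ioc(1)[OF that(1) qb[OF that(2)]] unfolding sm sets_stieltjes
    by (auto simp: sets_restrict_space_iff)
  have Feq: "F x = emeasure m {x<..q}" if "0 < x" for x
    unfolding F_def using open_part_Ioc(1)[OF that qb[OF d(3)]] by (intro arg_cong[where f = "emeasure m"]) auto
  have Fmono: "F y \<le> F x" if "x \<le> y" for x y
  proof -
    have "{y\<in>open_part b. x < y \<and> y \<le> q} = open_part b \<inter> {x<..q}" by auto
    then have "{y\<in>open_part b. x < y \<and> y \<le> q} \<in> sets m"
      unfolding sm by (simp add: sets_restrict_space_iff)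
    then show ?thesis unfolding F_def using that by (intro emeasure_mono) auto
  qed
  have Fm: "F \<in> borel_measurable ?\<sigma>"
  proof -
    have "F \<in> borel_measurable (restrict_space borel (open_part b))"
      by (intro measurable_restrict_space1 borel_measurable_antimono_ennreal Fmono)
    then show ?thesis using measurable_cong_sets[OF sets_stieltjes refl] by blast
  qed
  have sc: "continuous_on {d..q} s" "\<And>x y. 0 < x \<Longrightarrow> x < y \<Longrightarrow> y < r \<Longrightarrow> s x < s y"
    using s inU open_part_Ioc(2)[OF d(1) qb[OF d(3)]] strict_mono_onD[of "open_part b" s]
    unfolding scale_function_def by (auto intro: continuous_on_subset)
  have vc: "continuous_on {d..q} v"
    using gen d unfolding has_dm_ds_def by (auto intro: continuous_on_subset)
  obtain h where h: "\<And>x. x \<in> {0<..<r} \<Longrightarrow> ((\<lambda>y. (v y - v x) /\<^sub>R (s y - s x)) \<longlongrightarrow> h x) (at_right x)"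
    and hm: "\<And>x y. x \<in> {0<..<r} \<Longrightarrow> y \<in> {0<..<r} \<Longrightarrow> x < y \<Longrightarrow> h y - h x = (LINT z:{x<..y}|m. - 1)"
    using gen unfolding has_dm_ds_def by blast
  have near: "\<forall>\<^sub>F y in at_right x. y < c" if "x < c" for x c :: real
    using that eventually_at_right[OF that] by blast
  have h0: "0 \<le> h x" if x: "0 < x" "x < r" for x
  proof (rule tendsto_lowerbound[OF h])
    show "\<forall>\<^sub>F y in at_right x. 0 \<le> (v y - v x) /\<^sub>R (s y - s x)"
      using near[OF x(2)] eventually_at_right_less
    proof eventually_elim
      fix y assume "y < r" "x < y"
      then show "0 \<le> (v y - v x) /\<^sub>R (s y - s x)"
        using mono[of x y] sc(2)[of x y] x by (auto intro!: mult_nonneg_nonneg)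
    qed
  qed (use x in \<open>auto simp: trivial_limit_at_right_real\<close>)
  have mfin: "emeasure m {x<..y} < \<infinity>" if "0 < x" "y < r" for x y
  proof -
    have sub: "{x..y} \<subseteq> open_part b" by (rule open_part_Ioc(2)[OF that(1) qb[OF that(2)]])
    then have "{x..y} \<in> sets m" unfolding sm by (auto simp: sets_restrict_space_iff)
    then have "emeasure m {x<..y} \<le> emeasure m {x..y}" by (intro emeasure_mono) auto
    also have "\<dots> < \<infinity>" using m sub compact_Icc unfolding speed_measure_def by blast
    finally show ?thesis .
  qed
  have Fh: "F x \<le> ennreal (h x)" if x: "0 < x" "x < q" for x
  proof -
    have "h q - h x = - measure m {x<..q}"
      using hm[of x q] x d sIoc[OF x(1) d(3)] mfin[OF x(1) d(3)]
      by (simp add: set_lebesgue_integral_def)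
    then have "measure m {x<..q} \<le> h x" using h0[of q] d by simp
    moreover have "F x = ennreal (measure m {x<..q})"
      using mfin[OF x(1) d(3)] Feq[OF x(1)] by (simp add: emeasure_eq_ennreal_measure top.not_eq_extremum)
    ultimately show ?thesis by (simp add: ennreal_leI)
  qed
  define I where "I x y = (\<integral>\<^sup>+z. indicator {x<..y} z * F z \<partial>?\<sigma>)" for x y
  have I_le: "I x y \<le> F x * ennreal (s y - s x)" if "0 < x" "x \<le> y" "y < r" for x y
  proof -
    have "I x y \<le> (\<integral>\<^sup>+z. F x * indicator {x<..y} z \<partial>?\<sigma>)"
      unfolding I_def by (intro nn_integral_mono) (auto simp: indicator_def intro: Fmono)
    also have "\<dots> = F x * emeasure ?\<sigma> {x<..y}"
      using sIoc(2)[OF that(1,3)] by (rule nn_integral_cmult_indicator)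
    also have "emeasure ?\<sigma> {x<..y} = ennreal (s y - s x)"
      using that by (intro emeasure_stieltjes_Ioc[OF s] inU) auto
    finally show ?thesis .
  qed
  have I_split: "I d z = I d y + I y z" if "d \<le> y" "y \<le> z" "z < r" for y z
  proof -
    have "I d z = (\<integral>\<^sup>+x. indicator {d<..y} x * F x + indicator {y<..z} x * F x \<partial>?\<sigma>)"
      unfolding I_def using that by (intro nn_integral_cong) (auto simp: indicator_def)
    also have "\<dots> = I d y + I y z"
      unfolding I_def using that d sIoc Fm by (intro nn_integral_add borel_measurable_times) auto
    finally show ?thesis .
  qed
  have Ffin: "F x < \<infinity>" if "0 < x" for x using Feq mfin that d by simp
  have Ifin: "I x y < \<infinity>" if "0 < x" "x \<le> y" "y < r" for x y
  proof -
    have "F x * ennreal (s y - s x) < \<infinity>" using Ffin[OF that(1)] by (auto simp: ennreal_mult_less_top)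
    then show ?thesis using I_le[OF that] by (rule le_less_trans[rotated])
  qed
  \<comment> \<open>Since \<open>h\<close> is only a right derivative, it is not integrated; instead
    \<open>v\<close> is compared with the indefinite integral \<open>G\<close> of \<open>F\<close>
    by the mean value inequality. The Lipschitz bound of \<open>G\<close> in \<open>s\<close>
    supplies the continuity needed there.\<close>
  define G where "G y = enn2real (I d y)" for y
  have G_diff: "0 \<le> G z - G y" "G z - G y \<le> enn2real (F y) * (s z - s y)"
    if yz: "d \<le> y" "y \<le> z" "z \<le> q" for y z
  proof -
    have y0: "0 < y" "z < r" "y < r" using yz d by auto
    have "G z = G y + enn2real (I y z)"
      unfolding G_def using I_split[OF yz(1,2) y0(2)] Ifin[OF d(1) yz(1) y0(3)] Ifin[OF y0(1) yz(2) y0(2)]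
      by (simp add: enn2real_plus)
    moreover have "enn2real (I y z) \<le> enn2real (F y * ennreal (s z - s y))"
      using I_le[OF y0(1) yz(2) y0(2)] Ffin[OF y0(1)]
      by (intro enn2real_mono) (auto simp: ennreal_mult_less_top)
    moreover have "0 \<le> s z - s y" using sc(2)[of y z] y0 yz by (cases "y = z") auto
    ultimately show "0 \<le> G z - G y" "G z - G y \<le> enn2real (F y) * (s z - s y)"
      by (auto simp: enn2real_mult)
  qed
  have Fr: "enn2real (F y) \<le> enn2real (F d)" if "d \<le> y" for y
    using Fmono[OF that] Ffin[OF d(1)] by (intro enn2real_mono) auto
  have Glip: "\<bar>G z - G y\<bar> \<le> enn2real (F d) * \<bar>s z - s y\<bar>" if "y \<in> {d..q}" "z \<in> {d..q}" for y z
  proof -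
    have *: "\<bar>G z - G y\<bar> \<le> enn2real (F d) * \<bar>s z - s y\<bar>" if "d \<le> y" "y \<le> z" "z \<le> q" for y z
    proof -
      have "0 \<le> s z - s y" using sc(2)[of y z] that d by (cases "y = z") auto
      then show ?thesis
        using G_diff[OF that] mult_right_mono[OF Fr[OF that(1)], of "s z - s y"] by auto
    qed
    show ?thesis
      using *[of y z] *[of z y] that by (cases "y \<le> z") (auto simp: abs_minus_commute)
  qed
  have Gc: "continuous_on {d..q} G"
    unfolding continuous_on_def
  proof
    fix y assume y: "y \<in> {d..q}"
    have "((\<lambda>z. G z - G y) \<longlongrightarrow> 0) (at y within {d..q})"
    proof (rule Lim_null_comparison)
      show "\<forall>\<^sub>F z in at y within {d..q}. norm (G z - G y) \<le> enn2real (F d) * \<bar>s z - s y\<bar>"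
        using Glip y by (auto simp: eventually_at_filter)
      have "((\<lambda>z. enn2real (F d) * \<bar>s z - s y\<bar>) \<longlongrightarrow> enn2real (F d) * \<bar>s y - s y\<bar>) (at y within {d..q})"
        using sc(1) y by (intro tendsto_intros) (auto simp: continuous_on_def)
      then show "((\<lambda>z. enn2real (F d) * \<bar>s z - s y\<bar>) \<longlongrightarrow> 0) (at y within {d..q})" by simp
    qed
    then show "(G \<longlongrightarrow> G y) (at y within {d..q})" by (rule LIM_zero_cancel)
  qed
  have "v d - G d \<le> v q - G q"
  proof (rule scale_mean_value[OF d(2) _ sc(1)])
    show "continuous_on {d..q} (\<lambda>y. v y - G y)" by (intro continuous_intros vc Gc)
    fix z \<epsilon> :: real assume z: "d \<le> z" "z < q" and \<epsilon>: "0 < \<epsilon>"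
    have z': "z \<in> {0<..<r}" using z d by auto
    have "\<forall>\<^sub>F y in at_right z. h z - \<epsilon> < (v y - v z) /\<^sub>R (s y - s z)"
      using h[OF z'] by (rule order_tendstoD) (use \<epsilon> in simp)
    then show "\<forall>\<^sub>F y in at_right z. - \<epsilon> * (s y - s z) \<le> v y - G y - (v z - G z)"
      using near[OF z(2)] eventually_at_right_less
    proof eventually_elim
      fix y assume *: "h z - \<epsilon> < (v y - v z) /\<^sub>R (s y - s z)" "y < q" "z < y"
      have pos: "0 < s y - s z" using sc(2)[of z y] * z d by auto
      then have "(h z - \<epsilon>) * (s y - s z) < v y - v z"
        using *(1) by (simp add: field_simps)
      moreover have "G y - G z \<le> enn2real (F z) * (s y - s z)" using * z by (intro G_diff) auto
      \<comment> \<open>\<open>F\<close> decreases, so to the right of \<open>z\<close> the slope of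
        \<open>G\<close> is at most \<open>F z\<close>, and this is at most the slope
        \<open>h z\<close> of \<open>v\<close>.\<close>
      moreover have "enn2real (F z) \<le> h z" using Fh[of z] z d h0[of z] by (intro enn2real_leI) auto
      then have "enn2real (F z) * (s y - s z) \<le> h z * (s y - s z)" using pos by (intro mult_right_mono) auto
      ultimately show "- \<epsilon> * (s y - s z) \<le> v y - G y - (v z - G z)" by (simp add: algebra_simps)
    qed
  qed
  moreover have "G d = 0" by (simp add: G_def I_def)
  ultimately have "G q \<le> v q - v d" by simp
  moreover have "I d q = ennreal (G q)"
    unfolding G_def using Ifin[OF d(1), of q] d by simp
  ultimately have "I d q \<le> ennreal (v q - v d)" by (simp add: ennreal_leI)
  moreover have "(\<integral>\<^sup>+x. indicator {d<..} x * F x \<partial>?\<sigma>) = I d q"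
    unfolding I_def
  proof (intro nn_integral_cong)
    fix x
    have "F x = 0" if "q < x"
    proof -
      have "{y\<in>open_part b. x < y \<and> y \<le> q} = {}" using that by auto
      then show ?thesis by (simp only: F_def emeasure_empty)
    qed
    then show "indicator {d<..} x * F x = indicator {d<..q} x * F x" by (auto simp: indicator_def)
  qed
  ultimately show ?thesis by (simp add: F_def)
qed

text \<open>Monotone convergence along levels \<open>u n\<close> increasing to \<open>b\<close>: the
  truncated masses increase to the full tail of \<open>m\<close>, and the bound \<open>C\<close> is
  uniform in the truncation.\<close>

lemma boundary_I_le:
  assumes m: "speed_measure b m" and d: "0 < d" "ereal d < b"
    and le: "\<And>q. d < q \<Longrightarrow> ereal q < b \<Longrightarrow>
      (\<integral>\<^sup>+x. indicator {d<..} x * emeasure m {y\<in>open_part b. x < y \<and> y \<le> q} \<partial>stieltjes b s) \<le> C"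
  shows "boundary_I b m s d \<le> C"
proof -
  obtain u l :: "nat \<Rightarrow> real" where u: "incseq u" "\<And>i. l i < u i" "\<And>i. ereal d < ereal (l i)" "\<And>i. ereal (u i) < b"
    "(\<lambda>i. ereal (u i)) \<longlonglongrightarrow> b"
  proof (rule einterval_Icc_approximation[OF d(2)])
    fix u l :: "nat \<Rightarrow> real"
    assume "incseq u" "\<And>i. l i < u i" "\<And>i. ereal d < ereal (l i)" "\<And>i. ereal (u i) < b"
      "(\<lambda>i. ereal (u i)) \<longlonglongrightarrow> b"
    then show thesis by (rule that)
  qed
  have sm: "sets m = sets (restrict_space borel (open_part b))" using m by (simp add: speed_measure_def)
  let ?A = "\<lambda>x n. {y\<in>open_part b. x < y \<and> y \<le> u n}"
  have A: "?A x n \<in> sets m" for x n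
  proof -
    have "?A x n = open_part b \<inter> {x<..u n}" by auto
    then show ?thesis unfolding sm by (simp add: sets_restrict_space_iff)
  qed
  have un: "(\<Union>n. ?A x n) = {y\<in>open_part b. x < y}" for x
  proof (intro set_eqI iffI)
    fix y assume y: "y \<in> {y\<in>open_part b. x < y}"
    then have "ereal y < b" by (simp add: open_part_def)
    then have "\<forall>\<^sub>F n in sequentially. ereal y < ereal (u n)" by (rule order_tendstoD(1)[OF u(5)])
    then obtain n where "ereal y < ereal (u n)" by (meson eventually_happens trivial_limit_sequentially)
    then have "y \<le> u n" by simp
    then show "y \<in> (\<Union>n. ?A x n)" using y by blast
  qed auto
  have inc: "incseq (?A x)" for x using u(1) by (auto simp: incseq_def intro: order_trans)
  have "boundary_I b m s d = (\<integral>\<^sup>+x. (SUP n. indicator {d<..} x * emeasure m (?A x n)) \<partial>stieltjes b s)"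
    unfolding boundary_I_def
  proof (intro nn_integral_cong)
    fix x
    have "emeasure m {y\<in>open_part b. x < y} = (SUP n. emeasure m (?A x n))"
      unfolding un[symmetric] using A inc by (intro SUP_emeasure_incseq[symmetric]) auto
    then show "indicator {d<..} x * emeasure m {y\<in>open_part b. x < y} =
        (SUP n. indicator {d<..} x * emeasure m (?A x n))"
      by (simp add: SUP_mult_left_ennreal)
  qed
  also have "\<dots> = (SUP n. \<integral>\<^sup>+x. indicator {d<..} x * emeasure m (?A x n) \<partial>stieltjes b s)"
  proof (rule nn_integral_monotone_convergence_SUP)
    show "incseq (\<lambda>n x. indicator {d<..} x * emeasure m (?A x n))"
      using inc A by (auto simp: incseq_def le_fun_def intro!: mult_left_mono emeasure_mono)
    fix n
    have F: "(\<lambda>x. emeasure m (?A x n)) \<in> borel_measurable borel"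
      using A by (intro borel_measurable_antimono_ennreal emeasure_mono) auto
    have "(\<lambda>x. indicator {d<..} x * emeasure m (?A x n)) \<in> borel_measurable (restrict_space borel (open_part b))"
      using F by (intro measurable_restrict_space1) measurable
    then show "(\<lambda>x. indicator {d<..} x * emeasure m (?A x n)) \<in> borel_measurable (stieltjes b s)"
      using measurable_cong_sets[OF sets_stieltjes refl] by blast
  qed
  also have "\<dots> \<le> C"
  proof (rule SUP_least)
    fix n
    have "d < u n" using u(2)[of n] u(3)[of n] by simp
    then show "(\<integral>\<^sup>+x. indicator {d<..} x * emeasure m (?A x n) \<partial>stieltjes b s) \<le> C" using u(4) by (rule le)
  qed
  finally show ?thesis .
qed

section \<open>Bound, continuity and generator of the mean hitting time\<close>

context absorbed_diffusion
begin

lemma emeasure_survival_0: "emeasure (P 0) (survival \<Omega> X u) = 0"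
proof -
  have "emeasure (P 0) (survival \<Omega> X u) = emeasure (P 0) {}"
  proof (rule emeasure_eq_AE)
    show "AE \<omega> in P 0. \<omega> \<in> survival \<Omega> X u \<longleftrightarrow> \<omega> \<in> {}"
      using start[OF half_open_0]
    proof eventually_elim
      fix \<omega> assume "X 0 \<omega> = 0"
      then have "T0 \<omega> \<le> ennreal 0" by (intro hitting_time_le) auto
      then show "\<omega> \<in> survival \<Omega> X u \<longleftrightarrow> \<omega> \<in> {}" by (auto simp: survival_def)
    qed
    show "survival \<Omega> X u \<in> sets (P 0)" unfolding sets_P[OF half_open_0] by (rule survival_sets)
  qed simp
  then show ?thesis by simp
qed

lemma survival_Markov:
  assumes x: "x \<in> half_open b" and t: "0 \<le> t" "0 \<le> u"
  shows "emeasure (P x) (survival \<Omega> X (t + u)) = (\<integral>\<^sup>+\<omega>. emeasure (P (X t \<omega>)) (survival \<Omega> X u) \<partial>P x)"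
proof -
  have "emeasure (P x) (survival \<Omega> X (t + u)) =
      emeasure (P x) {\<omega>\<in>\<Omega>. ennreal t < \<infinity> \<and> ennreal t + ennreal u < T0 \<omega>}"
    using t by (simp add: survival_def)
  also have "\<dots> = (\<integral>\<^sup>+\<omega>. indicator {\<omega>\<in>\<Omega>. ennreal t < \<infinity>} \<omega> *
      emeasure (P (X (enn2real (ennreal t)) \<omega>)) (survival \<Omega> X u) \<partial>P x)"
    by (rule survival_strong_Markov[OF x optional_time_const t(2)])
  also have "\<dots> = (\<integral>\<^sup>+\<omega>. emeasure (P (X t \<omega>)) (survival \<Omega> X u) \<partial>P x)"
    using t by (intro nn_integral_cong) (simp add: space_P[OF x])
  finally show ?thesis .
qed

text \<open>Off the survival event the position is \<open>0\<close>, from where survival has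
  probability zero; the indicator can thus be inserted or dropped at will.\<close>

lemma AE_dead_after_survival:
  assumes x: "x \<in> half_open b" and t: "0 \<le> t"
  shows "AE \<omega> in P x. emeasure (P (X t \<omega>)) (survival \<Omega> X u) =
    emeasure (P (X t \<omega>)) (survival \<Omega> X u) * indicator (survival \<Omega> X t) \<omega>"
  using AE_X_eq_0_iff[OF x] AE_space
proof eventually_elim
  fix \<omega> assume *: "\<forall>t\<ge>0. X t \<omega> = 0 \<longleftrightarrow> T0 \<omega> \<le> ennreal t" "\<omega> \<in> space (P x)"
  show "emeasure (P (X t \<omega>)) (survival \<Omega> X u) =
    emeasure (P (X t \<omega>)) (survival \<Omega> X u) * indicator (survival \<Omega> X t) \<omega>"
  proof (cases "\<omega> \<in> survival \<Omega> X t")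
    case False
    then have "X t \<omega> = 0" using * t by (auto simp: survival_def space_P[OF x] not_less)
    then show ?thesis by (simp add: emeasure_survival_0)
  qed simp
qed

text \<open>The Markov property at multiples of \<open>u\<close> gives survival up to
  \<open>n * u\<close> probability at most \<open>p ^ n\<close>. The lifetime is at most
  \<open>u\<close> times the number of \<open>n\<close> with \<open>n * u < T0\<close>, and the
  geometric series gives \<open>u / (1 - p)\<close>.\<close>

lemma nn_integral_T0_le:
  assumes u: "0 < u" and p: "0 \<le> p" "p < 1"
    and le: "\<And>x. x \<in> half_open b \<Longrightarrow> emeasure (P x) (survival \<Omega> X u) \<le> ennreal p"
    and x: "x \<in> half_open b"
  shows "(\<integral>\<^sup>+\<omega>. T0 \<omega> \<partial>P x) \<le> ennreal (u / (1 - p))"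
proof -
  have S: "survival \<Omega> X t \<in> sets (P x)" for t unfolding sets_P[OF x] by (rule survival_sets)
  have bound: "emeasure (P x) (survival \<Omega> X (real n * u)) \<le> ennreal (p ^ n)" for n
  proof (induction n)
    case 0
    interpret prob_space "P x" by (rule prob_space_P[OF x])
    show ?case by (simp add: emeasure_le_1)
  next
    case (Suc n)
    have "emeasure (P x) (survival \<Omega> X (real (Suc n) * u)) =
        (\<integral>\<^sup>+\<omega>. emeasure (P (X (real n * u) \<omega>)) (survival \<Omega> X u) \<partial>P x)"
      using survival_Markov[OF x, of "real n * u" u] u by (simp add: algebra_simps)
    also have "\<dots> \<le> (\<integral>\<^sup>+\<omega>. ennreal p * indicator (survival \<Omega> X (real n * u)) \<omega> \<partial>P x)"
    proof (rule nn_integral_mono_AE)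
      have nu: "0 \<le> real n * u" using u by simp
      show "AE \<omega> in P x. emeasure (P (X (real n * u) \<omega>)) (survival \<Omega> X u)
          \<le> ennreal p * indicator (survival \<Omega> X (real n * u)) \<omega>"
        using AE_dead_after_survival[OF x nu, of u] AE_space
      proof eventually_elim
        fix \<omega> assume *: "emeasure (P (X (real n * u) \<omega>)) (survival \<Omega> X u) =
          emeasure (P (X (real n * u) \<omega>)) (survival \<Omega> X u) * indicator (survival \<Omega> X (real n * u)) \<omega>"
          "\<omega> \<in> space (P x)"
        show "emeasure (P (X (real n * u) \<omega>)) (survival \<Omega> X u)
          \<le> ennreal p * indicator (survival \<Omega> X (real n * u)) \<omega>"
          using * by (subst *(1)) (intro mult_right_mono le X_in_state nu, auto simp: space_P[OF x])
      qed
    qed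
    also have "\<dots> = ennreal p * emeasure (P x) (survival \<Omega> X (real n * u))"
      by (rule nn_integral_cmult_indicator[OF S])
    also have "\<dots> \<le> ennreal p * ennreal (p ^ n)" by (intro mult_left_mono Suc) auto
    also have "\<dots> = ennreal (p ^ Suc n)" using p by (simp add: ennreal_mult)
    finally show ?case .
  qed
  have "(\<integral>\<^sup>+\<omega>. T0 \<omega> \<partial>P x) \<le> (\<integral>\<^sup>+\<omega>. (\<Sum>n. ennreal u * indicator (survival \<Omega> X (real n * u)) \<omega>) \<partial>P x)"
  proof (rule nn_integral_mono_AE)
    show "AE \<omega> in P x. T0 \<omega> \<le> (\<Sum>n. ennreal u * indicator (survival \<Omega> X (real n * u)) \<omega>)"
      using absorbed[OF x] AE_space
    proof eventually_elim
      fix \<omega> assume *: "T0 \<omega> < \<infinity>" "\<omega> \<in> space (P x)"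
      then obtain r where r: "T0 \<omega> = ennreal r" "0 \<le> r" by (cases "T0 \<omega>") auto
      \<comment> \<open>The least \<open>N\<close> with \<open>r \<le> N * u\<close>: for
        \<open>n < N\<close> the inequality \<open>n * u < r\<close> is strict, so each of the
        \<open>N\<close> summands is present.\<close>
      define N where "N = nat \<lceil>r / u\<rceil>"
      have "r / u \<le> real N" unfolding N_def by linarith
      then have "r \<le> real N * u" using u by (simp add: field_simps)
      then have "T0 \<omega> \<le> ennreal (real N * u)" by (simp add: r ennreal_leI)
      also have "\<dots> = (\<Sum>n<N. ennreal u)" using u by (simp add: ennreal_mult ennreal_of_nat_eq_real_of_nat)
      also have "\<dots> \<le> (\<Sum>n<N. ennreal u * indicator (survival \<Omega> X (real n * u)) \<omega>)"
      proof (rule sum_mono)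
        fix n assume "n \<in> {..<N}"
        then have "real n < r / u" unfolding N_def by simp linarith
        then have "real n * u < r" using u by (simp add: field_simps)
        then have "\<omega> \<in> survival \<Omega> X (real n * u)"
          using * u r by (auto simp: survival_def space_P[OF x] ennreal_less_iff)
        then show "ennreal u \<le> ennreal u * indicator (survival \<Omega> X (real n * u)) \<omega>" by simp
      qed
      also have "\<dots> \<le> (\<Sum>n. ennreal u * indicator (survival \<Omega> X (real n * u)) \<omega>)"
        by (rule sum_le_suminf) auto
      finally show "T0 \<omega> \<le> (\<Sum>n. ennreal u * indicator (survival \<Omega> X (real n * u)) \<omega>)" .
    qed
  qed
  also have "\<dots> = (\<Sum>n. \<integral>\<^sup>+\<omega>. ennreal u * indicator (survival \<Omega> X (real n * u)) \<omega> \<partial>P x)"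
    using S by (intro nn_integral_suminf borel_measurable_times borel_measurable_indicator) auto
  also have "\<dots> = (\<Sum>n. ennreal u * emeasure (P x) (survival \<Omega> X (real n * u)))"
    by (intro suminf_cong nn_integral_cmult_indicator S)
  also have "\<dots> \<le> (\<Sum>n. ennreal (u * p ^ n))"
  proof (rule suminf_le)
    fix n
    have "ennreal u * emeasure (P x) (survival \<Omega> X (real n * u)) \<le> ennreal u * ennreal (p ^ n)"
      by (intro mult_left_mono bound) auto
    then show "ennreal u * emeasure (P x) (survival \<Omega> X (real n * u)) \<le> ennreal (u * p ^ n)"
      using u p by (simp add: ennreal_mult)
  qed auto
  also have "\<dots> = ennreal (\<Sum>n. u * p ^ n)"
    using u p by (intro suminf_ennreal2 summable_mult summable_geometric) auto
  also have "(\<Sum>n. u * p ^ n) = u / (1 - p)"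
    using p by (subst suminf_mult) (auto simp: suminf_geometric summable_geometric)
  finally show ?thesis .
qed

text \<open>Its finiteness rests on the uniform bound \<open>C\<close> of the context that follows.
  \<open>survival_near_natural_boundary\<close> obtains that bound from the hypothesis it
  refutes.\<close>

definition mean_T0 :: "real \<Rightarrow> real" where
  "mean_T0 x = (LINT \<omega>|P x. enn2real (T0 \<omega>))"

context
  fixes C :: real
  assumes bounded_mean: "\<And>x. x \<in> half_open b \<Longrightarrow> (\<integral>\<^sup>+\<omega>. T0 \<omega> \<partial>P x) \<le> ennreal C"
begin

lemma
  assumes x: "x \<in> half_open b"
  shows integrable_T0: "integrable (P x) (\<lambda>\<omega>. enn2real (T0 \<omega>))"
    and nn_integral_T0: "(\<integral>\<^sup>+\<omega>. T0 \<omega> \<partial>P x) = ennreal (mean_T0 x)"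
proof -
  have m: "(\<lambda>\<omega>. enn2real (T0 \<omega>)) \<in> borel_measurable (P x)"
    using measurable_T0_P[OF x] by measurable
  have eq: "(\<integral>\<^sup>+\<omega>. ennreal (enn2real (T0 \<omega>)) \<partial>P x) = (\<integral>\<^sup>+\<omega>. T0 \<omega> \<partial>P x)"
    by (rule nn_integral_cong_AE) (use absorbed[OF x] in eventually_elim, simp)
  also have "\<dots> < \<infinity>" using bounded_mean[OF x] by (auto intro: le_less_trans)
  finally show *: "integrable (P x) (\<lambda>\<omega>. enn2real (T0 \<omega>))"
    using m by (intro integrableI_bounded) auto
  show "(\<integral>\<^sup>+\<omega>. T0 \<omega> \<partial>P x) = ennreal (mean_T0 x)"
    unfolding mean_T0_def eq[symmetric] by (rule nn_integral_eq_integral[OF *]) simp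
qed

lemma mean_T0_nonneg: "0 \<le> mean_T0 x"
  by (simp add: mean_T0_def integral_nonneg_AE)

lemma mean_T0_le: "x \<in> half_open b \<Longrightarrow> mean_T0 x \<le> max 0 C"
  using bounded_mean[of x] nn_integral_T0[of x] mean_T0_nonneg[of x]
  by (cases "0 \<le> C") (auto simp: ennreal_le_iff ennreal_neg)

lemma measurable_mean_T0: "mean_T0 \<in> borel_measurable (state_space b)"
proof -
  have "(\<lambda>x. enn2real (\<integral>\<^sup>+\<omega>. T0 \<omega> \<partial>P x)) \<in> borel_measurable (state_space b)"
    by (intro borel_measurable_enn2real measurable_compose[OF kernel']
        nn_integral_measurable_subprob_algebra measurable_T0)
  then show ?thesis
    by (rule measurable_cong[THEN iffD1, rotated])
      (simp add: space_state_space nn_integral_T0 mean_T0_nonneg)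
qed

text \<open>Needed before the differential equation is available, because the generator assumption
  speaks of continuous functions only. The integrand \<open>enn2real\<close> is unbounded and serves
  as its own dominating function.\<close>

lemma continuous_mean_T0: "continuous_on (half_open b) mean_T0"
  unfolding mean_T0_def[abs_def]
proof (rule continuous_expectation_T0[where w = enn2real])
  show "isCont enn2real t" if "t < \<infinity>" for t
    unfolding isCont_def using that by (intro tendsto_enn2real) auto
  show "\<bar>enn2real s\<bar> \<le> enn2real t" if "s \<le> t" "t < \<infinity>" for s t :: ennreal
    using that by (simp add: enn2real_mono)
qed (use integrable_T0 in auto)

lemma mean_T0_mono:
  assumes x: "x \<in> half_open b" and xz: "x \<le> z" "z \<in> half_open b"
  shows "mean_T0 x \<le> mean_T0 z"
proof (cases "x = z")
  case False
  then have xz': "x < z" using xz by simp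
  have o: "optional_time \<Omega> X (exit_time X {x<..})" by (rule optional_exit) simp
  have m: "exit_time X {x<..} \<in> borel_measurable (P z)" "T0 \<in> borel_measurable (P z)"
    using measurable_T0_P[OF xz(2)] measurable_P[OF xz(2) measurable_optional[OF o]] by auto
  have "mean_T0 x = (LINT \<omega>|P z. enn2real (T0 \<omega> - exit_time X {x<..} \<omega>))"
    unfolding mean_T0_def
    by (rule integral_T0_eq[OF x xz(2) o _ exit_above_law[OF x xz' xz(2)]]) simp
  also have "\<dots> \<le> mean_T0 z"
    unfolding mean_T0_def
  proof (rule integral_mono_AE')
    show "AE \<omega> in P z. enn2real (T0 \<omega> - exit_time X {x<..} \<omega>) \<le> enn2real (T0 \<omega>)"
      using absorbed[OF xz(2)] by eventually_elim (simp add: enn2real_mono diff_le_self_ennreal)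
  qed (auto simp: integrable_T0[OF xz(2)])
  finally show ?thesis .
qed simp

text \<open>The mean lifetime from \<open>x\<close> is the mean exit time from \<open>(a, c)\<close>
  plus the mean lifetime from the exit position. Dynkin's quotient therefore equals
  \<open>- 1\<close> exactly for every interval with \<open>0 < a < x < c\<close>, and the limit is
  that of a constant.\<close>

lemma local_generator_mean_T0:
  assumes x: "x \<in> open_part b"
  shows "local_generator X P mean_T0 x (- 1)"
proof -
  have xin: "x \<in> half_open b" and x0: "0 < x" using x by (auto simp: open_part_def half_open_def)
  interpret prob_space "P x" by (rule prob_space_P[OF xin])
  have "\<forall>\<^sub>F (a, c) in at_left x \<times>\<^sub>F at_right x. (0 < a \<and> a < x) \<and> x < c"
  proof -
    have "\<forall>\<^sub>F a in at_left x. 0 < a \<and> a < x"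
      unfolding eventually_at_left[OF x0] using x0 by auto
    moreover have "\<forall>\<^sub>F c in at_right x. x < c" by (rule eventually_at_right_less)
    ultimately show ?thesis unfolding case_prod_beta by (rule eventually_prodI)
  qed
  moreover have "((LINT \<omega>:{\<omega>. X (enn2real (exit_time X {a<..<c} \<omega>)) \<omega> \<in> {a..c}}|P x.
          mean_T0 (X (enn2real (exit_time X {a<..<c} \<omega>)) \<omega>)) - mean_T0 x)
          / enn2real (\<integral>\<^sup>+\<omega>. exit_time X {a<..<c} \<omega> \<partial>P x) = - 1"
    if a: "0 < a" "a < x" and c: "x < c" for a c
  proof -
    let ?T = "exit_time X {a<..<c}"
    have o: "optional_time \<Omega> X ?T" by (rule optional_exit) simp
    have mT [measurable]: "?T \<in> borel_measurable (P x)" "T0 \<in> borel_measurable (P x)"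
      using measurable_T0_P[OF xin] measurable_P[OF xin measurable_optional[OF o]] by auto
    have mX: "X_at ?T \<in> P x \<rightarrow>\<^sub>M state_space b"
      by (intro measurable_P xin measurable_X_at measurable_optional o)
    \<comment> \<open>\<open>a > 0\<close> puts the exit before \<open>T0\<close>; positivity of the
      exit time is kept for the denominator of the quotient.\<close>
    have ae: "AE \<omega> in P x. 0 < ?T \<omega> \<and> ?T \<omega> \<le> T0 \<omega> \<and> T0 \<omega> < \<infinity> \<and> X_at ?T \<omega> \<in> {a..c} \<and> X_at ?T \<omega> \<in> half_open b"
      using start[OF xin] absorbed[OF xin] AE_space
    proof eventually_elim
      fix \<omega> assume *: "X 0 \<omega> = x" "T0 \<omega> < \<infinity>" "\<omega> \<in> space (P x)"
      then have \<omega>: "\<omega> \<in> \<Omega>" by (simp add: space_P[OF xin])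
      then have cont: "continuous_on {0..} (\<lambda>t. X t \<omega>)" by (rule continuous_paths)
      have le: "?T \<omega> \<le> T0 \<omega>" using a
        unfolding hitting_time_eq_exit_time by (intro exit_time_antimono) auto
      then have fin: "?T \<omega> < \<infinity>" using *(2) by (rule le_less_trans)
      have "0 < ?T \<omega>" by (rule exit_time_pos[of X \<omega>, OF cont]) (use * a c in auto)
      moreover have "X_at ?T \<omega> \<in> {a..c}"
        by (rule X_exit_time_closure[OF cont _ _ _ fin]) (use * a c in auto)
      ultimately show "0 < ?T \<omega> \<and> ?T \<omega> \<le> T0 \<omega> \<and> T0 \<omega> < \<infinity> \<and> X_at ?T \<omega> \<in> {a..c} \<and> X_at ?T \<omega> \<in> half_open b"
        using le * \<omega> X_at_in_state by blast
    qed
    let ?\<eta> = "distr (P x) (state_space b) (X_at ?T)"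
    have \<eta>: "?\<eta> \<in> distributions b" by (intro distribution_P xin measurable_optional o)
    \<comment> \<open>The mean of \<open>T0 - ?T\<close> is computed from its law, which is the
      hitting law of the distribution of the exit position.\<close>
    have "(\<integral>\<^sup>+\<omega>. T0 \<omega> - ?T \<omega> \<partial>P x) = (\<integral>\<^sup>+t. t \<partial>distr (P x) borel (\<lambda>\<omega>. T0 \<omega> - ?T \<omega>))"
      by (rule nn_integral_distr[symmetric]) auto
    also have "\<dots> = (\<integral>\<^sup>+t. t \<partial>hitting_law X P ?\<eta>)"
      using hitting_law_stopped[OF xin o] ae by (auto elim: eventually_mono)
    also have "\<dots> = (\<integral>\<^sup>+y. (\<integral>\<^sup>+\<omega>. T0 \<omega> \<partial>P y) \<partial>?\<eta>)" by (rule nn_integral_hitting_law[OF \<eta>]) simp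
    also have "\<dots> = (\<integral>\<^sup>+\<omega>. (\<integral>\<^sup>+\<omega>'. T0 \<omega>' \<partial>P (X_at ?T \<omega>)) \<partial>P x)"
      using measurable_compose[OF kernel' nn_integral_measurable_subprob_algebra[OF measurable_T0]]
      by (intro nn_integral_distr mX) simp
    also have "\<dots> = (\<integral>\<^sup>+\<omega>. ennreal (mean_T0 (X_at ?T \<omega>)) \<partial>P x)"
      by (intro nn_integral_cong nn_integral_T0 X_at_in_state) (simp add: space_P[OF xin])
    finally have res: "(\<integral>\<^sup>+\<omega>. T0 \<omega> - ?T \<omega> \<partial>P x) = (\<integral>\<^sup>+\<omega>. ennreal (mean_T0 (X_at ?T \<omega>)) \<partial>P x)" .
    have mv: "(\<lambda>\<omega>. mean_T0 (X_at ?T \<omega>)) \<in> borel_measurable (P x)"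
      by (rule measurable_compose[OF mX measurable_mean_T0])
    have int: "integrable (P x) (\<lambda>\<omega>. mean_T0 (X_at ?T \<omega>))"
    proof (rule integrable_const_bound[OF _ mv])
      show "AE \<omega> in P x. norm (mean_T0 (X_at ?T \<omega>)) \<le> max 0 C"
        using ae by eventually_elim (use mean_T0_le mean_T0_nonneg in auto)
    qed
    have "ennreal (mean_T0 x) = (\<integral>\<^sup>+\<omega>. T0 \<omega> \<partial>P x)" by (rule nn_integral_T0[OF xin, symmetric])
    also have "\<dots> = (\<integral>\<^sup>+\<omega>. (T0 \<omega> - ?T \<omega>) + ?T \<omega> \<partial>P x)"
      by (rule nn_integral_cong_AE) (use ae in eventually_elim, simp add: diff_add_cancel_ennreal)
    also have "\<dots> = (\<integral>\<^sup>+\<omega>. T0 \<omega> - ?T \<omega> \<partial>P x) + (\<integral>\<^sup>+\<omega>. ?T \<omega> \<partial>P x)"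
      by (rule nn_integral_add) auto
    also have "(\<integral>\<^sup>+\<omega>. T0 \<omega> - ?T \<omega> \<partial>P x) = ennreal (LINT \<omega>|P x. mean_T0 (X_at ?T \<omega>))"
      unfolding res by (rule nn_integral_eq_integral[OF int]) (simp add: mean_T0_nonneg)
    finally have sum: "ennreal (mean_T0 x) =
        ennreal (LINT \<omega>|P x. mean_T0 (X_at ?T \<omega>)) + (\<integral>\<^sup>+\<omega>. ?T \<omega> \<partial>P x)" .
    define e where "e = enn2real (\<integral>\<^sup>+\<omega>. ?T \<omega> \<partial>P x)"
    have fin: "(\<integral>\<^sup>+\<omega>. ?T \<omega> \<partial>P x) < \<infinity>" using sum by (auto simp: less_top[symmetric] ennreal_add_eq_top dest: sym)
    have ipos: "0 \<le> (LINT \<omega>|P x. mean_T0 (X_at ?T \<omega>))" by (simp add: integral_nonneg_AE mean_T0_nonneg)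
    have "ennreal (mean_T0 x) = ennreal ((LINT \<omega>|P x. mean_T0 (X_at ?T \<omega>)) + e)"
      using sum fin ipos by (simp add: e_def ennreal_plus)
    then have mean: "mean_T0 x = (LINT \<omega>|P x. mean_T0 (X_at ?T \<omega>)) + e"
      using ipos mean_T0_nonneg by (subst (asm) ennreal_inj) (auto simp: e_def)
    \<comment> \<open>Division by zero yields zero, so the mean exit time must be shown to be
      positive for the quotient to be \<open>- 1\<close>.\<close>
    have "(\<integral>\<^sup>+\<omega>. ?T \<omega> \<partial>P x) \<noteq> 0"
    proof
      assume "(\<integral>\<^sup>+\<omega>. ?T \<omega> \<partial>P x) = 0"
      then have "AE \<omega> in P x. ?T \<omega> = 0" by (simp add: nn_integral_0_iff_AE)
      then have "AE \<omega> in P x. False" using ae by eventually_elim auto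
      then show False by simp
    qed
    then have epos: "0 < e" using fin by (simp add: e_def enn2real_positive_iff zero_less_iff_neq_zero)
    have "(LINT \<omega>:{\<omega>. X_at ?T \<omega> \<in> {a..c}}|P x. mean_T0 (X_at ?T \<omega>)) = (LINT \<omega>|P x. mean_T0 (X_at ?T \<omega>))"
      unfolding set_lebesgue_integral_def
    proof (rule integral_cong_AE)
      have "{\<omega> \<in> space (P x). X_at ?T \<omega> \<in> {a..c}} \<in> sets (P x)"
      proof -
        have "X_at ?T \<in> borel_measurable (P x)" using mX by (rule measurable_restrict_space2_iff[THEN iffD1, THEN conjunct1])
        then show ?thesis by measurable
      qed
      then have "(\<lambda>\<omega>. indicator {\<omega> \<in> space (P x). X_at ?T \<omega> \<in> {a..c}} \<omega> *\<^sub>R mean_T0 (X_at ?T \<omega>)) \<in> borel_measurable (P x)"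
        using mv by (intro borel_measurable_scaleR borel_measurable_indicator)
      then show "(\<lambda>\<omega>. indicator {\<omega>. X_at ?T \<omega> \<in> {a..c}} \<omega> *\<^sub>R mean_T0 (X_at ?T \<omega>)) \<in> borel_measurable (P x)"
        by (rule measurable_cong[THEN iffD1, rotated]) (auto simp: indicator_def)
      show "AE \<omega> in P x. indicator {\<omega>. X_at ?T \<omega> \<in> {a..c}} \<omega> *\<^sub>R mean_T0 (X_at ?T \<omega>) = mean_T0 (X_at ?T \<omega>)"
        using ae by eventually_elim simp
    qed (rule mv)
    then show ?thesis using mean epos by (simp add: e_def[symmetric])
  qed
  ultimately show ?thesis
    unfolding local_generator_def
    by (intro tendsto_eventually) (auto elim!: eventually_mono simp: Let_def)
qed

end

end

locale absorbed_dm_ds_diffusion = dm_ds_diffusion + absorbed_diffusion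
begin

text \<open>If hitting \<open>0\<close> before a fixed time had probability bounded away from zero, the mean hitting
  time would be a bounded solution of \<open>(d/dm)(d/ds) v = -1\<close>, whose slope dominates the mass of \<open>m\<close>
  near \<open>b\<close>; so \<open>b\<close> would not be natural.\<close>

lemma survival_near_natural_boundary:
  assumes natural: "natural_boundary b m s" and p: "0 \<le> p" "p < 1"
  shows "\<exists>x\<in>open_part b. ennreal p < emeasure (P x) (survival \<Omega> X u)"
proof (rule ccontr)
  assume "\<not> ?thesis"
  then have neg: "emeasure (P x) (survival \<Omega> X u) \<le> ennreal p" if "x \<in> open_part b" for x
    using that by (auto simp: not_less)
  \<comment> \<open>The geometric bound needs a positive time step, while \<open>u\<close> is
    arbitrary. Enlarging the time only decreases survival probabilities.\<close>
  define U where "U = max 1 u"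
  have U: "0 < U" "u \<le> U" by (auto simp: U_def)
  have "emeasure (P x) (survival \<Omega> X U) \<le> ennreal p" if x: "x \<in> half_open b" for x
  proof (cases "x = 0")
    case True
    then show ?thesis by (simp add: emeasure_survival_0)
  next
    case False
    then have xo: "x \<in> open_part b" using x by (auto simp: open_part_def half_open_def)
    have "survival \<Omega> X U \<subseteq> survival \<Omega> X u"
      using ennreal_leI[OF U(2)] by (auto simp: survival_def)
    then have "emeasure (P x) (survival \<Omega> X U) \<le> emeasure (P x) (survival \<Omega> X u)"
      using survival_sets sets_P[OF x] by (intro emeasure_mono) auto
    then show ?thesis using neg[OF xo] by (rule order_trans)
  qed
  then have bd: "(\<integral>\<^sup>+\<omega>. T0 \<omega> \<partial>P x) \<le> ennreal (U / (1 - p))" if "x \<in> half_open b" for x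
    using nn_integral_T0_le[OF U(1) p _ that] by blast
  let ?C = "max 0 (U / (1 - p))"
  obtain d where d: "0 < d" "ereal d < b" using b_pos ereal_dense2[of 0 b] by (auto simp: zero_ereal_def)
  have "boundary_I b m s d \<le> ennreal ?C"
  proof (rule boundary_I_le[OF speed d])
    fix q assume q: "d < q" "ereal q < b"
    \<comment> \<open>A real end point strictly beyond \<open>q\<close> is taken because
      \<open>b\<close> may be infinite and because the slope at \<open>q\<close> needs room on its
      right.\<close>
    obtain r where r: "q < r" "ereal r < b" using ereal_dense2[OF q(2)] by auto
    have sub: "x \<in> half_open b" "x \<in> open_part b" if "0 < x" "x < r" for x
    proof -
      have "ereal x < ereal r" using that by simp
      also note r(2)
      finally show "x \<in> half_open b" "x \<in> open_part b" using that by (auto simp: half_open_def open_part_def)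
    qed
    have gen: "has_dm_ds m s {0<..<r} mean_T0 (\<lambda>_. - 1)"
    proof (subst generator)
      show "continuous_on {0<..<r} mean_T0"
        by (rule continuous_on_subset[OF continuous_mean_T0[OF bd]]) (use sub in auto)
      show "\<forall>x\<in>{0<..<r}. local_generator X P mean_T0 x (- 1)"
        using local_generator_mean_T0[OF bd] sub by auto
    qed (use r q d in auto)
    have "(\<integral>\<^sup>+x. indicator {d<..} x * emeasure m {y\<in>open_part b. x < y \<and> y \<le> q} \<partial>stieltjes b s)
        \<le> ennreal (mean_T0 q - mean_T0 d)"
      by (rule nn_integral_speed_tail_le[OF speed scale d(1) q(1) r(1) less_imp_le[OF r(2)] gen])
        (use mean_T0_mono[OF bd] sub in auto)
    also have "\<dots> \<le> ennreal ?C"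
      using mean_T0_le[OF bd sub(1)[of q]] mean_T0_nonneg[OF bd, of d] q d r by (intro ennreal_leI) auto
    finally show "(\<integral>\<^sup>+x. indicator {d<..} x * emeasure m {y\<in>open_part b. x < y \<and> y \<le> q} \<partial>stieltjes b s) \<le> ennreal ?C" .
  qed
  also have "\<dots> < \<infinity>" by simp
  finally have "boundary_I b m s d < \<infinity>" .
  moreover have "d \<in> open_part b" using d by (simp add: open_part_def)
  then have "boundary_I b m s d = \<infinity>" using natural unfolding natural_boundary_def by blast
  ultimately show False by simp
qed

end

section \<open>Laws with random starting point\<close>

context diffusion
begin

lemma space_distributions: "\<mu> \<in> distributions b \<Longrightarrow> space \<mu> = half_open b"
  using sets_eq_imp_space_eq[of \<mu> "state_space b"] by (auto simp: space_prob_algebra space_state_space)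

lemma measurable_distributions:
  "\<mu> \<in> distributions b \<Longrightarrow> f \<in> state_space b \<rightarrow>\<^sub>M N \<Longrightarrow> f \<in> \<mu> \<rightarrow>\<^sub>M N"
  using measurable_cong_sets[of \<mu> "state_space b" N N] by (auto simp: space_prob_algebra)

text \<open>A path that reaches \<open>y\<close> and then survives for a further time
  \<open>t\<close> has lived longer than \<open>t\<close>. With \<open>hits_pos\<close> this carries
  facts about survival from one starting point to another.\<close>

lemma first_passage_survival:
  assumes x: "x \<in> half_open b" and y: "y \<in> half_open b" and t: "0 \<le> t"
  shows "emeasure (P x) {\<omega>\<in>\<Omega>. hitting_time X y \<omega> < \<infinity>} * emeasure (P y) (survival \<Omega> X t)
    \<le> emeasure (P x) (survival \<Omega> X t)"
proof -
  let ?T = "hitting_time X y"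
  have T: "optional_time \<Omega> X ?T"
    unfolding hitting_time_eq_exit_time by (rule optional_exit_time) (auto intro: continuous_paths)
  have "{\<omega>\<in>space (path_algebra \<Omega> X). ?T \<omega> < \<infinity>} \<in> sets (path_algebra \<Omega> X)"
    using measurable_optional[OF T] by measurable
  then have S: "{\<omega>\<in>\<Omega>. ?T \<omega> < \<infinity>} \<in> sets (P x)" by (simp add: sets_P[OF x])
  have "emeasure (P x) {\<omega>\<in>\<Omega>. ?T \<omega> < \<infinity>} * emeasure (P y) (survival \<Omega> X t) =
      (\<integral>\<^sup>+\<omega>. emeasure (P y) (survival \<Omega> X t) * indicator {\<omega>\<in>\<Omega>. ?T \<omega> < \<infinity>} \<omega> \<partial>P x)"
    by (simp only: nn_integral_cmult_indicator[OF S] mult.commute)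
  also have "\<dots> = (\<integral>\<^sup>+\<omega>. indicator {\<omega>\<in>\<Omega>. ?T \<omega> < \<infinity>} \<omega> * emeasure (P (X_at ?T \<omega>)) (survival \<Omega> X t) \<partial>P x)"
  proof (rule nn_integral_cong)
    fix \<omega>
    have "X_at ?T \<omega> = y" if "\<omega> \<in> \<Omega>" "?T \<omega> < \<infinity>"
      using X_exit_time_notin[of X \<omega> "- {y}", OF continuous_paths[OF that(1)]] that(2)
      unfolding hitting_time_eq_exit_time by auto
    then show "emeasure (P y) (survival \<Omega> X t) * indicator {\<omega>\<in>\<Omega>. ?T \<omega> < \<infinity>} \<omega> =
        indicator {\<omega>\<in>\<Omega>. ?T \<omega> < \<infinity>} \<omega> * emeasure (P (X_at ?T \<omega>)) (survival \<Omega> X t)"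
      by (auto simp: indicator_def)
  qed
  also have "\<dots> = emeasure (P x) {\<omega>\<in>\<Omega>. ?T \<omega> < \<infinity> \<and> ?T \<omega> + ennreal t < T0 \<omega>}"
    by (rule survival_strong_Markov[OF x T t, symmetric])
  also have "\<dots> \<le> emeasure (P x) (survival \<Omega> X t)"
  proof (rule emeasure_mono)
    show "survival \<Omega> X t \<in> sets (P x)" unfolding sets_P[OF x] by (rule survival_sets)
    show "{\<omega>\<in>\<Omega>. ?T \<omega> < \<infinity> \<and> ?T \<omega> + ennreal t < T0 \<omega>} \<subseteq> survival \<Omega> X t"
    proof
      fix \<omega> assume "\<omega> \<in> {\<omega>\<in>\<Omega>. ?T \<omega> < \<infinity> \<and> ?T \<omega> + ennreal t < T0 \<omega>}"
      moreover have "ennreal t \<le> ?T \<omega> + ennreal t" by simp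
      ultimately show "\<omega> \<in> survival \<Omega> X t"
        unfolding survival_def using le_less_trans by blast
    qed
  qed
  finally show ?thesis .
qed

lemma hits_pos:
  assumes x: "x \<in> half_open b - {0}" and y: "y \<in> half_open b"
  shows "0 < emeasure (P x) {\<omega>\<in>\<Omega>. hitting_time X y \<omega> < \<infinity>}"
  using hits[OF assms] by (auto simp: measure_def enn2real_positive_iff)

text \<open>Letting the time tend to infinity in \<open>first_passage_survival\<close> gives that
  the probability of reaching \<open>y\<close> from \<open>x\<close>, times that of never being
  absorbed from \<open>y\<close>, is \<open>0\<close>. The first factor is positive.\<close>

lemma absorbed_from_one_point:
  assumes x: "x \<in> half_open b - {0}" and abs: "AE \<omega> in P x. T0 \<omega> < \<infinity>" and y: "y \<in> half_open b"
  shows "AE \<omega> in P y. T0 \<omega> < \<infinity>"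
proof -
  have x': "x \<in> half_open b" using x by simp
  interpret x: prob_space "P x" by (rule prob_space_P[OF x'])
  let ?S = "\<lambda>n::nat. survival \<Omega> X (real n)" and ?A = "{\<omega>\<in>\<Omega>. T0 \<omega> = \<infinity>}"
  have S: "?S n \<in> sets (P x)" for n unfolding sets_P[OF x'] by (rule survival_sets)
  have Sy: "?S n \<in> sets (P y)" for n unfolding sets_P[OF y] by (rule survival_sets)
  have inter: "(\<Inter>n. ?S n) = ?A"
  proof (intro set_eqI iffI)
    fix \<omega> assume \<omega>: "\<omega> \<in> (\<Inter>n. ?S n)"
    have "T0 \<omega> = \<infinity>"
    proof (rule ccontr)
      assume "T0 \<omega> \<noteq> \<infinity>"
      then obtain r where r: "T0 \<omega> = ennreal r" "0 \<le> r" by (cases "T0 \<omega>") auto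
      obtain n where "r \<le> real n" using real_arch_simple by blast
      then have "\<not> ennreal (real n) < T0 \<omega>" using r by (simp add: not_less ennreal_leI del: ennreal_of_nat_eq_real_of_nat)
      then show False using \<omega> by (auto simp: survival_def)
    qed
    then show "\<omega> \<in> ?A" using \<omega> by (auto simp: survival_def)
  qed (auto simp: survival_def less_top[symmetric])
  have dec: "decseq ?S"
    unfolding decseq_def survival_def
    by (auto intro: le_less_trans[rotated] simp del: ennreal_of_nat_eq_real_of_nat intro!: ennreal_leI)
  have "(\<lambda>n. emeasure (P x) (?S n)) \<longlonglongrightarrow> emeasure (P x) (\<Inter>n. ?S n)"
    by (rule Lim_emeasure_decseq[OF _ dec]) (use S in auto)
  moreover have "emeasure (P x) ?A = emeasure (P x) {}"
  proof (rule emeasure_eq_AE)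
    show "AE \<omega> in P x. \<omega> \<in> ?A \<longleftrightarrow> \<omega> \<in> {}" using abs by eventually_elim auto
    show "?A \<in> sets (P x)" unfolding inter[symmetric] using S by (intro sets.countable_INT) auto
  qed simp
  ultimately have lim: "(\<lambda>n. emeasure (P x) (?S n)) \<longlonglongrightarrow> 0" unfolding inter by simp
  let ?h = "emeasure (P x) {\<omega>\<in>\<Omega>. hitting_time X y \<omega> < \<infinity>}"
  have "?h * emeasure (P y) ?A \<le> emeasure (P x) (?S n)" for n
  proof -
    have "emeasure (P y) ?A \<le> emeasure (P y) (?S n)"
      unfolding inter[symmetric] using Sy by (intro emeasure_mono) auto
    then have "?h * emeasure (P y) ?A \<le> ?h * emeasure (P y) (?S n)" by (intro mult_left_mono) auto
    also have "\<dots> \<le> emeasure (P x) (?S n)" by (rule first_passage_survival[OF x' y]) simp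
    finally show ?thesis .
  qed
  then have "?h * emeasure (P y) ?A \<le> 0" by (intro LIMSEQ_le_const[OF lim]) auto
  then have "emeasure (P y) ?A = 0" using hits_pos[OF x y] by auto
  moreover have "?A \<in> sets (P y)" unfolding inter[symmetric] using Sy by (intro sets.countable_INT) auto
  ultimately have "AE \<omega> in P y. \<omega> \<notin> ?A" by (intro AE_not_in) (simp add: null_sets_def)
  then show ?thesis using AE_space
    by eventually_elim (auto simp: space_P[OF y] less_top[symmetric])
qed

text \<open>An exponential law has no mass at \<open>\<infinity>\<close>, so absorption is almost
  sure from \<open>\<nu>\<close>-almost every point. As \<open>\<nu>\<close> does not charge
  \<open>0\<close>, one such point differs from \<open>0\<close>, and absorption spreads from it.
  Likewise every exponential tail is positive, so some \<open>y\<close> survives \<open>t\<close>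
  with positive probability, and every \<open>x \<noteq> 0\<close> reaches this \<open>y\<close>
  with positive probability.\<close>

lemma exponential_hitting_law_imp_absorbed:
  assumes \<nu>: "\<nu> \<in> distributions b" "emeasure \<nu> {0} = 0" and l: "0 < l"
    and exp: "hitting_law X P \<nu> = exponential_law l"
  shows "x \<in> half_open b \<Longrightarrow> AE \<omega> in P x. T0 \<omega> < \<infinity>"
    and "x \<in> half_open b - {0} \<Longrightarrow> 0 \<le> t \<Longrightarrow> 0 < emeasure (P x) (survival \<Omega> X t)"
proof -
  have sp: "space \<nu> = half_open b" by (rule space_distributions[OF \<nu>(1)])
  interpret \<nu>: prob_space \<nu> using \<nu>(1) by (simp add: space_prob_algebra)
  have "{0} \<in> sets \<nu>"
    using \<nu>(1) half_open_0 by (auto simp: space_prob_algebra sets_restrict_space_iff)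
  then have nz: "AE x in \<nu>. x \<in> half_open b - {0}"
    using AE_not_in[of "{0}" \<nu>] \<nu>(2) AE_space by (auto simp: null_sets_def sp elim: eventually_elim2)
  have tail: "(\<integral>\<^sup>+x. emeasure (P x) (survival \<Omega> X t) \<partial>\<nu>) = ennreal (exp (- (l * t)))" if "0 \<le> t" for t
  proof -
    interpret e: prob_space "exponential_law l" by (rule prob_space_exponential_law[OF l])
    have "(\<integral>\<^sup>+x. emeasure (P x) (survival \<Omega> X t) \<partial>\<nu>) = emeasure (exponential_law l) {ennreal t<..}"
      using emeasure_hitting_law_greaterThan[OF \<nu>(1)] emeasure_initial_law_survival[OF \<nu>(1)] exp by simp
    then show ?thesis
      using that l by (simp add: e.emeasure_eq_measure exponential_law_greaterThan)
  qed
  have "(\<integral>\<^sup>+t. indicator {\<infinity>} t \<partial>exponential_law l) = (\<integral>\<^sup>+x. (\<integral>\<^sup>+\<omega>. indicator {\<infinity>} (T0 \<omega>) \<partial>P x) \<partial>\<nu>)"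
    unfolding exp[symmetric] by (rule nn_integral_hitting_law[OF \<nu>(1)]) simp
  moreover have "(\<integral>\<^sup>+t. indicator {\<infinity>} t \<partial>exponential_law l) = 0"
  proof -
    have "ennreal -` {\<infinity>} = {}" by auto
    then show ?thesis by (simp add: exponential_law_def emeasure_distr)
  qed
  moreover have m: "(\<lambda>x. \<integral>\<^sup>+\<omega>. indicator {\<infinity>} (T0 \<omega>) \<partial>P x) \<in> borel_measurable \<nu>"
    by (intro measurable_distributions[OF \<nu>(1)] measurable_compose[OF kernel']
        nn_integral_measurable_subprob_algebra measurable_compose[OF measurable_T0]) simp
  ultimately have "AE x in \<nu>. (\<integral>\<^sup>+\<omega>. indicator {\<infinity>} (T0 \<omega>) \<partial>P x) = 0"
    by (simp add: nn_integral_0_iff_AE)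
  with nz have "AE x in \<nu>. x \<in> half_open b - {0} \<and> (\<integral>\<^sup>+\<omega>. indicator {\<infinity>} (T0 \<omega>) \<partial>P x) = 0"
    by eventually_elim simp
  then obtain x0 where x0: "x0 \<in> half_open b - {0}" "(\<integral>\<^sup>+\<omega>. indicator {\<infinity>} (T0 \<omega>) \<partial>P x0) = 0"
    using \<nu>.not_empty eventually_happens[of _ "ae_filter \<nu>"] \<nu>.ae_filter_bot by blast
  have "(\<lambda>\<omega>. indicator {\<infinity>} (T0 \<omega>) :: ennreal) \<in> borel_measurable (P x0)"
    using x0(1) by (intro measurable_compose[OF measurable_T0_P]) auto
  then have "AE \<omega> in P x0. indicator {\<infinity>} (T0 \<omega>) = (0::ennreal)"
    using x0(2) by (simp add: nn_integral_0_iff_AE)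
  then have "AE \<omega> in P x0. T0 \<omega> < \<infinity>"
    by eventually_elim (auto simp: less_top[symmetric] indicator_def split: if_splits)
  then show "AE \<omega> in P x. T0 \<omega> < \<infinity>" if "x \<in> half_open b" for x
    by (rule absorbed_from_one_point[OF x0(1) _ that])
  fix x t assume x: "x \<in> half_open b - {0}" and t: "(0::real) \<le> t"
  have "\<exists>y\<in>half_open b. 0 < emeasure (P y) (survival \<Omega> X t)"
  proof (rule ccontr)
    assume "\<not> ?thesis"
    then have "(\<integral>\<^sup>+y. emeasure (P y) (survival \<Omega> X t) \<partial>\<nu>) = (\<integral>\<^sup>+y. 0 \<partial>\<nu>)"
      by (intro nn_integral_cong) (auto simp: sp)
    then show False using tail[OF t] by (simp add: ennreal_eq_0_iff not_le)
  qed
  then obtain y where y: "y \<in> half_open b" "0 < emeasure (P y) (survival \<Omega> X t)" by blast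
  have "0 < emeasure (P x) {\<omega>\<in>\<Omega>. hitting_time X y \<omega> < \<infinity>} * emeasure (P y) (survival \<Omega> X t)"
    using hits_pos[OF x y(1)] y(2) by (simp add: ennreal_zero_less_mult_iff)
  also have "\<dots> \<le> emeasure (P x) (survival \<Omega> X t)"
    by (rule first_passage_survival) (use x y t in auto)
  finally show "0 < emeasure (P x) (survival \<Omega> X t)" .
qed

text \<open>Adding the bound \<open>B\<close> makes the integrand nonnegative, so the identity for
  nonnegative integrals applies; the constant is then cancelled, all measures being
  probabilities.\<close>

lemma integral_hitting_law:
  fixes g :: "ennreal \<Rightarrow> real"
  assumes \<mu>: "\<mu> \<in> distributions b" and g: "g \<in> borel_measurable borel" "\<And>t. \<bar>g t\<bar> \<le> B"
  shows "(LINT t|hitting_law X P \<mu>. g t) = (LINT x|\<mu>. LINT \<omega>|P x. g (T0 \<omega>))"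
proof -
  interpret H: prob_space "hitting_law X P \<mu>" by (rule prob_space_hitting_law[OF \<mu>])
  interpret \<mu>: prob_space \<mu> using \<mu> by (simp add: space_prob_algebra)
  have gH: "g \<in> borel_measurable (hitting_law X P \<mu>)"
    using g(1) measurable_cong_sets[OF sets_hitting_law[OF \<mu>] refl] by blast
  have intP: "integrable (P x) (\<lambda>\<omega>. g (T0 \<omega>))" if "x \<in> half_open b" for x
  proof -
    interpret prob_space "P x" by (rule prob_space_P[OF that])
    show ?thesis
      by (rule integrable_const_bound[where B = B])
        (use g measurable_compose[OF measurable_T0_P[OF that]] in auto)
  qed
  have gm: "(\<lambda>x. LINT \<omega>|P x. g (T0 \<omega>)) \<in> borel_measurable \<mu>"
    by (intro measurable_distributions[OF \<mu>] measurable_compose[OF kernel']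
        integral_measurable_subprob_algebra measurable_compose[OF measurable_T0] g)
  have bd: "\<bar>LINT \<omega>|P x. g (T0 \<omega>)\<bar> \<le> B" if "x \<in> half_open b" for x
  proof -
    interpret prob_space "P x" by (rule prob_space_P[OF that])
    have "\<bar>LINT \<omega>|P x. g (T0 \<omega>)\<bar> \<le> (LINT \<omega>|P x. \<bar>g (T0 \<omega>)\<bar>)" by (rule integral_abs_bound)
    also have "\<dots> \<le> (LINT \<omega>|P x. B)"
      using intP[OF that] g(2) by (intro integral_mono) auto
    finally show ?thesis by (simp add: prob_space)
  qed
  have B: "0 \<le> B" using g(2)[of 0] by linarith
  have intH: "integrable (hitting_law X P \<mu>) g"
    by (rule H.integrable_const_bound[where B = B]) (use gH g in auto)
  have int\<mu>: "integrable \<mu> (\<lambda>x. LINT \<omega>|P x. g (T0 \<omega>))"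
    by (rule \<mu>.integrable_const_bound[where B = B])
      (use gm bd AE_space[of \<mu>] in \<open>auto simp: space_distributions[OF \<mu>] elim!: eventually_mono\<close>)
  have nn: "0 \<le> g t + B" for t using g(2)[of t] by linarith
  have "ennreal ((LINT t|hitting_law X P \<mu>. g t) + B) = ennreal (LINT t|hitting_law X P \<mu>. g t + B)"
    using intH by (simp add: H.prob_space)
  also have "\<dots> = (\<integral>\<^sup>+t. ennreal (g t + B) \<partial>hitting_law X P \<mu>)"
    using intH nn by (intro nn_integral_eq_integral[symmetric]) auto
  also have "\<dots> = (\<integral>\<^sup>+x. (\<integral>\<^sup>+\<omega>. ennreal (g (T0 \<omega>) + B) \<partial>P x) \<partial>\<mu>)"
    by (rule nn_integral_hitting_law[OF \<mu>]) (use g in measurable)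
  also have "\<dots> = (\<integral>\<^sup>+x. ennreal ((LINT \<omega>|P x. g (T0 \<omega>)) + B) \<partial>\<mu>)"
  proof (intro nn_integral_cong)
    fix x assume "x \<in> space \<mu>"
    then have x: "x \<in> half_open b" by (simp add: space_distributions[OF \<mu>])
    interpret prob_space "P x" by (rule prob_space_P[OF x])
    have "(\<integral>\<^sup>+\<omega>. ennreal (g (T0 \<omega>) + B) \<partial>P x) = ennreal (LINT \<omega>|P x. g (T0 \<omega>) + B)"
      using intP[OF x] nn by (intro nn_integral_eq_integral) auto
    then show "(\<integral>\<^sup>+\<omega>. ennreal (g (T0 \<omega>) + B) \<partial>P x) = ennreal ((LINT \<omega>|P x. g (T0 \<omega>)) + B)"
      using intP[OF x] by (simp add: prob_space)
  qed
  also have "\<dots> = ennreal (LINT x|\<mu>. (LINT \<omega>|P x. g (T0 \<omega>)) + B)"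
  proof (intro nn_integral_eq_integral)
    show "AE x in \<mu>. 0 \<le> (LINT \<omega>|P x. g (T0 \<omega>)) + B"
      using AE_space
    proof eventually_elim
      fix x assume "x \<in> space \<mu>"
      then show "0 \<le> (LINT \<omega>|P x. g (T0 \<omega>)) + B"
        using bd[of x] by (simp add: space_distributions[OF \<mu>] abs_le_iff)
    qed
  qed (use int\<mu> in auto)
  also have "\<dots> = ennreal ((LINT x|\<mu>. LINT \<omega>|P x. g (T0 \<omega>)) + B)"
    using int\<mu> by (simp add: \<mu>.prob_space)
  finally have *: "ennreal ((LINT t|hitting_law X P \<mu>. g t) + B) =
      ennreal ((LINT x|\<mu>. LINT \<omega>|P x. g (T0 \<omega>)) + B)" .
  have "0 \<le> (LINT t|hitting_law X P \<mu>. g t + B)" "0 \<le> (LINT x|\<mu>. (LINT \<omega>|P x. g (T0 \<omega>)) + B)"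
  proof -
    show "0 \<le> (LINT t|hitting_law X P \<mu>. g t + B)" using nn by (simp add: integral_nonneg_AE)
    show "0 \<le> (LINT x|\<mu>. (LINT \<omega>|P x. g (T0 \<omega>)) + B)"
      using bd by (intro Bochner_Integration.integral_nonneg) (force simp: space_distributions[OF \<mu>] abs_le_iff)
  qed
  then have "0 \<le> (LINT t|hitting_law X P \<mu>. g t) + B" "0 \<le> (LINT x|\<mu>. LINT \<omega>|P x. g (T0 \<omega>)) + B"
    using intH int\<mu> by (auto simp: H.prob_space \<mu>.prob_space)
  then show ?thesis using * by simp
qed

text \<open>A bounded continuous \<open>f\<close> on \<open>[0, b)\<close> need not extend
  continuously past a finite \<open>b\<close>. The extension \<open>g\<close> reads \<open>f\<close>
  at \<open>max 0 x\<close> below \<open>b\<close> and is \<open>0\<close> from \<open>b\<close> on;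
  its discontinuities lie where \<open>\<nu>\<close> has no mass, so the almost everywhere
  continuous form of weak convergence applies.\<close>

lemma weak_convergence_from_line:
  fixes \<eta> :: "nat \<Rightarrow> real measure" and f :: "real \<Rightarrow> real"
  assumes \<eta>: "\<And>n. \<eta> n \<in> distributions b" and \<nu>: "\<nu> \<in> distributions b"
    and w: "weak_conv_m (\<lambda>n. distr (\<eta> n) borel (\<lambda>x. x)) (distr \<nu> borel (\<lambda>x. x))"
    and f: "continuous_on (half_open b) f" "bounded (f ` half_open b)"
  shows "(\<lambda>n. LINT x|\<eta> n. f x) \<longlonglongrightarrow> (LINT x|\<nu>. f x)"
proof -
  have id: "(\<lambda>x. x) \<in> borel_measurable \<mu>" if "\<mu> \<in> distributions b" for \<mu>
    by (intro measurable_distributions[OF that] measurable_restrict_space1) simp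
  define U where "U = {x. ereal x < b}"
  have U: "open U" unfolding U_def by (intro open_Collect_less continuous_intros)
  define g where "g x = (if x \<in> U then f (max 0 x) else 0)" for x
  have "max 0 x \<in> half_open b" if "x \<in> U" for x
    using that b_pos by (auto simp: U_def half_open_def max_def zero_ereal_def)
  then have gU: "continuous_on U (\<lambda>x. f (max 0 x))"
    by (intro continuous_on_compose2[OF f(1)] continuous_intros) auto
  have gm: "g \<in> borel_measurable borel"
    unfolding g_def[abs_def] using U by (intro borel_measurable_continuous_on_if gU continuous_on_const) auto
  obtain B where B: "\<And>x. x \<in> half_open b \<Longrightarrow> norm (f x) \<le> B"
    using f(2) unfolding bounded_iff by auto
  have B0: "0 \<le> B" using B[OF half_open_0] norm_ge_zero order_trans by blast
  have gB: "norm (g x) \<le> B" for x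
    using B[of "max 0 x"] B0 b_pos by (auto simp: g_def U_def half_open_def max_def zero_ereal_def)
  have cont: "isCont g x" if "x \<in> U" for x
  proof -
    have "continuous_on U g"
      using gU by (rule continuous_on_cong[THEN iffD1, rotated 2]) (auto simp: g_def)
    then show ?thesis using U that by (simp add: continuous_on_eq_continuous_at)
  qed
  have eq: "(LINT x|distr \<mu> borel (\<lambda>x. x). g x) = (LINT x|\<mu>. f x)" if "\<mu> \<in> distributions b" for \<mu>
  proof -
    have "(LINT x|distr \<mu> borel (\<lambda>x. x). g x) = (LINT x|\<mu>. g x)"
      by (rule integral_distr[OF id[OF that] gm])
    also have "\<dots> = (LINT x|\<mu>. f x)"
      by (intro Bochner_Integration.integral_cong)
        (auto simp: space_distributions[OF that] g_def U_def half_open_def)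
    finally show ?thesis .
  qed
  interpret \<nu>: prob_space \<nu> using \<nu> by (simp add: space_prob_algebra)
  have "distr \<nu> borel (\<lambda>x. x) {x. \<not> isCont g x} = 0"
  proof -
    have "- U \<in> sets borel" using U by auto
    then have "emeasure (distr \<nu> borel (\<lambda>x. x)) (- U) = emeasure \<nu> (- U \<inter> space \<nu>)"
      using id[OF \<nu>] by (simp add: emeasure_distr)
    also have "- U \<inter> space \<nu> = {}" by (auto simp: space_distributions[OF \<nu>] U_def half_open_def)
    finally have "emeasure (distr \<nu> borel (\<lambda>x. x)) (- U) = 0" by simp
    moreover have "emeasure (distr \<nu> borel (\<lambda>x. x)) {x. \<not> isCont g x} \<le> emeasure (distr \<nu> borel (\<lambda>x. x)) (- U)"
      using cont U by (intro emeasure_mono) auto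
    ultimately show ?thesis by simp
  qed
  moreover have "real_distribution (distr \<mu> borel (\<lambda>x. x))" if "\<mu> \<in> distributions b" for \<mu>
    using that id[OF that] by (intro prob_space.real_distribution_distr) (auto simp: space_prob_algebra)
  ultimately have "(\<lambda>n. LINT x|distr (\<eta> n) borel (\<lambda>x. x). g x) \<longlonglongrightarrow> (LINT x|distr \<nu> borel (\<lambda>x. x). g x)"
    using \<eta> \<nu> w gB gm by (intro weak_conv_imp_bdd_ae_continuous_conv[where B = B]) auto
  then show ?thesis by (simp add: eq \<eta> \<nu>)
qed

end

section \<open>Limits of conditional laws\<close>

context absorbed_dm_ds_diffusion
begin

text \<open>Choose \<open>c\<close> from which survival up to \<open>u\<close> has probability above
  \<open>1/2\<close>. By monotonicity the same holds from all points beyond \<open>c\<close>, so the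
  mass beyond \<open>c\<close> is at most twice the tail of the hitting law at \<open>u\<close>, and
  that tail tends to \<open>exp (- (l * u))\<close>.\<close>

lemma uniform_tail:
  fixes \<eta> :: "nat \<Rightarrow> real measure"
  assumes natural: "natural_boundary b m s" and l: "0 < l"
    and \<eta>: "\<And>n. \<eta> n \<in> distributions b"
    and conv: "\<And>u. 0 \<le> u \<Longrightarrow> (\<lambda>n. measure (hitting_law X P (\<eta> n)) {ennreal u<..}) \<longlonglongrightarrow> exp (- (l * u))"
    and e: "0 < e"
  shows "\<exists>c\<in>open_part b. \<forall>\<^sub>F n in sequentially. measure (\<eta> n) {x\<in>space (\<eta> n). c < x} < e"
proof -
  \<comment> \<open>Chosen so that \<open>exp (- (l * u)) < e / 2\<close>: the \<open>+ 1\<close>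
    makes the inequality strict, and the maximum keeps \<open>u\<close> nonnegative.\<close>
  define u where "u = max 0 (- ln (e / 2) / l) + 1"
  have u: "0 \<le> u" by (simp add: u_def)
  have "- ln (e / 2) / l < u" unfolding u_def by linarith
  then have "- (l * u) < ln (e / 2)" using l by (simp add: field_simps)
  then have "exp (- (l * u)) < e / 2" using e by (metis exp_less_mono exp_ln half_gt_zero)
  then have ev: "\<forall>\<^sub>F n in sequentially. measure (hitting_law X P (\<eta> n)) {ennreal u<..} < e / 2"
    by (rule order_tendstoD(2)[OF conv[OF u]])
  obtain c where c: "c \<in> open_part b" "ennreal (1 / 2) < emeasure (P c) (survival \<Omega> X u)"
    using survival_near_natural_boundary[OF natural, of "1 / 2" u] by auto
  have ch: "c \<in> half_open b" using c(1) by (auto simp: open_part_def half_open_def)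
  have bound: "measure (\<eta> n) {x\<in>space (\<eta> n). c < x} \<le> 2 * measure (hitting_law X P (\<eta> n)) {ennreal u<..}" for n
  proof -
    interpret H: prob_space "hitting_law X P (\<eta> n)" by (rule prob_space_hitting_law[OF \<eta>])
    interpret \<eta>: prob_space "\<eta> n" using \<eta>[of n] by (simp add: space_prob_algebra)
    have id: "(\<lambda>x. x) \<in> borel_measurable (\<eta> n)"
      by (intro measurable_distributions[OF \<eta>] measurable_restrict_space1) simp
    then have A: "{x\<in>space (\<eta> n). c < x} \<in> sets (\<eta> n)" by measurable
    have "ennreal (1 / 2) * emeasure (\<eta> n) {x\<in>space (\<eta> n). c < x} =
        (\<integral>\<^sup>+x. ennreal (1 / 2) * indicator {x\<in>space (\<eta> n). c < x} x \<partial>\<eta> n)"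
      by (rule nn_integral_cmult_indicator[OF A, symmetric])
    also have "\<dots> \<le> (\<integral>\<^sup>+x. emeasure (P x) (survival \<Omega> X u) \<partial>\<eta> n)"
    proof (rule nn_integral_mono)
      fix x assume x: "x \<in> space (\<eta> n)"
      show "ennreal (1 / 2) * indicator {x\<in>space (\<eta> n). c < x} x \<le> emeasure (P x) (survival \<Omega> X u)"
      proof (cases "c < x")
        case True
        have "emeasure (P c) (survival \<Omega> X u) \<le> emeasure (P x) (survival \<Omega> X u)"
          using True x by (intro survival_mono[OF ch]) (auto simp: space_distributions[OF \<eta>])
        then show ?thesis using c(2) True x by (simp add: order.trans[OF less_imp_le])
      qed simp
    qed
    also have "\<dots> = emeasure (hitting_law X P (\<eta> n)) {ennreal u<..}"
      by (simp only: emeasure_hitting_law_greaterThan[OF \<eta>] emeasure_initial_law_survival[OF \<eta>])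
    finally have "ennreal (1 / 2 * measure (\<eta> n) {x\<in>space (\<eta> n). c < x})
        \<le> ennreal (measure (hitting_law X P (\<eta> n)) {ennreal u<..})"
      unfolding \<eta>.emeasure_eq_measure H.emeasure_eq_measure by (subst ennreal_mult) simp_all
    then have "1 / 2 * measure (\<eta> n) {x\<in>space (\<eta> n). c < x} \<le> measure (hitting_law X P (\<eta> n)) {ennreal u<..}"
      by (subst (asm) ennreal_le_iff) simp_all
    then show ?thesis by simp
  qed
  have "\<forall>\<^sub>F n in sequentially. measure (\<eta> n) {x\<in>space (\<eta> n). c < x} < e"
    using ev
  proof eventually_elim
    fix n assume "measure (hitting_law X P (\<eta> n)) {ennreal u<..} < e / 2"
    then show "measure (\<eta> n) {x\<in>space (\<eta> n). c < x} < e" using bound[of n] by linarith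
  qed
  then show ?thesis using c(1) by blast
qed

section \<open>Tightness and weak limits on the line\<close>

lemma
  assumes \<mu>: "\<mu> \<in> distributions b"
  shows line_distribution: "real_distribution (distr \<mu> borel (\<lambda>x. x))"
    and measure_line: "A \<in> sets borel \<Longrightarrow> measure (distr \<mu> borel (\<lambda>x. x)) A = measure \<mu> (A \<inter> half_open b)"
proof -
  have id: "(\<lambda>x. x) \<in> borel_measurable \<mu>"
    by (intro measurable_distributions[OF \<mu>] measurable_restrict_space1) simp
  show "real_distribution (distr \<mu> borel (\<lambda>x. x))"
    using \<mu> id by (intro prob_space.real_distribution_distr) (auto simp: space_prob_algebra)
  show "measure (distr \<mu> borel (\<lambda>x. x)) A = measure \<mu> (A \<inter> half_open b)" if "A \<in> sets borel"
    using id that by (simp add: measure_distr space_distributions[OF \<mu>])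
qed

lemma tight_of_tail:
  fixes \<eta> :: "nat \<Rightarrow> real measure"
  assumes \<eta>: "\<And>n. \<eta> n \<in> distributions b"
    and tail: "\<And>e. 0 < e \<Longrightarrow> \<exists>c\<in>open_part b. \<forall>\<^sub>F n in sequentially. measure (\<eta> n) {x\<in>space (\<eta> n). c < x} < e"
  shows "tight (\<lambda>n. distr (\<eta> n) borel (\<lambda>x. x))"
  unfolding tight_def
proof (intro conjI allI impI)
  let ?R = "\<lambda>n. distr (\<eta> n) borel (\<lambda>x. x)"
  show "real_distribution (?R n)" for n by (rule line_distribution[OF \<eta>])
  fix e :: real assume e: "0 < e"
  obtain c N where c: "c \<in> open_part b" and N: "\<And>n. N \<le> n \<Longrightarrow> measure (\<eta> n) {x\<in>space (\<eta> n). c < x} < e"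
    using tail[OF e] unfolding eventually_sequentially by blast
  \<comment> \<open>Tightness uses intervals open on the left; the end point \<open>-1\<close> keeps
    a possible atom at \<open>0\<close> inside.\<close>
  have comp: "measure (?R n) {-1<..B} = 1 - measure (\<eta> n) {x\<in>space (\<eta> n). B < x}" for n B
  proof -
    interpret prob_space "\<eta> n" using \<eta>[of n] by (simp add: space_prob_algebra)
    have id: "(\<lambda>x. x) \<in> borel_measurable (\<eta> n)"
      by (intro measurable_distributions[OF \<eta>] measurable_restrict_space1) simp
    then have A: "{x\<in>space (\<eta> n). B < x} \<in> sets (\<eta> n)" by measurable
    have "measure (?R n) {-1<..B} = measure (\<eta> n) ({-1<..B} \<inter> half_open b)" by (rule measure_line[OF \<eta>]) simp
    also have "{-1<..B} \<inter> half_open b = space (\<eta> n) - {x\<in>space (\<eta> n). B < x}"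
      by (auto simp: space_distributions[OF \<eta>] half_open_def)
    finally show ?thesis using prob_compl[OF A] by simp
  qed
  have "\<exists>B. measure (\<eta> n) {x\<in>space (\<eta> n). B < x} < e" for n
  proof -
    interpret R: real_distribution "?R n" by (rule line_distribution[OF \<eta>])
    have "\<forall>\<^sub>F B in at_top. 1 - e < cdf (?R n) B"
      by (rule order_tendstoD(1)[OF R.cdf_lim_at_top_prob]) (use e in simp)
    then obtain B where B: "1 - e < cdf (?R n) B" "-1 < B"
      using eventually_happens[OF eventually_conj[OF _ eventually_gt_at_top[of "-1"]]] by auto
    have "cdf (?R n) (-1) = 0"
    proof -
      have "{..-1} \<inter> half_open b = {}" by (auto simp: half_open_def)
      then show ?thesis unfolding cdf_def by (subst measure_line[OF \<eta>]) auto
    qed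
    then have "measure (?R n) {-1<..B} = cdf (?R n) B" using R.cdf_diff_eq[OF B(2)] by simp
    then show ?thesis using comp[of n B] B(1) by (intro exI[of _ B]) linarith
  qed
  then obtain B where B: "\<And>n. measure (\<eta> n) {x\<in>space (\<eta> n). B n < x} < e" by metis
  \<comment> \<open>The tail bound holds only from \<open>N\<close> on; each of the finitely many
    earlier laws contributes its own level \<open>B n\<close>. The \<open>0\<close> ensures
    \<open>-1 < M\<close>.\<close>
  define M where "M = Max (insert (max 0 c) (B ` {..<N}))"
  have M: "max 0 c \<le> M" "n < N \<Longrightarrow> B n \<le> M" for n
    unfolding M_def by (rule Max_ge; simp)+
  have "measure (\<eta> n) {x\<in>space (\<eta> n). M < x} < e" for n
  proof -
    interpret prob_space "\<eta> n" using \<eta>[of n] by (simp add: space_prob_algebra)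
    have id: "(\<lambda>x. x) \<in> borel_measurable (\<eta> n)"
      by (intro measurable_distributions[OF \<eta>] measurable_restrict_space1) simp
    have mono: "measure (\<eta> n) {x\<in>space (\<eta> n). M < x} \<le> measure (\<eta> n) {x\<in>space (\<eta> n). K < x}" if "K \<le> M" for K
      using that id by (intro finite_measure_mono) (auto, measurable)
    show ?thesis
      using mono[of c] mono[of "B n"] M(1) M(2)[of n] N[of n] B[of n] by (cases "n < N") auto
  qed
  then show "\<exists>a B. a < B \<and> (\<forall>n. 1 - e < measure (?R n) {a<..B})"
    using M(1) by (intro exI[of _ "-1"] exI[of _ M]) (auto simp: comp algebra_simps)
qed

text \<open>Mass could escape through a finite \<open>b\<close> without violating tightness on the
  line. It is excluded by the levels \<open>c < b\<close> of the tail condition, tested with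
  continuous functions.\<close>

lemma weak_limit_in_half_open:
  fixes \<eta> :: "nat \<Rightarrow> real measure"
  assumes \<eta>: "\<And>n. \<eta> n \<in> distributions b"
    and tail: "\<And>e. 0 < e \<Longrightarrow> \<exists>c\<in>open_part b. \<forall>\<^sub>F n in sequentially. measure (\<eta> n) {x\<in>space (\<eta> n). c < x} < e"
    and R: "real_distribution R" and w: "weak_conv_m (\<lambda>n. distr (\<eta> n) borel (\<lambda>x. x)) R"
  shows "measure R (half_open b) = 1"
proof -
  interpret R: real_distribution R by (rule R)
  let ?R = "\<lambda>n. distr (\<eta> n) borel (\<lambda>x. x)"
  have id: "(\<lambda>x. x) \<in> borel_measurable (\<eta> n)" for n
    by (intro measurable_distributions[OF \<eta>] measurable_restrict_space1) simp
  have conv: "(\<lambda>n. LINT x|\<eta> n. f x) \<longlonglongrightarrow> (LINT x|R. f x)"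
    if f: "continuous_on UNIV f" "\<And>x. norm (f x) \<le> 1" for f :: "real \<Rightarrow> real"
  proof -
    have "(\<lambda>n. LINT x|?R n. f x) \<longlonglongrightarrow> (LINT x|R. f x)"
      by (rule weak_conv_imp_integral_bdd_continuous_conv[OF line_distribution[OF \<eta>] R w _ f(2)])
        (use f(1) in \<open>simp add: continuous_on_eq_continuous_at\<close>)
    then show ?thesis
      using integral_distr[OF id borel_measurable_continuous_onI[OF f(1)]] by simp
  qed
  have neg: "measure R {..<0} = 0"
  proof -
    \<comment> \<open>Zero on \<open>[0, b)\<close> and positive on the negative half line, so its
      integral under the limit vanishes and no mass sits below \<open>0\<close>.\<close>
    let ?f = "\<lambda>x::real. max 0 (min 1 (- x))"
    have c: "continuous_on UNIV ?f" by (intro continuous_intros)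
    have "(LINT x|\<eta> n. ?f x) = (LINT x|\<eta> n. 0)" for n
      by (intro Bochner_Integration.integral_cong) (auto simp: space_distributions[OF \<eta>] half_open_def)
    then have "(\<lambda>n::nat. 0) \<longlonglongrightarrow> (LINT x|R. ?f x)"
      using conv[OF c] by (simp add: abs_le_iff)
    then have "(LINT x|R. ?f x) = 0" using LIMSEQ_unique tendsto_const by blast
    moreover have "integrable R ?f"
      by (rule R.integrable_const_bound[where B = 1])
        (use borel_measurable_continuous_onI[OF c] in auto)
    ultimately have "AE x in R. ?f x = 0" by (subst (asm) integral_nonneg_eq_0_iff_AE) auto
    then have "AE x in R. x \<notin> {..<0}" by eventually_elim (auto simp: max_def min_def split: if_splits)
    then show ?thesis by (subst R.prob_eq_0) auto
  qed
  define T where "T = {x. b \<le> ereal x}"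
  have Tb: "T \<in> sets borel" unfolding T_def by (intro borel_closed closed_Collect_le continuous_intros)
  have pos: "measure R T \<le> e" if e: "0 < e" for e
  proof -
    obtain c where c: "c \<in> open_part b"
        and ev: "\<forall>\<^sub>F n in sequentially. measure (\<eta> n) {x\<in>space (\<eta> n). c < x} < e"
      using tail[OF e] by blast
    obtain c' where c': "c < c'" "ereal c' < b"
      using c ereal_dense2[of "ereal c" b] by (auto simp: open_part_def)
    \<comment> \<open>A ramp from \<open>0\<close> at \<open>c\<close> to \<open>1\<close> at
      \<open>c'\<close>: it lies below the indicator of \<open>{c<..}\<close>, which bounds the
      integrals along the sequence, and above the indicator of \<open>T\<close>, because
      \<open>c'\<close> is still below \<open>b\<close>.\<close>
    let ?f = "\<lambda>x. 1 - cts_step c c' x"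
    have "continuous_on UNIV (cts_step c c')"
      by (rule uniformly_continuous_imp_continuous[OF cts_step_uniformly_continuous[OF c'(1)]])
    then have cont: "continuous_on UNIV ?f" by (intro continuous_intros)
    have bd: "0 \<le> ?f x" "?f x \<le> 1" for x using c'(1) by (auto simp: cts_step_def field_simps)
    have fm: "?f \<in> borel_measurable borel" by (rule borel_measurable_continuous_onI[OF cont])
    have le: "(LINT x|\<eta> n. ?f x) \<le> measure (\<eta> n) {x\<in>space (\<eta> n). c < x}" for n
    proof -
      interpret prob_space "\<eta> n" using \<eta>[of n] by (simp add: space_prob_algebra)
      have A: "{x\<in>space (\<eta> n). c < x} \<in> sets (\<eta> n)" using id[of n] by measurable
      have "(LINT x|\<eta> n. ?f x) \<le> (LINT x|\<eta> n. indicator {x\<in>space (\<eta> n). c < x} x)"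
      proof (rule integral_mono)
        show "integrable (\<eta> n) ?f"
          by (rule integrable_const_bound[where B = 1])
            (use bd measurable_compose[OF id fm] in auto)
        show "integrable (\<eta> n) (indicator {x\<in>space (\<eta> n). c < x} :: real \<Rightarrow> real)"
          using A by (simp add: emeasure_eq_measure)
        show "?f x \<le> indicator {x\<in>space (\<eta> n). c < x} x" if "x \<in> space (\<eta> n)" for x
          using that bd(2)[of x] by (auto simp: indicator_def cts_step_def)
      qed
      then show ?thesis using A by simp
    qed
    have "(LINT x|R. ?f x) \<le> e"
    proof (rule tendsto_upperbound[OF conv[OF cont]])
      show "norm (?f x) \<le> 1" for x using bd[of x] by simp
      show "\<forall>\<^sub>F n in sequentially. (LINT x|\<eta> n. ?f x) \<le> e"
        using ev by eventually_elim (use le in \<open>auto intro: order_trans less_imp_le\<close>)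
    qed simp
    moreover have "(LINT x|R. indicator T x) \<le> (LINT x|R. ?f x)"
    proof (rule integral_mono)
      show "integrable R ?f"
        by (rule R.integrable_const_bound[where B = 1]) (use bd fm in auto)
      show "integrable R (indicator T :: real \<Rightarrow> real)"
        using Tb by (simp add: R.emeasure_eq_measure)
      show "indicator T x \<le> ?f x" for x
      proof (cases "x \<in> T")
        case True
        then have "b \<le> ereal x" by (simp add: T_def)
        with c'(2) have "ereal c' < ereal x" by (rule less_le_trans)
        then show ?thesis using c'(1) by (simp add: cts_step_def)
      qed (use bd in simp)
    qed
    ultimately show ?thesis using Tb by simp
  qed
  have "measure R T \<le> 0" by (rule field_le_epsilon) (use pos in simp)
  then have "measure R T = 0" by (simp add: measure_le_0_iff)
  moreover have "half_open b = space R - ({..<0} \<union> T)"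
    by (auto simp: half_open_def T_def not_less)
  moreover have "measure R ({..<0} \<union> T) \<le> measure R {..<0} + measure R T"
    using Tb by (intro measure_Un_le) auto
  ultimately show ?thesis
    using neg Tb R.prob_compl[of "{..<0} \<union> T"] by (simp add: measure_le_0_iff)
qed

lemma restricted_distribution:
  assumes R: "real_distribution R" and half: "measure R (half_open b) = 1"
  obtains \<eta> where "\<eta> \<in> distributions b" "distr \<eta> borel (\<lambda>x. x) = R"
proof
  interpret R: real_distribution R by (rule R)
  let ?\<eta> = "restrict_space R (half_open b)"
  have H: "half_open b \<in> sets R" by simp
  have s: "sets ?\<eta> = sets (state_space b)" by (rule sets_restrict_space_cong) simp
  moreover have "prob_space ?\<eta>"
    using half H by (intro prob_space_restrict_space) (auto simp: R.emeasure_eq_measure)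
  ultimately show "?\<eta> \<in> distributions b" by (simp add: space_prob_algebra)
  show "distr ?\<eta> borel (\<lambda>x. x) = R"
  proof (rule measure_eqI)
    fix A assume "A \<in> sets (distr ?\<eta> borel (\<lambda>x. x))"
    then have A: "A \<in> sets borel" by simp
    have id: "(\<lambda>x. x) \<in> borel_measurable ?\<eta>"
      by (rule measurable_restrict_space1) (simp add: measurable_ident_sets)
    have "emeasure (distr ?\<eta> borel (\<lambda>x. x)) A = emeasure ?\<eta> (A \<inter> half_open b)"
      using id A by (simp add: emeasure_distr space_restrict_space)
    also have "\<dots> = emeasure R (A \<inter> half_open b)"
      using H A by (intro emeasure_restrict_space) auto
    also have "\<dots> = emeasure R A"
    proof (rule emeasure_eq_AE)
      have "AE x in R. x \<in> half_open b" using half H by (simp add: R.prob_eq_1)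
      then show "AE x in R. x \<in> A \<inter> half_open b \<longleftrightarrow> x \<in> A" by eventually_elim auto
    qed (use A in auto)
    finally show "emeasure (distr ?\<eta> borel (\<lambda>x. x)) A = emeasure R A" .
  qed simp
qed

section \<open>Passing hitting laws to the limit\<close>

lemma
  fixes g :: "ennreal \<Rightarrow> real"
  assumes g: "continuous_on UNIV g" "\<And>t. norm (g t) \<le> B"
  shows continuous_bounded_expectation: "continuous_on (half_open b) (\<lambda>x. LINT \<omega>|P x. g (T0 \<omega>))"
    and bounded_expectation: "bounded ((\<lambda>x. LINT \<omega>|P x. g (T0 \<omega>)) ` half_open b)"
proof -
  have gm: "g \<in> borel_measurable borel" by (rule borel_measurable_continuous_onI[OF g(1)])
  have int: "integrable (P x) (\<lambda>\<omega>. B)" if "x \<in> half_open b" for x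
  proof -
    interpret prob_space "P x" by (rule prob_space_P[OF that])
    show ?thesis by simp
  qed
  show "continuous_on (half_open b) (\<lambda>x. LINT \<omega>|P x. g (T0 \<omega>))"
    by (rule continuous_expectation_T0[where w = "\<lambda>_. B"])
      (use gm g int in \<open>auto simp: continuous_on_eq_continuous_at\<close>)
  have "norm (LINT \<omega>|P x. g (T0 \<omega>)) \<le> B" if x: "x \<in> half_open b" for x
  proof -
    interpret prob_space "P x" by (rule prob_space_P[OF x])
    have "norm (LINT \<omega>|P x. g (T0 \<omega>)) \<le> (LINT \<omega>|P x. norm (g (T0 \<omega>)))" by (rule integral_norm_bound)
    also have "\<dots> \<le> (LINT \<omega>|P x. B)"
      using g(2) measurable_compose[OF measurable_T0_P[OF x] gm]
      by (intro integral_mono int x integrable_const_bound[where B = B]) auto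
    finally show ?thesis by (simp add: prob_space)
  qed
  then show "bounded ((\<lambda>x. LINT \<omega>|P x. g (T0 \<omega>)) ` half_open b)" by (auto simp: bounded_iff)
qed

text \<open>The expectation of \<open>g(T0)\<close> is a bounded continuous function of the starting
  point, hence a test function for the convergence of the initial laws. So the same integrals tend
  both to the value for \<open>\<zeta>\<close> and to the exponential one.\<close>

lemma hitting_law_limit:
  fixes \<eta> :: "nat \<Rightarrow> real measure"
  assumes \<eta>: "\<And>n. \<eta> n \<in> distributions b" and \<zeta>: "\<zeta> \<in> distributions b" and l: "0 < l"
    and w: "weak_conv_m (\<lambda>n. distr (\<eta> n) borel (\<lambda>x. x)) (distr \<zeta> borel (\<lambda>x. x))"
    and conv: "weakly_converges (\<lambda>n. hitting_law X P (\<eta> n)) (exponential_law l) sequentially"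
  shows "hitting_law X P \<zeta> = exponential_law l"
proof -
  have E: "prob_space (exponential_law l)" by (rule prob_space_exponential_law[OF l])
  interpret E: prob_space "exponential_law l" by (rule E)
  interpret H: prob_space "hitting_law X P \<zeta>" by (rule prob_space_hitting_law[OF \<zeta>])
  \<comment> \<open>Weak convergence of a constant sequence turns equality of integrals of
    continuous functions into equality of all tails.\<close>
  have "weakly_converges (\<lambda>n::nat. hitting_law X P \<zeta>) (exponential_law l) sequentially"
    unfolding weakly_converges_def
  proof (intro allI impI)
    fix g :: "ennreal \<Rightarrow> real"
    assume g: "continuous_on (space (exponential_law l)) g \<and> bounded (g ` space (exponential_law l))"
    then obtain B where B: "\<And>t. norm (g t) \<le> B" by (auto simp: bounded_iff)
    have gc: "continuous_on UNIV g" using g by simp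
    have gm: "g \<in> borel_measurable borel" by (rule borel_measurable_continuous_onI[OF gc])
    have eq: "(LINT t|hitting_law X P \<mu>. g t) = (LINT x|\<mu>. LINT \<omega>|P x. g (T0 \<omega>))" if "\<mu> \<in> distributions b" for \<mu>
      by (rule integral_hitting_law[OF that gm]) (use B in auto)
    have "(\<lambda>n. LINT t|hitting_law X P (\<eta> n). g t) \<longlonglongrightarrow> (LINT t|hitting_law X P \<zeta>. g t)"
      unfolding eq[OF \<eta>] eq[OF \<zeta>]
      by (rule weak_convergence_from_line[OF \<eta> \<zeta> w])
        (rule continuous_bounded_expectation[OF gc B], rule bounded_expectation[OF gc B])
    moreover have "(\<lambda>n. LINT t|hitting_law X P (\<eta> n). g t) \<longlonglongrightarrow> (LINT t|exponential_law l. g t)"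
      using conv g unfolding weakly_converges_def by blast
    ultimately have "(LINT t|hitting_law X P \<zeta>. g t) = (LINT t|exponential_law l. g t)"
      by (rule LIMSEQ_unique)
    then show "(\<lambda>n. LINT t|hitting_law X P \<zeta>. g t) \<longlonglongrightarrow> (LINT t|exponential_law l. g t)" by simp
  qed
  then have "(\<lambda>n::nat. measure (hitting_law X P \<zeta>) {ennreal u<..}) \<longlonglongrightarrow> measure (exponential_law l) {ennreal u<..}"
    if "0 \<le> u" for u
    by (rule weak_conv_ennreal_seq(2)[rotated 4])
      (use that \<zeta> E in \<open>auto simp: prob_space_hitting_law sets_hitting_law exponential_law_singleton\<close>)
  then have "measure (hitting_law X P \<zeta>) {ennreal u<..} = measure (exponential_law l) {ennreal u<..}"
    if "0 \<le> u" for u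
    using that LIMSEQ_unique tendsto_const by blast
  then show ?thesis
    by (intro measure_ennreal_eqI)
      (auto simp: sets_hitting_law[OF \<zeta>] E H.prob_space_axioms H.emeasure_eq_measure E.emeasure_eq_measure)
qed

text \<open>Prokhorov's scheme: the laws are tight on the line, and every subsequential limit is
  concentrated on \<open>[0, b)\<close>, has the exponential hitting law and is therefore
  \<open>\<nu>\<close>.\<close>

lemma weak_conv_of_hitting_laws:
  fixes \<eta> :: "nat \<Rightarrow> real measure"
  assumes natural: "natural_boundary b m s" and l: "0 < l"
    and \<eta>: "\<And>n. \<eta> n \<in> distributions b" and \<nu>: "\<nu> \<in> distributions b"
    and unique: "\<And>\<zeta>. \<zeta> \<in> distributions b \<Longrightarrow> hitting_law X P \<zeta> = exponential_law l \<Longrightarrow> \<zeta> = \<nu>"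
    and conv: "weakly_converges (\<lambda>n. hitting_law X P (\<eta> n)) (exponential_law l) sequentially"
  shows "weak_conv_m (\<lambda>n. distr (\<eta> n) borel (\<lambda>x. x)) (distr \<nu> borel (\<lambda>x. x))"
proof -
  have E: "prob_space (exponential_law l)" by (rule prob_space_exponential_law[OF l])
  have tl: "(\<lambda>n. measure (hitting_law X P (\<eta> n)) {ennreal u<..}) \<longlonglongrightarrow> exp (- (l * u))" if "0 \<le> u" for u
    using weak_conv_ennreal_seq(2)[OF _ _ E _ conv that exponential_law_singleton[OF that]]
      prob_space_hitting_law[OF \<eta>] sets_hitting_law[OF \<eta>] that l
    by (simp add: exponential_law_greaterThan)
  have tail: "\<exists>c\<in>open_part b. \<forall>\<^sub>F n in sequentially. measure (\<eta> n) {x\<in>space (\<eta> n). c < x} < e"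
    if "0 < e" for e
    by (rule uniform_tail[OF natural l \<eta> _ that]) (rule tl)
  show ?thesis
  proof (rule tight_subseq_weak_converge)
    show "tight (\<lambda>n. distr (\<eta> n) borel (\<lambda>x. x))" by (rule tight_of_tail[OF \<eta> tail])
    show "real_distribution (distr (\<eta> n) borel (\<lambda>x. x))" "real_distribution (distr \<nu> borel (\<lambda>x. x))" for n
      by (rule line_distribution[OF \<eta>], rule line_distribution[OF \<nu>])
    fix r :: "nat \<Rightarrow> nat" and R
    assume r: "strict_mono r" and R: "real_distribution R"
      and w: "weak_conv_m ((\<lambda>n. distr (\<eta> n) borel (\<lambda>x. x)) \<circ> r) R"
    have w': "weak_conv_m (\<lambda>n. distr (\<eta> (r n)) borel (\<lambda>x. x)) R" using w by (simp add: comp_def)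
    have rinf: "filterlim r sequentially sequentially" using r by (rule filterlim_subseq)
    have "\<exists>c\<in>open_part b. \<forall>\<^sub>F n in sequentially. measure (\<eta> (r n)) {x\<in>space (\<eta> (r n)). c < x} < e"
      if "0 < e" for e
      using tail[OF that] eventually_compose_filterlim[OF _ rinf] by blast
    then have "measure R (half_open b) = 1" by (rule weak_limit_in_half_open[OF \<eta> _ R w'])
    then obtain \<zeta> where \<zeta>: "\<zeta> \<in> distributions b" "distr \<zeta> borel (\<lambda>x. x) = R"
      by (rule restricted_distribution[OF R])
    have "weakly_converges (\<lambda>n. hitting_law X P (\<eta> (r n))) (exponential_law l) sequentially"
      using conv filterlim_compose[OF _ rinf] unfolding weakly_converges_def by blast
    then have "hitting_law X P \<zeta> = exponential_law l"
      using w' by (intro hitting_law_limit[OF \<eta> \<zeta>(1) l]) (simp add: \<zeta>(2))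
    then show "weak_conv_m ((\<lambda>n. distr (\<eta> n) borel (\<lambda>x. x)) \<circ> r) (distr \<nu> borel (\<lambda>x. x))"
      using unique[OF \<zeta>(1)] \<zeta>(2) w by simp
  qed
qed

text \<open>Conditioning on survival divides by its probability and restricts the integral of the
  survival probability from \<open>X t\<close> to the survival event. The restriction changes
  nothing, since off that event \<open>X t = 0\<close>, and the Markov property then gives survival
  up to \<open>t + u\<close>.\<close>

lemma
  assumes \<mu>: "\<mu> \<in> distributions b" and t: "0 \<le> t"
    and pos: "0 < emeasure (initial_law P \<mu>) (survival \<Omega> X t)"
  shows conditional_law_distribution: "conditional_law \<Omega> b X P \<mu> t \<in> distributions b"
    and hitting_law_conditional: "0 \<le> u \<Longrightarrow>
      measure (hitting_law X P (conditional_law \<Omega> b X P \<mu> t)) {ennreal u<..} =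
      measure (initial_law P \<mu>) (survival \<Omega> X (t + u)) / measure (initial_law P \<mu>) (survival \<Omega> X t)"
proof -
  let ?M = "initial_law P \<mu>" and ?S = "survival \<Omega> X t"
  interpret M: prob_space ?M by (rule prob_space_initial_law[OF \<mu>])
  note sM = sets_initial_law[OF \<mu>]
  have S: "?S \<in> sets ?M" unfolding sM by (rule survival_sets)
  have U: "prob_space (uniform_measure ?M ?S)"
    using pos by (intro prob_space_uniform_measure) (auto simp: M.emeasure_eq_measure)
  have XM: "X t \<in> ?M \<rightarrow>\<^sub>M state_space b"
    using measurable_X[OF t] measurable_cong_sets[OF sM refl] by blast
  then have XU: "X t \<in> uniform_measure ?M ?S \<rightarrow>\<^sub>M state_space b" by simp
  show *: "conditional_law \<Omega> b X P \<mu> t \<in> distributions b"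
    unfolding conditional_law_def
    using prob_space.prob_space_distr[OF U XU] by (simp add: space_prob_algebra)
  assume u: "0 \<le> u"
  let ?k = "\<lambda>\<omega>. emeasure (P (X t \<omega>)) (survival \<Omega> X u)"
  have k: "?k \<in> borel_measurable (path_algebra \<Omega> X)"
    by (rule measurable_compose[OF measurable_X[OF t] measurable_kernel_emeasure[OF survival_sets]])
  have kM: "?k \<in> borel_measurable ?M" using k measurable_cong_sets[OF sM refl] by blast
  have "emeasure (hitting_law X P (conditional_law \<Omega> b X P \<mu> t)) {ennreal u<..} =
      (\<integral>\<^sup>+x. emeasure (P x) (survival \<Omega> X u) \<partial>conditional_law \<Omega> b X P \<mu> t)"
    by (simp only: emeasure_hitting_law_greaterThan[OF *] emeasure_initial_law_survival[OF *])
  also have "\<dots> = (\<integral>\<^sup>+\<omega>. ?k \<omega> \<partial>uniform_measure ?M ?S)"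
    unfolding conditional_law_def
    by (rule nn_integral_distr[OF XU]) (use measurable_kernel_emeasure[OF survival_sets] in simp)
  also have "\<dots> = (\<integral>\<^sup>+\<omega>. ?k \<omega> * indicator ?S \<omega> \<partial>?M) / emeasure ?M ?S"
    by (rule nn_integral_uniform_measure[OF kM S])
  also have "(\<integral>\<^sup>+\<omega>. ?k \<omega> * indicator ?S \<omega> \<partial>?M) = (\<integral>\<^sup>+x. (\<integral>\<^sup>+\<omega>. ?k \<omega> * indicator ?S \<omega> \<partial>P x) \<partial>\<mu>)"
    by (intro nn_integral_initial_law \<mu> borel_measurable_times_ennreal k borel_measurable_indicator survival_sets)
  also have "\<dots> = (\<integral>\<^sup>+x. emeasure (P x) (survival \<Omega> X (t + u)) \<partial>\<mu>)"
  proof (intro nn_integral_cong)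
    fix x assume "x \<in> space \<mu>"
    then have x: "x \<in> half_open b" by (simp add: space_distributions[OF \<mu>])
    have "(\<integral>\<^sup>+\<omega>. ?k \<omega> * indicator ?S \<omega> \<partial>P x) = (\<integral>\<^sup>+\<omega>. ?k \<omega> \<partial>P x)"
      by (rule nn_integral_cong_AE) (use AE_dead_after_survival[OF x t, of u] in \<open>auto elim!: eventually_mono\<close>)
    then show "(\<integral>\<^sup>+\<omega>. ?k \<omega> * indicator ?S \<omega> \<partial>P x) = emeasure (P x) (survival \<Omega> X (t + u))"
      by (simp add: survival_Markov[OF x t u])
  qed
  also have "\<dots> = emeasure ?M (survival \<Omega> X (t + u))"
    by (rule emeasure_initial_law_survival[OF \<mu>, symmetric])
  finally have eq: "emeasure (hitting_law X P (conditional_law \<Omega> b X P \<mu> t)) {ennreal u<..} =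
      emeasure ?M (survival \<Omega> X (t + u)) / emeasure ?M ?S" .
  interpret H: prob_space "hitting_law X P (conditional_law \<Omega> b X P \<mu> t)" by (rule prob_space_hitting_law[OF *])
  have "0 < measure ?M ?S" using pos by (simp add: M.emeasure_eq_measure)
  then have "ennreal (measure (hitting_law X P (conditional_law \<Omega> b X P \<mu> t)) {ennreal u<..}) =
      ennreal (measure ?M (survival \<Omega> X (t + u)) / measure ?M ?S)"
    using eq by (simp add: M.emeasure_eq_measure H.emeasure_eq_measure divide_ennreal)
  then show "measure (hitting_law X P (conditional_law \<Omega> b X P \<mu> t)) {ennreal u<..} =
      measure ?M (survival \<Omega> X (t + u)) / measure ?M ?S"
    by simp
qed

end

lemma (in diffusion) distribution_at_0:
  assumes \<mu>: "\<mu> \<in> distributions b" and AE: "AE x in \<mu>. x = 0"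
  shows "\<mu> = return (state_space b) 0"
proof -
  have s: "sets \<mu> = sets (state_space b)" using \<mu> by (simp add: space_prob_algebra)
  interpret prob_space \<mu> using \<mu> by (simp add: space_prob_algebra)
  have id: "(\<lambda>x. x) \<in> \<mu> \<rightarrow>\<^sub>M state_space b" by (rule measurable_ident_sets[OF s])
  have "\<mu> = distr \<mu> (state_space b) (\<lambda>x. x)" by (rule distr_id2[OF s[symmetric], symmetric])
  also have "\<dots> = distr \<mu> (state_space b) (\<lambda>_. 0)"
    using id half_open_0 AE by (intro distr_cong_AE) (auto simp: space_state_space)
  also have "\<dots> = return (state_space b) 0"
    using half_open_0 by (intro distr_const) (simp add: space_state_space)
  finally show ?thesis .
qed

theorem theorem1p1:
  fixes \<Omega> :: "'w set" and b :: ereal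
    and X :: "real \<Rightarrow> 'w \<Rightarrow> real" and P :: "real \<Rightarrow> 'w measure"
    and m :: "real measure" and s :: "real \<Rightarrow> real"
    and l :: real and \<nu> \<mu> :: "real measure"
  assumes X: "dm_ds_diffusion \<Omega> b X P m s"
    and natural: "natural_boundary b m s"
    and bottom: "spectral_bottom b m s > 0"
    and scale_b: "scale_at_b b s = \<infinity>"
    and uniqueness: "first_hitting_uniqueness X P (P_exp b X P)"
    and l: "l > 0"
    and \<nu>: "\<nu> \<in> distributions b" "emeasure \<nu> {0} = 0"
    and \<nu>_exp: "hitting_law X P \<nu> = exponential_law l"
    and \<mu>: "\<mu> \<in> distributions b" "\<mu> \<noteq> return (state_space b) 0"
  shows "((\<forall>u>0. ((\<lambda>t. measure (initial_law P \<mu>) (survival \<Omega> X (t + u))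
              / measure (initial_law P \<mu>) (survival \<Omega> X t)) \<longlongrightarrow> exp (- (l * u))) at_top)
          \<longleftrightarrow> weakly_converges (\<lambda>t. hitting_law X P (conditional_law \<Omega> b X P \<mu> t))
                (exponential_law l) at_top)
       \<and> (weakly_converges (\<lambda>t. hitting_law X P (conditional_law \<Omega> b X P \<mu> t))
                (exponential_law l) at_top
          \<longleftrightarrow> weakly_converges (conditional_law \<Omega> b X P \<mu>) \<nu> at_top)"
    (is "(?i \<longleftrightarrow> ?ii) \<and> (?ii \<longleftrightarrow> ?iii)")
proof -
  interpret dm_ds_diffusion \<Omega> b X P m s by (rule X)
  \<comment> \<open>Two facts about the diffusion itself are extracted from \<open>\<nu>\<close>:
    absorption from every point, which opens the locale, and positive survival probability at all
    times from every \<open>x \<noteq> 0\<close>.\<close>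
  note abs = exponential_hitting_law_imp_absorbed[OF \<nu> l \<nu>_exp]
  interpret absorbed_dm_ds_diffusion \<Omega> b X P m s
    by unfold_locales (rule abs(1))
  let ?M = "initial_law P \<mu>" and ?c = "conditional_law \<Omega> b X P \<mu>"
  interpret M: prob_space ?M by (rule prob_space_initial_law[OF \<mu>(1)])
  \<comment> \<open>This is where \<open>\<mu>\<close> differing from the point mass at
    \<open>0\<close> enters: otherwise conditioning on survival would be conditioning on a null
    event.\<close>
  have pos: "0 < emeasure ?M (survival \<Omega> X t)" if t: "0 \<le> t" for t
  proof (rule ccontr)
    assume "\<not> 0 < emeasure ?M (survival \<Omega> X t)"
    then have "(\<integral>\<^sup>+x. emeasure (P x) (survival \<Omega> X t) \<partial>\<mu>) = 0"
      using emeasure_initial_law_survival[OF \<mu>(1)] by simp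
    then have "AE x in \<mu>. emeasure (P x) (survival \<Omega> X t) = 0"
      using measurable_distributions[OF \<mu>(1) measurable_kernel_emeasure[OF survival_sets]]
      by (simp add: nn_integral_0_iff_AE)
    then have "AE x in \<mu>. x = 0"
      using AE_space
    proof eventually_elim
      fix x assume "emeasure (P x) (survival \<Omega> X t) = 0" "x \<in> space \<mu>"
      then show "x = 0" using abs(2)[of x t] t by (auto simp: space_distributions[OF \<mu>(1)])
    qed
    then show False using distribution_at_0[OF \<mu>(1)] \<mu>(2) by blast
  qed
  have cd: "?c t \<in> distributions b" if "0 \<le> t" for t
    by (rule conditional_law_distribution[OF \<mu>(1) that pos[OF that]])
  have ch: "measure (hitting_law X P (?c t)) {ennreal u<..} =
      measure ?M (survival \<Omega> X (t + u)) / measure ?M (survival \<Omega> X t)" if "0 \<le> t" "0 \<le> u" for t u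
    by (rule hitting_law_conditional[OF \<mu>(1) that(1) pos[OF that(1)] that(2)])
  have mpos: "0 < measure ?M (survival \<Omega> X t)" if "0 \<le> t" for t
    using pos[OF that] by (simp add: M.emeasure_eq_measure)
  have "?ii \<longleftrightarrow> (\<forall>u\<ge>0. ((\<lambda>t. measure (hitting_law X P (?c t)) {ennreal u<..}) \<longlongrightarrow> exp (- (l * u))) at_top)"
    using cd l by (intro weakly_converges_at_top_iff prob_space_hitting_law sets_hitting_law)
  also have "\<dots> \<longleftrightarrow> (\<forall>u\<ge>0. ((\<lambda>t. measure ?M (survival \<Omega> X (t + u)) / measure ?M (survival \<Omega> X t))
      \<longlongrightarrow> exp (- (l * u))) at_top)"
    using ch by (intro all_cong tendsto_cong) (auto intro!: eventually_mono[OF eventually_ge_at_top[of 0]])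
  also have "\<dots> \<longleftrightarrow> ?i"
  proof
    assume i: ?i
    show "\<forall>u\<ge>0. ((\<lambda>t. measure ?M (survival \<Omega> X (t + u)) / measure ?M (survival \<Omega> X t))
      \<longlongrightarrow> exp (- (l * u))) at_top"
    proof (intro allI impI)
      fix u :: real assume "0 \<le> u"
      show "((\<lambda>t. measure ?M (survival \<Omega> X (t + u)) / measure ?M (survival \<Omega> X t))
        \<longlongrightarrow> exp (- (l * u))) at_top"
      \<comment> \<open>(i) leaves out \<open>u = 0\<close>, where the quotient is identically
        \<open>1\<close> for \<open>t \<ge> 0\<close>, its denominator being positive.\<close>
      proof (cases "u = 0")
        case True
        have "\<forall>\<^sub>F t in at_top. measure ?M (survival \<Omega> X (t + u)) / measure ?M (survival \<Omega> X t) = exp (- (l * u))"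
          using eventually_ge_at_top[of "0::real"]
          by eventually_elim (use mpos True in \<open>simp add: less_imp_neq[symmetric]\<close>)
        then show ?thesis by (rule tendsto_eventually)
      qed (use i \<open>0 \<le> u\<close> in simp)
    qed
  qed simp
  finally have i_ii: "?i \<longleftrightarrow> ?ii" by blast
  have "?ii \<longleftrightarrow> ?iii"
  proof
    assume ii: ?ii
    \<comment> \<open>Both laws lie in \<open>P_exp\<close> with the same rate \<open>l\<close>, so
      injectivity of the hitting law on that class identifies them.\<close>
    have unique: "\<zeta> = \<nu>" if "\<zeta> \<in> distributions b" "hitting_law X P \<zeta> = exponential_law l" for \<zeta>
      using uniqueness[unfolded first_hitting_uniqueness_def]
      by (rule inj_onD) (use that \<nu>(1) \<nu>_exp l in \<open>auto simp: P_exp_def\<close>)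
    show ?iii
      unfolding weakly_converges_def
    proof (intro allI impI tendsto_at_topI_sequentially)
      fix f :: "real \<Rightarrow> real" and T :: "nat \<Rightarrow> real"
      assume f: "continuous_on (space \<nu>) f \<and> bounded (f ` space \<nu>)" and T: "filterlim T at_top sequentially"
      have ev: "\<forall>\<^sub>F n in sequentially. max 0 (T n) = T n"
        using T by (auto simp: filterlim_at_top max_def elim: eventually_mono)
      have T': "filterlim (\<lambda>n. max 0 (T n)) at_top sequentially"
        using T filterlim_cong[OF refl refl ev] by blast
      have conv: "weakly_converges (\<lambda>n. hitting_law X P (?c (max 0 (T n)))) (exponential_law l) sequentially"
        using ii filterlim_compose[OF _ T'] unfolding weakly_converges_def by blast
      have d: "?c (max 0 (T n)) \<in> distributions b" for n by (rule cd) simp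
      have "(\<lambda>n. LINT x|?c (max 0 (T n)). f x) \<longlonglongrightarrow> (LINT x|\<nu>. f x)"
        using f by (intro weak_convergence_from_line[OF d \<nu>(1)]
            weak_conv_of_hitting_laws[OF natural l d \<nu>(1) unique conv]) (auto simp: space_distributions[OF \<nu>(1)])
      then show "(\<lambda>n. LINT x|?c (T n). f x) \<longlonglongrightarrow> (LINT x|\<nu>. f x)"
        by (rule Lim_transform_eventually) (use ev in eventually_elim, simp)
    qed
  next
    assume iii: ?iii
    show ?ii
      unfolding weakly_converges_def
    proof (intro allI impI)
      fix g :: "ennreal \<Rightarrow> real"
      assume g: "continuous_on (space (exponential_law l)) g \<and> bounded (g ` space (exponential_law l))"
      then obtain B where B: "\<And>t. norm (g t) \<le> B" by (auto simp: bounded_iff)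
      have gc: "continuous_on UNIV g" using g by simp
      have gm: "g \<in> borel_measurable borel" by (rule borel_measurable_continuous_onI[OF gc])
      have eq: "(LINT t|hitting_law X P \<zeta>. g t) = (LINT x|\<zeta>. LINT \<omega>|P x. g (T0 \<omega>))" if "\<zeta> \<in> distributions b" for \<zeta>
        by (rule integral_hitting_law[OF that gm]) (use B in auto)
      \<comment> \<open>The expectation of \<open>g(T0)\<close>, as a function of the starting
        point, is bounded and continuous on \<open>[0, b)\<close>; it is inserted as test function
        into (iii).\<close>
      have "((\<lambda>t. LINT x|?c t. LINT \<omega>|P x. g (T0 \<omega>)) \<longlongrightarrow> (LINT x|\<nu>. LINT \<omega>|P x. g (T0 \<omega>))) at_top"
        using iii continuous_bounded_expectation[OF gc B] bounded_expectation[OF gc B]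
        unfolding weakly_converges_def space_distributions[OF \<nu>(1)] by blast
      then have "((\<lambda>t. LINT x|?c t. LINT \<omega>|P x. g (T0 \<omega>)) \<longlongrightarrow> (LINT t|exponential_law l. g t)) at_top"
        using eq[OF \<nu>(1)] by (simp add: \<nu>_exp)
      then show "((\<lambda>t. LINT s|hitting_law X P (?c t). g s) \<longlongrightarrow> (LINT t|exponential_law l. g t)) at_top"
        by (rule Lim_transform_eventually)
          (use eventually_ge_at_top[of "0::real"] in eventually_elim, simp add: eq cd)
    qed
  qed
  then show ?thesis using i_ii by blast
qed

end
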